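(* Let $\phi_{ABCD}$ be a massless spin-2 field on the Minkowski spacetime with F-gauge components $\phi_0,\dots,\phi_4$ admitting the expansion given in the context and satisfying the regularity condition $E^\ast_{p,m}=I^\ast_{p,m}=0$. For each integer $n\ge1$ there is a numerical coefficient $Q^-(n)$, depending only on $n$, such that the Newman–Penrose constants $\bar G^{n-1}_m$ at $\mathscr I^-$ are given by $$\bar G_m^{n-1}=Q^-(n)\,D_{n+2,n+1,m},\qquad |m|\le n+1,$$ where $D_{n+2,n+1,m}$ is determined by the initial data $a_{0,n+2;n+1,m}(0)$ and $a_{4,n+2;n+1,m}(0)$ as specified in the context.
   Context: Geometry. $(\mathcal M,g)$ is the conformal extension of Minkowski space with coordinates $\tau\in[-1,1]$, $\rho\ge0$ and points of $\mathbb S^2$, with $g=d\tau^2-\rho^{-2}(1-\tau^2)d\rho^2+2\rho^{-1}\tau\,d\tau\,d\rho-\sigma=\Theta^2\tilde\eta$, where $\Theta=\rho(1-\tau^2)$, $\sigma$ is the unit round metric and $\tilde\eta=d\tilde t^2-d\tilde\rho^2-\tilde\rho^2\sigma$ is the Minkowski metric, with $\tilde t=\tau/(\rho(1-\tau^2))$, $\tilde\rho=1/(\rho(1-\tau^2))$. $\mathscr I^\pm=\{\tau=\pm1\}$. The F-frame is $e_{00'}=\tfrac{\sqrt2}{2}((1-\tau)\partial_\tau+\rho\partial_\rho)$, $e_{11'}=\tfrac{\sqrt2}{2}((1+\tau)\partial_\tau-\rho\partial_\rho)$, $e_{01'}=\tfrac{\sqrt2}{2}\partial_+$, $e_{10'}=\tfrac{\sqrt2}{2}\partial_-$,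 with $\partial_+=\overline{\partial_-}$ a complex null frame on $\mathbb S^2$, $\sigma^{-1}=\tfrac12(\partial_+\otimes\partial_-+\partial_-\otimes\partial_+)$. Harmonics. $Y_{s;\ell,m}$ are the $L^2(\mathbb S^2)$-orthonormal spin-weighted spherical harmonics, with $\eth Y_{s;\ell,m}=\sqrt{(\ell-s)(\ell+s+1)}\,Y_{s+1;\ell,m}$, $\bar\eth Y_{s;\ell,m}=-\sqrt{(\ell+s)(\ell-s+1)}\,Y_{s-1;\ell,m}$. Field. The massless spin-2 equation $\nabla_{A'}{}^{A}\phi_{ABCD}=0$ on $(\mathcal M,g)$, for the components $\phi_0,\dots,\phi_4$ (spin weights $2,1,0,-1,-2$) in the spin dyad adapted to the F-frame, reads $(1+\tau)\partial_\tau\phi_0-\rho\partial_\rho\phi_0+\eth\phi_1=-2\phi_0$, $\partial_\tau\phi_1+\tfrac12\bar\eth\phi_0+\tfrac12\eth\phi_2=-\phi_1$, $\partial_\tau\phi_2+\tfrac12\bar\eth\phi_1+\tfrac12\eth\phi_3=0$, $\partial_\tau\phi_3+\tfrac12\bar\eth\phi_2+\tfrac12\eth\phi_4=\phi_3$, $(1-\tau)\partial_\tau\phi_4+\rho\partial_\rho\phi_4+\bar\eth\phi_3=2\phi_4$, together with $\tau\partial_\tau\phi_k-\rho\partial_\rho\phi_k+\tfrac12\eth\phi_{k+1}-\tfrac12\bar\eth\phi_{k-1}=0$ for $k=1,2,3$. The fields are smooth in $(\tau,\rho)$ and have expansions near $\rho=0$ $$\phi_n=\sum_{p\ge|2-n|}\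 \sum_{\ell=|2-n|}^{p}\ \sum_{m=-\ell}^{\ell}\frac1{p!}\,a_{n,p;\ell,m}(\tau)\,Y_{2-n;\ell,m}\,\rho^p,\qquad n=0,\dots,4,$$ convergent together with all termwise derivatives, locally uniformly for $|\tau|\le1$, $0\le\rho<\rho_0$. Regularity condition. For $\ell=p$ one has $a_{0,p;p,m}=(\tfrac{1-\tau}{2})^{p+2}(\tfrac{1+\tau}{2})^{p-2}\big(E_{p,m}+E^\ast_{p,m}\int_0^\tau\frac{ds}{(1+s)^{p-1}(1-s)^{p+3}}\big)$ and $a_{4,p;p,m}=(\tfrac{1+\tau}{2})^{p+2}(\tfrac{1-\tau}{2})^{p-2}\big(I_{p,m}+I^\ast_{p,m}\int_0^\tau\frac{ds}{(1-s)^{p-1}(1+s)^{p+3}}\big)$ with constants $E,E^\ast,I,I^\ast$; the condition is $E^\ast_{p,m}=I^\ast_{p,m}=0$ for all $p\ge2$, $|m|\le p$. Constants $D$. For $2\le\ell<p$ put $Q^1_{p,\ell}(\tau)=(\tfrac{1-\tau}{2})^{p+2}P_{\ell-2}^{(p+2,-p+2)}(\tau)$, $Q^3_{p,\ell}(\tau)=(\tfrac{1+\tau}{2})^{p-2}P_{\ell+2}^{(-p-2,p-2)}(\tau)$, where $P_k^{(\alpha,\beta)}(x)=\sum_{s=0}^k\binom{k+\alpha}{k-s}\binom{k+\beta}{s}\left(\tfrac{x-1}{2}\right)^s\left(\tfrac{x+1}{2}\right)^{k-s}$ are Jacobi polynomials (generalized binomial coefficients), and $$X_{p,\ell}(\tau)=\begin{pmatrix}Q^1_{p,\ell}(\tau)&(-1)^{\ell}Q^3_{p,\ell}(\tau)\\(-1)^{\ell}Q^3_{p,\ell}(-\tau)&Q^1_{p,\ell}(-\tau)\end{pmatrix}.$$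 Then $(C_{p,\ell,m},D_{p,\ell,m})^{T}:=X_{p,\ell}(0)^{-1}(a_{0,p;\ell,m}(0),a_{4,p;\ell,m}(0))^{T}$. NP constants at $\mathscr I^-$ (the bar is not complex conjugation). Let $\phi_4'=\frac{16}{\rho^2(1-\tau)^4}\phi_0$ and $\tilde\phi_4=\tilde\rho^{-5}\phi_4'$ (the component of the physical spin-2 field in the dyad associated with the NP frame at $\mathscr I^-$). At fixed advanced time $\tilde v=\tilde t+\tilde\rho=1/(\rho(1-\tau))$ and fixed angles, as $\tilde\rho\to\infty$, $\tilde\phi_4=\sum_{k=0}^N\tilde\phi_4^k\,\tilde\rho^{-5-k}+o(\tilde\rho^{-5-N})$ for every $N$, with $\tilde\phi_4^k$ independent of $\tilde\rho$. For $n\ge0$, $|m|\le n+2$, $\bar G^n_m=\int_{\mathcal C}\overline{Y_{2;n+2,m}}\,\tilde\phi_4^{n+1}\,dS$, where $\mathcal C\cong\mathbb S^2$ is a cut $\{\tau=-1,\rho=\rho_\star\}$ of $\mathscr I^-$ with $0<\rho_\star<\rho_0$, and $dS$ is the area element of $\sigma$; the value is independent of the cut. *)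

theory Defs
  imports "HOL-Analysis.Analysis" "HOL-Library.Landau_Symbols"
begin

section \<open>Spin-weighted functions on the sphere\<close>

text \<open>
  Spin-weighted functions are represented by their components with respect to the standard
  dyad of the polar coordinates \<open>(\<theta>, \<psi>)\<close>, with \<open>0 < \<theta> < \<pi>\<close> and \<open>\<psi>\<close> real (of period \<open>2 \<pi>\<close>).
  The operator \<open>\<eth>\<close> raises the spin weight by one, its conjugate lowers it by one; the sign
  convention is the one for which
  \<open>\<eth> Y\<^sub>s = sqrt ((l - s) (l + s + 1)) Y\<^sub>s\<^sub>+\<^sub>1\<close> and
  \<open>eth_bar Y\<^sub>s = - sqrt ((l + s) (l - s + 1)) Y\<^sub>s\<^sub>-\<^sub>1\<close>.
\<close>

definition eth :: "int \<Rightarrow> (real \<Rightarrow> real \<Rightarrow> complex) \<Rightarrow> real \<Rightarrow> real \<Rightarrow> complex" where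
  "eth s f \<theta> \<psi> =
     - (vector_derivative (\<lambda>t. f t \<psi>) (at \<theta>)
        + \<i> / of_real (sin \<theta>) * vector_derivative (\<lambda>t. f \<theta> t) (at \<psi>)
        - of_int s * of_real (cot \<theta>) * f \<theta> \<psi>)"

definition eth_bar :: "int \<Rightarrow> (real \<Rightarrow> real \<Rightarrow> complex) \<Rightarrow> real \<Rightarrow> real \<Rightarrow> complex" where
  "eth_bar s f \<theta> \<psi> =
     - (vector_derivative (\<lambda>t. f t \<psi>) (at \<theta>)
        - \<i> / of_real (sin \<theta>) * vector_derivative (\<lambda>t. f \<theta> t) (at \<psi>)
        + of_int s * of_real (cot \<theta>) * f \<theta> \<psi>)"

text \<open>
  The orthonormal spin-weighted spherical harmonics \<open>Y\<^sub>s\<^sub>;\<^sub>l\<^sub>,\<^sub>m\<close> (Goldberg et al.), meaningful for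
  \<open>\<bar>s\<bar> \<le> l\<close> and \<open>\<bar>m\<bar> \<le> l\<close>. The range of summation consists of the indices \<open>r\<close> for which both
  binomial coefficients are nonzero; on it all arguments of \<open>nat\<close> are nonnegative.
\<close>

definition swsh :: "int \<Rightarrow> nat \<Rightarrow> int \<Rightarrow> real \<Rightarrow> real \<Rightarrow> complex" where
  "swsh s l m \<theta> \<psi> =
     of_real
       ((-1) powi m
        * sqrt (fact (nat (int l + m)) * fact (nat (int l - m)) * (2 * real l + 1)
                / (4 * pi * fact (nat (int l + s)) * fact (nat (int l - s))))
        * (\<Sum>r \<in> {max 0 (m - s)..min (int l - s) (int l + m)}.
             (-1) ^ nat (int l - s - r)
             * real (nat (int l - s) choose nat r)
             * real (nat (int l + s) choose nat (r + s - m))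
             * cos (\<theta> / 2) ^ nat (2 * r + s - m)
             * sin (\<theta> / 2) ^ nat (2 * int l - 2 * r - s + m)))
     * cis (of_int m * \<psi>)"

definition sphere_integral :: "(real \<Rightarrow> real \<Rightarrow> complex) \<Rightarrow> complex" where
  "sphere_integral f =
     (LINT x : {0<..<pi} \<times> {0..2 * pi} | lborel. sin (fst x) *\<^sub>R f (fst x) (snd x))"


section \<open>Functions on the conformal extension of Minkowski space\<close>

text \<open>Arguments are \<open>\<tau> \<in> [-1, 1]\<close>, \<open>\<rho> \<ge> 0\<close>, \<open>\<theta>\<close>, \<open>\<psi>\<close>; derivatives at the ends of the ranges
  of \<open>\<tau>\<close> and \<open>\<rho>\<close> are one-sided.\<close>

type_synonym field = "real \<Rightarrow> real \<Rightarrow> real \<Rightarrow> real \<Rightarrow> complex"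

definition d_tau :: "field \<Rightarrow> field" where
  "d_tau f \<tau> \<rho> \<theta> \<psi> = vector_derivative (\<lambda>t. f t \<rho> \<theta> \<psi>) (at \<tau> within {-1..1})"

definition d_rho :: "field \<Rightarrow> field" where
  "d_rho f \<tau> \<rho> \<theta> \<psi> = vector_derivative (\<lambda>r. f \<tau> r \<theta> \<psi>) (at \<rho> within {0..})"

definition eth_field :: "int \<Rightarrow> field \<Rightarrow> field" where
  "eth_field s f \<tau> \<rho> = eth s (f \<tau> \<rho>)"

definition eth_bar_field :: "int \<Rightarrow> field \<Rightarrow> field" where
  "eth_bar_field s f \<tau> \<rho> = eth_bar s (f \<tau> \<rho>)"

datatype deriv_op = Tau | Rho | Eth | EthBar

text \<open>\<open>field_deriv w s f\<close> applies the operators in the list \<open>w\<close>, from left to right, to the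
  function \<open>f\<close> of spin weight \<open>s\<close>.\<close>

primrec field_deriv :: "deriv_op list \<Rightarrow> int \<Rightarrow> field \<Rightarrow> field" where
  "field_deriv [] s f = f"
| "field_deriv (d # w) s f =
     (case d of
        Tau \<Rightarrow> field_deriv w s (d_tau f)
      | Rho \<Rightarrow> field_deriv w s (d_rho f)
      | Eth \<Rightarrow> field_deriv w (s + 1) (eth_field s f)
      | EthBar \<Rightarrow> field_deriv w (s - 1) (eth_bar_field s f))"

definition smooth_tau_rho :: "field \<Rightarrow> bool" where
  "smooth_tau_rho f \<longleftrightarrow>
     (\<forall>w. set w \<subseteq> {Tau, Rho} \<longrightarrow>
       (\<forall>\<theta> \<in> {0<..<pi}. \<forall>\<psi>.
          continuous_on ({-1..1} \<times> {0..}) (\<lambda>(\<tau>, \<rho>). field_deriv w 0 f \<tau> \<rho> \<theta> \<psi>) \<and>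
          (\<forall>\<tau> \<in> {-1..1}. \<forall>\<rho> \<in> {0..}.
             (\<lambda>t. field_deriv w 0 f t \<rho> \<theta> \<psi>) differentiable (at \<tau> within {-1..1}) \<and>
             (\<lambda>r. field_deriv w 0 f \<tau> r \<theta> \<psi>) differentiable (at \<rho> within {0..}))))"

definition angular_differentiable :: "field \<Rightarrow> bool" where
  "angular_differentiable f \<longleftrightarrow>
     (\<forall>\<tau> \<in> {-1..1}. \<forall>\<rho> \<in> {0..}. \<forall>\<theta> \<in> {0<..<pi}. \<forall>\<psi>.
        (\<lambda>t. f \<tau> \<rho> t \<psi>) differentiable (at \<theta>) \<and> (\<lambda>t. f \<tau> \<rho> \<theta> t) differentiable (at \<psi>))"


section \<open>Massless spin-2 fields in the F-gauge\<close>

text \<open>The components \<open>\<phi> 0, \<dots>, \<phi> 4\<close> are taken in the spin dyad adapted to the F-frame;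
  \<open>\<phi> n\<close> has spin weight \<open>2 - n\<close>. The conjuncts are the components of
  \<open>\<nabla>\<^sub>A\<^sub>'\<^sup>A \<phi>\<^sub>A\<^sub>B\<^sub>C\<^sub>D = 0\<close>, written as evolution equations and constraints.\<close>

definition massless_spin2 :: "(nat \<Rightarrow> field) \<Rightarrow> bool" where
  "massless_spin2 \<phi> \<longleftrightarrow>
     (\<forall>n \<le> 4. smooth_tau_rho (\<phi> n) \<and> angular_differentiable (\<phi> n)) \<and>
     (\<forall>\<tau> \<in> {-1..1}. \<forall>\<rho> \<in> {0..}. \<forall>\<theta> \<in> {0<..<pi}. \<forall>\<psi>.
        (1 + of_real \<tau>) * d_tau (\<phi> 0) \<tau> \<rho> \<theta> \<psi> - of_real \<rho> * d_rho (\<phi> 0) \<tau> \<rho> \<theta> \<psi>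
          + eth_field 1 (\<phi> 1) \<tau> \<rho> \<theta> \<psi> = - 2 * \<phi> 0 \<tau> \<rho> \<theta> \<psi> \<and>
        d_tau (\<phi> 1) \<tau> \<rho> \<theta> \<psi> + eth_bar_field 2 (\<phi> 0) \<tau> \<rho> \<theta> \<psi> / 2
          + eth_field 0 (\<phi> 2) \<tau> \<rho> \<theta> \<psi> / 2 = - \<phi> 1 \<tau> \<rho> \<theta> \<psi> \<and>
        d_tau (\<phi> 2) \<tau> \<rho> \<theta> \<psi> + eth_bar_field 1 (\<phi> 1) \<tau> \<rho> \<theta> \<psi> / 2
          + eth_field (-1) (\<phi> 3) \<tau> \<rho> \<theta> \<psi> / 2 = 0 \<and>
        d_tau (\<phi> 3) \<tau> \<rho> \<theta> \<psi> + eth_bar_field 0 (\<phi> 2) \<tau> \<rho> \<theta> \<psi> / 2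
          + eth_field (-2) (\<phi> 4) \<tau> \<rho> \<theta> \<psi> / 2 = \<phi> 3 \<tau> \<rho> \<theta> \<psi> \<and>
        (1 - of_real \<tau>) * d_tau (\<phi> 4) \<tau> \<rho> \<theta> \<psi> + of_real \<rho> * d_rho (\<phi> 4) \<tau> \<rho> \<theta> \<psi>
          + eth_bar_field (-1) (\<phi> 3) \<tau> \<rho> \<theta> \<psi> = 2 * \<phi> 4 \<tau> \<rho> \<theta> \<psi> \<and>
        (\<forall>k \<in> {1, 2, 3}.
           of_real \<tau> * d_tau (\<phi> k) \<tau> \<rho> \<theta> \<psi> - of_real \<rho> * d_rho (\<phi> k) \<tau> \<rho> \<theta> \<psi>
             + eth_field (1 - int k) (\<phi> (k + 1)) \<tau> \<rho> \<theta> \<psi> / 2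
             - eth_bar_field (3 - int k) (\<phi> (k - 1)) \<tau> \<rho> \<theta> \<psi> / 2 = 0))"


section \<open>Expansions near \<open>\<rho> = 0\<close>\<close>

text \<open>\<open>a n p l m\<close> is the coefficient \<open>a\<^sub>n\<^sub>,\<^sub>p\<^sub>;\<^sub>l\<^sub>,\<^sub>m\<close>, a function of \<open>\<tau>\<close>.\<close>

type_synonym coeffs = "nat \<Rightarrow> nat \<Rightarrow> nat \<Rightarrow> int \<Rightarrow> real \<Rightarrow> complex"

definition mode :: "coeffs \<Rightarrow> nat \<Rightarrow> nat \<Rightarrow> nat \<Rightarrow> int \<Rightarrow> field" where
  "mode a n p l m \<tau> \<rho> \<theta> \<psi> =
     1 / fact p * a n p l m \<tau> * swsh (2 - int n) l m \<theta> \<psi> * of_real \<rho> ^ p"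

text \<open>Uniform convergence on the sphere of all termwise derivatives (with \<open>\<eth>\<close> and its conjugate
  as angular derivatives), locally uniformly in \<open>(\<tau>, \<rho>) \<in> [-1, 1] \<times> [0, \<rho>\<^sub>0)\<close>.\<close>

definition has_expansion :: "(nat \<Rightarrow> field) \<Rightarrow> coeffs \<Rightarrow> real \<Rightarrow> bool" where
  "has_expansion \<phi> a \<rho>0 \<longleftrightarrow>
     (\<forall>n \<le> 4. \<forall>p \<ge> nat \<bar>2 - int n\<bar>. \<forall>l \<in> {nat \<bar>2 - int n\<bar>..p}. \<forall>m \<in> {- int l..int l}.
        \<forall>j. \<forall>\<tau> \<in> {-1..1}.
          ((\<lambda>f t. vector_derivative f (at t within {-1..1})) ^^ j) (a n p l m)
            differentiable (at \<tau> within {-1..1})) \<and>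
     (\<forall>n \<le> 4. \<forall>w. \<forall>r \<in> {0..<\<rho>0}.
        uniform_limit ({-1..1} \<times> {0..r} \<times> {0<..<pi} \<times> UNIV)
          (\<lambda>N (\<tau>, \<rho>, \<theta>, \<psi>).
             \<Sum>p = nat \<bar>2 - int n\<bar>..N. \<Sum>l = nat \<bar>2 - int n\<bar>..p. \<Sum>m = - int l..int l.
               field_deriv w (2 - int n) (mode a n p l m) \<tau> \<rho> \<theta> \<psi>)
          (\<lambda>(\<tau>, \<rho>, \<theta>, \<psi>). field_deriv w (2 - int n) (\<phi> n) \<tau> \<rho> \<theta> \<psi>)
          sequentially)"

text \<open>The form of the coefficients with \<open>l = p\<close>, with constants \<open>E\<close>, \<open>Es\<close>, \<open>I\<close>, \<open>Is\<close>, where the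
  second and fourth of them (starred in the usual notation) multiply the logarithmically
  singular solutions. The integrals diverge at one of \<open>\<tau> = \<plusminus>1\<close>, hence the open interval.\<close>

definition top_mode_form ::
    "coeffs \<Rightarrow> (nat \<Rightarrow> int \<Rightarrow> complex) \<Rightarrow> (nat \<Rightarrow> int \<Rightarrow> complex) \<Rightarrow>
     (nat \<Rightarrow> int \<Rightarrow> complex) \<Rightarrow> (nat \<Rightarrow> int \<Rightarrow> complex) \<Rightarrow> bool" where
  "top_mode_form a E Es I Is \<longleftrightarrow>
     (\<forall>p \<ge> 2. \<forall>m \<in> {- int p..int p}. \<forall>\<tau> \<in> {-1<..<1}.
        a 0 p p m \<tau> =
          of_real (((1 - \<tau>) / 2) ^ (p + 2) * ((1 + \<tau>) / 2) ^ (p - 2))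
          * (E p m + Es p m
               * of_real (LBINT s=0..ereal \<tau>. 1 / ((1 + s) ^ (p - 1) * (1 - s) ^ (p + 3)))) \<and>
        a 4 p p m \<tau> =
          of_real (((1 + \<tau>) / 2) ^ (p + 2) * ((1 - \<tau>) / 2) ^ (p - 2))
          * (I p m + Is p m
               * of_real (LBINT s=0..ereal \<tau>. 1 / ((1 - s) ^ (p - 1) * (1 + s) ^ (p + 3)))))"

definition regularity_condition ::
    "(nat \<Rightarrow> int \<Rightarrow> complex) \<Rightarrow> (nat \<Rightarrow> int \<Rightarrow> complex) \<Rightarrow> bool" where
  "regularity_condition Es Is \<longleftrightarrow>
     (\<forall>p \<ge> 2. \<forall>m \<in> {- int p..int p}. Es p m = 0 \<and> Is p m = 0)"


section \<open>The constants \<open>D\<close>\<close>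

definition jacobi :: "nat \<Rightarrow> real \<Rightarrow> real \<Rightarrow> real \<Rightarrow> real" where
  "jacobi k \<alpha> \<beta> x =
     (\<Sum>s\<le>k. ((real k + \<alpha>) gchoose (k - s)) * ((real k + \<beta>) gchoose s)
        * ((x - 1) / 2) ^ s * ((x + 1) / 2) ^ (k - s))"

definition Q1 :: "nat \<Rightarrow> nat \<Rightarrow> real \<Rightarrow> real" where
  "Q1 p l \<tau> = ((1 - \<tau>) / 2) ^ (p + 2) * jacobi (l - 2) (real p + 2) (- real p + 2) \<tau>"

definition Q3 :: "nat \<Rightarrow> nat \<Rightarrow> real \<Rightarrow> real" where
  "Q3 p l \<tau> = ((1 + \<tau>) / 2) ^ (p - 2) * jacobi (l + 2) (- real p - 2) (real p - 2) \<tau>"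

definition X_mat :: "nat \<Rightarrow> nat \<Rightarrow> real \<Rightarrow> complex ^ 2 ^ 2" where
  "X_mat p l \<tau> =
     vector [vector [of_real (Q1 p l \<tau>), of_real ((-1) ^ l * Q3 p l \<tau>)],
             vector [of_real ((-1) ^ l * Q3 p l (- \<tau>)), of_real (Q1 p l (- \<tau>))]]"

text \<open>The pair \<open>(C, D)\<close>; only its second component is used.\<close>

definition CD_vec :: "coeffs \<Rightarrow> nat \<Rightarrow> nat \<Rightarrow> int \<Rightarrow> complex ^ 2" where
  "CD_vec a p l m = matrix_inv (X_mat p l 0) *v vector [a 0 p l m 0, a 4 p l m 0]"

definition D_const :: "coeffs \<Rightarrow> nat \<Rightarrow> nat \<Rightarrow> int \<Rightarrow> complex" where
  "D_const a p l m = CD_vec a p l m $ 2"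


section \<open>Newman--Penrose constants at past null infinity\<close>

text \<open>The coordinates \<open>\<tau>\<close>, \<open>\<rho>\<close> as functions of the physical time \<open>t\<close> and radius \<open>r\<close>.\<close>

definition tau_of :: "real \<Rightarrow> real \<Rightarrow> real" where
  "tau_of t r = t / r"

definition rho_of :: "real \<Rightarrow> real \<Rightarrow> real" where
  "rho_of t r = r / (r\<^sup>2 - t\<^sup>2)"

lemma tau_of_physical_coordinates:
  assumes "\<rho> > 0" "\<bar>\<tau>\<bar> < 1"
  shows "tau_of (\<tau> / (\<rho> * (1 - \<tau>\<^sup>2))) (1 / (\<rho> * (1 - \<tau>\<^sup>2))) = \<tau>"
proof -
  have "1 - \<tau>\<^sup>2 > 0" using assms(2) by (simp add: abs_square_less_1)
  then show ?thesis using assms(1) by (simp add: tau_of_def)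
qed

lemma rho_of_physical_coordinates:
  assumes "\<rho> > 0" "\<bar>\<tau>\<bar> < 1"
  shows "rho_of (\<tau> / (\<rho> * (1 - \<tau>\<^sup>2))) (1 / (\<rho> * (1 - \<tau>\<^sup>2))) = \<rho>"
proof -
  define q where "q = \<rho> * (1 - \<tau>\<^sup>2)"
  have pos: "1 - \<tau>\<^sup>2 > 0" using assms(2) by (simp add: abs_square_less_1)
  then have q: "q > 0" using assms(1) by (simp add: q_def)
  have "(1 / q)\<^sup>2 - (\<tau> / q)\<^sup>2 = (1 - \<tau>\<^sup>2) / q\<^sup>2"
    by (simp add: power_divide diff_divide_distrib)
  then have "rho_of (\<tau> / q) (1 / q) = q / (1 - \<tau>\<^sup>2)"
    using q by (simp add: rho_of_def power2_eq_square)
  then show ?thesis using pos by (simp add: q_def)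
qed

definition phi4' :: "(nat \<Rightarrow> field) \<Rightarrow> field" where
  "phi4' \<phi> \<tau> \<rho> \<theta> \<psi> = of_real (16 / (\<rho>\<^sup>2 * (1 - \<tau>) ^ 4)) * \<phi> 0 \<tau> \<rho> \<theta> \<psi>"

definition physical_phi4 :: "(nat \<Rightarrow> field) \<Rightarrow> field" where
  "physical_phi4 \<phi> t r \<theta> \<psi> = phi4' \<phi> (tau_of t r) (rho_of t r) \<theta> \<psi> / of_real r ^ 5"

text \<open>The (unique) sequence of coefficients \<open>c k\<close> of \<open>r\<^sup>-\<^sup>5\<^sup>-\<^sup>k\<close> in the asymptotic expansion of the
  physical component as \<open>r \<rightarrow> \<infinity>\<close> at fixed advanced time \<open>v = t + r\<close> and fixed angles.\<close>

definition is_asymptotic_expansion :: "(real \<Rightarrow> complex) \<Rightarrow> (nat \<Rightarrow> complex) \<Rightarrow> bool" where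
  "is_asymptotic_expansion f c \<longleftrightarrow>
     (\<forall>N. (\<lambda>r. f r - (\<Sum>k\<le>N. c k / of_real r ^ (5 + k))) \<in> o[at_top](\<lambda>r. 1 / of_real r ^ (5 + N)))"

definition phi4_coeff :: "(nat \<Rightarrow> field) \<Rightarrow> real \<Rightarrow> real \<Rightarrow> real \<Rightarrow> nat \<Rightarrow> complex" where
  "phi4_coeff \<phi> v \<theta> \<psi> =
     (THE c. is_asymptotic_expansion (\<lambda>r. physical_phi4 \<phi> (v - r) r \<theta> \<psi>) c)"

text \<open>The constant evaluated on the cut \<open>{\<tau> = -1, \<rho> = \<rho>c}\<close>, on which the advanced time
  \<open>v = 1 / (\<rho> (1 - \<tau>))\<close> equals \<open>1 / (2 \<rho>c)\<close>.\<close>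

definition NP_minus :: "(nat \<Rightarrow> field) \<Rightarrow> real \<Rightarrow> nat \<Rightarrow> int \<Rightarrow> complex" where
  "NP_minus \<phi> \<rho>c n m =
     sphere_integral (\<lambda>\<theta> \<psi>. cnj (swsh 2 (n + 2) m \<theta> \<psi>) * phi4_coeff \<phi> (1 / (2 * \<rho>c)) \<theta> \<psi> (n + 1))"

end

theory Submission
  imports Defs "HOL-Computational_Algebra.Polynomial"
begin

text \<open>
  At fixed advanced time \<open>v\<close> put \<open>u = 1 + \<tau> = v / r\<close>; then \<open>\<rho> = 1 / (v (2 - u))\<close>, and \<open>r\<^sup>5\<close> times the
  physical component is \<open>16 v\<^sup>2 (2 - u)\<^sup>-\<^sup>2 \<phi>\<^sub>0\<close>. So the coefficient of order \<open>n\<close> of the asymptotic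
  expansion is a Taylor coefficient at \<open>u = 0\<close>, and by uniform convergence its projection to
  \<open>Y\<^sub>2\<^sub>;\<^sub>l\<^sub>,\<^sub>m\<close> with \<open>l = n + 1\<close> is a sum over \<open>p\<close> of the \<open>n\<close>-th derivatives at \<open>0\<close> of
  \<open>b\<^sub>p(u) = a\<^sub>0\<^sub>,\<^sub>p\<^sub>;\<^sub>l\<^sub>,\<^sub>m(u - 1) / (2 - u) ^ (p + 2)\<close>.

  Projecting the field equations to harmonics yields a first-order system for \<open>a\<^sub>0\<close> and \<open>a\<^sub>1\<close>, whence
  \<open>u (2 - u) b'' = (2 (p - 3) + 6 u) b' - (l + 3) (l - 2) b\<close>. At \<open>u = 0\<close> this gives
  \<open>2 (k + 3 - p) b\<^sub>k\<^sub>+\<^sub>1 = (k - (l - 2)) (k + l + 3) b\<^sub>k\<close> for the derivatives \<open>b\<^sub>k\<close> of \<open>b\<close> at \<open>0\<close>, so that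
  \<open>b\<^sub>n = 0\<close> for every \<open>p \<noteq> n + 2\<close>.
  For \<open>p = n + 2 = l + 1\<close> the fundamental solutions are partial sums of the binomial expansion of
  \<open>1 = ((1 + \<tau>) / 2 + (1 - \<tau>) / 2) ^ (2 l + 1)\<close>: \<open>Q\<^sup>1\<close> is the part of degree at most \<open>l - 2\<close> in
  \<open>(1 + \<tau>) / 2\<close>, and \<open>Q\<^sup>1 + (-1) ^ l Q\<^sup>3 = 1\<close>. Hence \<open>a\<^sub>0 = D + (C - D) Q\<^sup>1\<close>, and only the constant \<open>D\<close>
  contributes to \<open>b\<^sub>n\<close>, because \<open>Q\<^sup>1 / (2 - u) ^ (l + 3)\<close> is a polynomial of degree at most \<open>l - 2 < n\<close>.
\<close>

section \<open>Spin-weighted spherical harmonics\<close>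

text \<open>Two obstacles shape the proof. The coefficient at past null infinity is taken pointwise
  in the angles and integrated afterwards, and the sum over modes is infinite, so the derivative of
  order n in u has to commute with both. It is therefore written, along a line of constant advanced
  time, as one finite combination of mixed \<tau>- and \<rho>-derivatives, the same for the field
  and for every mode. Uniform convergence of each such derivative then suffices, and no limit is
  ever differentiated. For p = n + 2 the recursion at u = 0 degenerates to 0 = 0 exactly where it
  should determine the wanted derivative. Local analysis cannot find it, and the mode has to be
  solved on the whole range from \<tau> = -1 to \<tau> = 0. The datum a_4 enters there through the
  constraints at \<tau> = 0, which express the initial slope of a_0 by a_0 - a_4. The polar factors
  of the harmonics are treated as coefficients of a product of powers of two linear polynomials.
  This yields the ladder relations, and integration by parts then yields orthonormality.\<close>

definition wigner_poly :: "nat \<Rightarrow> nat \<Rightarrow> real \<Rightarrow> real poly" where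
  "wigner_poly a b \<theta> = [:cos (\<theta> / 2), - sin (\<theta> / 2):] ^ a * [:sin (\<theta> / 2), cos (\<theta> / 2):] ^ b"

text \<open>Up to normalisation a Wigner d-function: the coefficients of \<open>wigner_poly\<close>
  describe the rotation by \<theta> on binary forms of degree 2 l. For spin weights beyond l the
  truncation by \<open>nat\<close> makes the value meaningless; the ladder relations meet such
  values only with a vanishing factor.\<close>

definition polar_part :: "int \<Rightarrow> nat \<Rightarrow> int \<Rightarrow> real \<Rightarrow> real" where
  "polar_part s l m \<theta> =
     (-1) powi m
     * sqrt (fact (nat (int l + m)) * fact (nat (int l - m)) * (2 * real l + 1)
             / (4 * pi * fact (nat (int l + s)) * fact (nat (int l - s))))
     * coeff (wigner_poly (nat (int l - s)) (nat (int l + s)) \<theta>) (nat (int l - m))"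

lemma coeff_linear_power_choose:
  "coeff ([:x, y:] ^ n) i = of_nat (n choose i) * y ^ i * x ^ (n - i)" for x y :: "'a :: comm_semiring_1"
proof (cases "i \<le> n")
  case True
  then show ?thesis by (rule coeff_linear_poly_power)
next
  case False
  have "degree ([:x, y:] ^ n) \<le> degree [:x, y:] * n" by (rule degree_power_le)
  also have "\<dots> \<le> n" by simp
  finally show ?thesis using False by (simp add: coeff_eq_0 binomial_eq_0)
qed

lemma coeff_wigner_poly:
  fixes s m :: int and l :: nat
  assumes "\<bar>s\<bar> \<le> int l" "\<bar>m\<bar> \<le> int l"
  shows "coeff (wigner_poly (nat (int l - s)) (nat (int l + s)) \<theta>) (nat (int l - m)) =
    (\<Sum>r \<in> {max 0 (m - s)..min (int l - s) (int l + m)}.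
             (-1) ^ nat (int l - s - r)
             * real (nat (int l - s) choose nat r)
             * real (nat (int l + s) choose nat (r + s - m))
             * cos (\<theta> / 2) ^ nat (2 * r + s - m)
             * sin (\<theta> / 2) ^ nat (2 * int l - 2 * r - s + m))"
proof -
  define a b k where abk: "a = nat (int l - s)" "b = nat (int l + s)" "k = nat (int l - m)"
  define c d where cd: "c = cos (\<theta> / 2)" "d = sin (\<theta> / 2)"
  define I where "I = {i. i \<le> k \<and> i \<le> a \<and> k - i \<le> b}"
  have s: "s = int l - int a" and l2: "2 * int l = int a + int b" and m: "m = int l - int k"
    using assms abk by auto
  have "coeff (wigner_poly a b \<theta>) k =
      (\<Sum>i\<le>k. real (a choose i) * (- d) ^ i * c ^ (a - i) * (real (b choose (k - i)) * c ^ (k - i) * d ^ (b - (k - i))))"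
    by (simp add: wigner_poly_def coeff_mult coeff_linear_power_choose cd)
  also have "\<dots> = (\<Sum>i\<in>I. real (a choose i) * (- d) ^ i * c ^ (a - i) * (real (b choose (k - i)) * c ^ (k - i) * d ^ (b - (k - i))))"
    by (rule sum.mono_neutral_right) (auto simp: I_def)
  also have "\<dots> = (\<Sum>r \<in> {max 0 (m - s)..min (int l - s) (int l + m)}.
             (-1) ^ nat (int l - s - r) * real (a choose nat r) * real (b choose nat (r + s - m))
             * c ^ nat (2 * r + s - m) * d ^ nat (2 * int l - 2 * r - s + m))"
  \<comment> \<open>Of the a factors \<open>c - d z\<close>, i contribute \<open>- d z\<close> and r
    = a - i contribute \<open>c\<close>; the sum in \<open>swsh\<close> runs over r.\<close>
  proof (rule sum.reindex_bij_witness[where i = "\<lambda>r. nat (int a - r)" and j = "\<lambda>i. int a - int i"])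
    fix i assume i: "i \<in> I"
    then have i': "i \<le> k" "i \<le> a" "k \<le> b + i" by (auto simp: I_def)
    show "nat (int a - (int a - int i)) = i" by simp
    show "int a - int i \<in> {max 0 (m - s)..min (int l - s) (int l + m)}"
      using i' s l2 m by auto
    have e1: "nat (int l - s - (int a - int i)) = i" using s by auto
    have e2: "nat (int a - int i) = a - i" using i' by auto
    have e3: "nat ((int a - int i) + s - m) = k - i" using i' s m by auto
    have e4: "nat (2 * (int a - int i) + s - m) = (a - i) + (k - i)" using i' s m by auto
    have e5: "nat (2 * int l - 2 * (int a - int i) - s + m) = i + (b - (k - i))"
      using i' s m l2 by auto
    have e6: "a choose (a - i) = a choose i" using i' binomial_symmetric[of i a] by simp
    show "(-1) ^ nat (int l - s - (int a - int i)) * real (a choose nat (int a - int i)) * real (b choose nat ((int a - int i) + s - m))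
             * c ^ nat (2 * (int a - int i) + s - m) * d ^ nat (2 * int l - 2 * (int a - int i) - s + m)
         = real (a choose i) * (- d) ^ i * c ^ (a - i) * (real (b choose (k - i)) * c ^ (k - i) * d ^ (b - (k - i)))"
      unfolding e1 e2 e3 e4 e5 e6 by (simp add: power_add power_minus[of d])
  qed (use s l2 m in \<open>auto simp: I_def\<close>)
  finally show ?thesis unfolding abk cd .
qed

lemma swsh_eq_polar_part:
  assumes "\<bar>s\<bar> \<le> int l" "\<bar>m\<bar> \<le> int l"
  shows "swsh s l m \<theta> \<psi> = of_real (polar_part s l m \<theta>) * cis (of_int m * \<psi>)"
  unfolding swsh_def polar_part_def coeff_wigner_poly[OF assms] ..

section \<open>Ladder relations in the polar angle\<close>

definition coeffwise_derivative :: "(real \<Rightarrow> real poly) \<Rightarrow> real poly \<Rightarrow> real \<Rightarrow> bool" where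
  "coeffwise_derivative p p' \<theta> \<longleftrightarrow> (\<forall>k. ((\<lambda>t. coeff (p t) k) has_real_derivative coeff p' k) (at \<theta>))"

lemma coeffwise_derivative_mult:
  assumes "coeffwise_derivative p p' \<theta>" "coeffwise_derivative q q' \<theta>"
  shows "coeffwise_derivative (\<lambda>t. p t * q t) (p' * q \<theta> + p \<theta> * q') \<theta>"
  using assms unfolding coeffwise_derivative_def
  by (auto simp: coeff_mult sum.distrib[symmetric] intro!: derivative_eq_intros sum.cong)

lemma coeffwise_derivative_power:
  assumes "coeffwise_derivative p p' \<theta>"
  shows "coeffwise_derivative (\<lambda>t. p t ^ n) (of_nat n * p \<theta> ^ (n - 1) * p') \<theta>"
proof (induction n)
  case 0
  then show ?case by (simp add: coeffwise_derivative_def)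
next
  case (Suc n)
  have "coeffwise_derivative (\<lambda>t. p t * p t ^ n) (p' * p \<theta> ^ n + p \<theta> * (of_nat n * p \<theta> ^ (n - 1) * p')) \<theta>"
    by (rule coeffwise_derivative_mult[OF assms Suc])
  moreover have "p' * p \<theta> ^ n + p \<theta> * (of_nat n * p \<theta> ^ (n - 1) * p') = of_nat (Suc n) * p \<theta> ^ (Suc n - 1) * p'"
    by (cases n) (auto simp: algebra_simps)
  ultimately show ?case by simp
qed

text \<open>The linear factors satisfy A' = - B / 2 and B' = A / 2, so differentiation in \<theta>
  trades one factor for the other. When an exponent is 0, its truncated predecessor is harmless
  because that term has coefficient 0.\<close>

lemma coeffwise_derivative_wigner_poly:
  "coeffwise_derivative (wigner_poly a b)
     (smult (- (real a / 2)) (wigner_poly (a - 1) (b + 1) \<theta>) + smult (real b / 2) (wigner_poly (a + 1) (b - 1) \<theta>)) \<theta>"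
proof -
  define c d where cd: "c = cos (\<theta> / 2)" "d = sin (\<theta> / 2)"
  have p: "coeffwise_derivative (\<lambda>t. [:cos (t / 2), - sin (t / 2):]) (smult (- (1 / 2)) [:d, c:]) \<theta>"
    unfolding coeffwise_derivative_def cd
    by (auto simp: coeff_pCons split: nat.splits intro!: derivative_eq_intros)
  have q: "coeffwise_derivative (\<lambda>t. [:sin (t / 2), cos (t / 2):]) (smult (1 / 2) [:c, - d:]) \<theta>"
    unfolding coeffwise_derivative_def cd
    by (auto simp: coeff_pCons split: nat.splits intro!: derivative_eq_intros)
  have "coeffwise_derivative (wigner_poly a b)
     ((of_nat a * [:c, - d:] ^ (a - 1) * smult (- (1 / 2)) [:d, c:]) * [:d, c:] ^ b
      + [:c, - d:] ^ a * (of_nat b * [:d, c:] ^ (b - 1) * smult (1 / 2) [:c, - d:])) \<theta>"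
    unfolding wigner_poly_def[abs_def] cd
    by (rule coeffwise_derivative_mult[OF coeffwise_derivative_power[OF p, unfolded cd] coeffwise_derivative_power[OF q, unfolded cd]])
  moreover have "(of_nat a * [:c, - d:] ^ (a - 1) * smult (- (1 / 2)) [:d, c:]) * [:d, c:] ^ b
      + [:c, - d:] ^ a * (of_nat b * [:d, c:] ^ (b - 1) * smult (1 / 2) [:c, - d:])
     = smult (- (real a / 2)) (wigner_poly (a - 1) (b + 1) \<theta>) + smult (real b / 2) (wigner_poly (a + 1) (b - 1) \<theta>)"
  proof -
    have 1: "of_nat n * (x::real poly) = smult (real n) x" for n x
      by (simp add: of_nat_poly)
    have 2: "(smult (real a) (A ^ (a - 1)) * smult (- (1 / 2)) B) * B ^ b
      + A ^ a * (smult (real b) (B ^ (b - 1)) * smult (1 / 2) A)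
      = smult (- (real a / 2)) (A ^ (a - 1) * B ^ (b + 1)) + smult (real b / 2) (A ^ (a + 1) * B ^ (b - 1))" for A B :: "real poly"
      by (simp add: algebra_simps)
    show ?thesis unfolding 1 wigner_poly_def cd[symmetric] by (rule 2)
  qed
  ultimately show ?thesis by simp
qed

text \<open>With \<open>A = c - d z\<close> and \<open>B = d + c z\<close>, where \<open>c = cos (\<theta>/2)\<close>, \<open>d = sin (\<theta>/2)\<close>, one has \<open>1 = c A + d B\<close>
  and \<open>z = c B - d A\<close>, which turns \<open>z d/dz\<close> of \<open>A ^ a * B ^ b\<close> into a combination of such products.\<close>

lemma wigner_poly_azimuthal:
  "(real a + real b - 2 * real k + (real b - real a) * cos \<theta>) * coeff (wigner_poly a b \<theta>) k
   = sin \<theta> * (real a * coeff (wigner_poly (a - 1) (b + 1) \<theta>) k + real b * coeff (wigner_poly (a + 1) (b - 1) \<theta>) k)"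
proof -
  define c d where cd: "c = cos (\<theta> / 2)" "d = sin (\<theta> / 2)"
  define A B :: "real poly" where AB: "A = [:c, - d:]" "B = [:d, c:]"
  have cd1: "c ^ 2 + d ^ 2 = 1" by (simp add: cd)
  have cos: "cos \<theta> = c ^ 2 - d ^ 2" unfolding cd using cos_double[of "\<theta> / 2"] by simp
  have sin: "sin \<theta> = 2 * c * d" unfolding cd using sin_double[of "\<theta> / 2"] by simp
  have one: "smult c A + smult d B = 1"
    using cd1 by (simp add: AB one_pCons power2_eq_square algebra_simps)
  have z: "smult c B - smult d A = [:0, 1:]"
    using cd1 by (simp add: AB power2_eq_square algebra_simps)
  have pd: "pderiv A = [:- d:]" "pderiv B = [:c:]" by (simp_all add: AB pderiv_pCons)
  have k: "real k * coeff (A ^ a * B ^ b) k = coeff ([:0, 1:] * pderiv (A ^ a * B ^ b)) k"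
    by (cases k) (simp_all add: coeff_pderiv)
  have pdp: "pderiv (p ^ n) = smult (real n) (p ^ (n - 1)) * pderiv p" for p :: "real poly" and n
    by (cases n) (simp_all add: pderiv_power_Suc del: power_Suc)
  \<comment> \<open>The scalars \<open>real a\<close> and \<open>real b\<close> keep these
    identities true when the exponent is 0 and its predecessor is truncated.\<close>
  have Aa: "smult (real a) (A ^ a) = smult (real a) (A ^ (a - 1) * A)" by (cases a) (auto simp: mult.commute)
  have Bb: "smult (real b) (B ^ b) = smult (real b) (B ^ (b - 1) * B)" by (cases b) (auto simp: mult.commute)
  have pd2: "[:0, 1:] * pderiv (A ^ a * B ^ b) =
      smult (- d * real a) ((smult c B - smult d A) * A ^ (a - 1) * B ^ b)
      + smult (c * real b) ((smult c B - smult d A) * B ^ (b - 1) * A ^ a)"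
    unfolding z pderiv_mult pdp pd by (simp add: algebra_simps)
  also have "\<dots> = smult (- d * c) (smult (real a) (A ^ (a - 1) * B ^ (b + 1))) + smult (d * d) (smult (real a) (A ^ (a - 1) * A) * B ^ b)
     + smult (c * c) (smult (real b) (B ^ (b - 1) * B) * A ^ a) - smult (c * d) (smult (real b) (B ^ (b - 1) * A ^ (a + 1)))"
    by (simp add: algebra_simps smult_add_right smult_diff_right)
  also have "\<dots> = smult (- d * c) (smult (real a) (A ^ (a - 1) * B ^ (b + 1))) + smult (d * d * a + c * c * b) (A ^ a * B ^ b)
      - smult (c * d) (smult (real b) (B ^ (b - 1) * A ^ (a + 1)))"
    unfolding Aa[symmetric] Bb[symmetric] by (simp add: algebra_simps smult_add_left)
  finally have "real k * coeff (A ^ a * B ^ b) k = - d * c * a * coeff (A ^ (a - 1) * B ^ (b + 1)) k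
     + (d ^ 2 * a + c ^ 2 * b) * coeff (A ^ a * B ^ b) k - c * d * b * coeff (A ^ (a + 1) * B ^ (b - 1)) k"
    unfolding k by (simp add: power2_eq_square mult.commute)
  then have "(real a + real b) * coeff (A ^ a * B ^ b) k - 2 * (real k * coeff (A ^ a * B ^ b) k) + (real b - real a) * cos \<theta> * coeff (A ^ a * B ^ b) k
      = sin \<theta> * (real a * coeff (A ^ (a - 1) * B ^ (b + 1)) k + real b * coeff (A ^ (a + 1) * B ^ (b - 1)) k)
      + ((a + b) * (1 - (c ^ 2 + d ^ 2))) * coeff (A ^ a * B ^ b) k"
    unfolding cos sin by (simp only:) (simp add: algebra_simps)
  then show ?thesis unfolding wigner_poly_def AB cd[symmetric] cd1 by (simp add: algebra_simps)
qed

definition raise_factor :: "int \<Rightarrow> nat \<Rightarrow> real" where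
  "raise_factor s l = sqrt (real_of_int ((int l - s) * (int l + s + 1)))"

text \<open>A change of spin weight by one moves one unit between the two factorials of the
  normalisation. The factor \<open>Suc a\<close> produced by differentiating a power combines with
  the change of the square root into the ladder factor.\<close>

lemma prefactor_shift:
  fixes G :: real
  assumes "G \<ge> 0"
  shows "sqrt (G / (fact b * fact (Suc a))) * real (Suc a)
    = sqrt (real (Suc a) * real (Suc b)) * sqrt (G / (fact (Suc b) * fact a))"
proof -
  have "sqrt (G / (fact b * fact (Suc a))) * real (Suc a) = sqrt (G / (fact b * fact (Suc a)) * real (Suc a) ^ 2)"
    by (simp only: real_sqrt_mult real_sqrt_power[symmetric]) simp
  also have "G / (fact b * fact (Suc a)) * real (Suc a) ^ 2 = real (Suc a) * real (Suc b) * (G / (fact (Suc b) * fact a))"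
    unfolding fact_Suc power2_eq_square of_nat_mult
    by (simp add: divide_simps del: of_nat_Suc)
  finally show ?thesis by (simp only: real_sqrt_mult)
qed

lemma polar_part_prefactor:
  fixes s m :: int and l :: nat
  obtains G where "G \<ge> 0" "\<And>s \<theta>. polar_part s l m \<theta> = (-1) powi m * sqrt (G / (fact (nat (int l + s)) * fact (nat (int l - s))))
     * coeff (wigner_poly (nat (int l - s)) (nat (int l + s)) \<theta>) (nat (int l - m))"
proof
  show "0 \<le> fact (nat (int l + m)) * fact (nat (int l - m)) * (2 * real l + 1) / (4 * pi)" by simp
qed (simp add: polar_part_def)

text \<open>\<open>T\<close> is the normalisation at spin weight \<open>s\<close>, obtained before
  \<theta> so that it passes through derivatives. At s = l, respectively s = - l, no factor is left
  to trade, and the corresponding ladder factor vanishes too.\<close>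

lemma polar_part_shift:
  assumes "\<bar>s\<bar> \<le> int l"
  obtains T where
    "\<And>\<theta>. polar_part s l m \<theta> = T * coeff (wigner_poly (nat (int l - s)) (nat (int l + s)) \<theta>) (nat (int l - m))"
    "\<And>\<theta>. T * (real (nat (int l - s)) * coeff (wigner_poly (nat (int l - s) - 1) (nat (int l + s) + 1) \<theta>) (nat (int l - m)))
      = raise_factor s l * polar_part (s + 1) l m \<theta>"
    "\<And>\<theta>. T * (real (nat (int l + s)) * coeff (wigner_poly (nat (int l - s) + 1) (nat (int l + s) - 1) \<theta>) (nat (int l - m)))
      = raise_factor (s - 1) l * polar_part (s - 1) l m \<theta>"
proof -
  define a b where ab: "a = nat (int l - s)" "b = nat (int l + s)"
  obtain G where G: "G \<ge> 0" "\<And>s \<theta>. polar_part s l m \<theta> = (-1) powi m * sqrt (G / (fact (nat (int l + s)) * fact (nat (int l - s))))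
     * coeff (wigner_poly (nat (int l - s)) (nat (int l + s)) \<theta>) (nat (int l - m))"
    using polar_part_prefactor[of l m] by metis
  define T where "T = (-1) powi m * sqrt (G / (fact b * fact a))"
  show thesis
  proof (rule that[of T])
    fix \<theta>
    show "polar_part s l m \<theta> = T * coeff (wigner_poly (nat (int l - s)) (nat (int l + s)) \<theta>) (nat (int l - m))"
      by (simp add: G T_def ab)
    show "T * (real (nat (int l - s)) * coeff (wigner_poly (nat (int l - s) - 1) (nat (int l + s) + 1) \<theta>) (nat (int l - m)))
      = raise_factor s l * polar_part (s + 1) l m \<theta>"
    proof (cases a)
      case 0
      then have "raise_factor s l = 0" using assms by (simp add: raise_factor_def ab)
      then show ?thesis using 0 ab by simp
    next
      case (Suc a')
      have e: "nat (int l + (s + 1)) = Suc b" "nat (int l - (s + 1)) = a'" using Suc assms ab by auto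
      have "int l - s = int (Suc a')" "int l + s + 1 = int (Suc b)" using Suc assms ab by auto
      then have r: "raise_factor s l = sqrt (real (Suc a') * real (Suc b))"
        unfolding raise_factor_def by (simp only: of_int_mult of_int_of_nat_eq mult.commute)
      show ?thesis unfolding G(2) e r ab[symmetric] T_def Suc
        using prefactor_shift[OF G(1), of b a'] by (simp del: fact_Suc of_nat_Suc)
    qed
    show "T * (real (nat (int l + s)) * coeff (wigner_poly (nat (int l - s) + 1) (nat (int l + s) - 1) \<theta>) (nat (int l - m)))
      = raise_factor (s - 1) l * polar_part (s - 1) l m \<theta>"
    proof (cases b)
      case 0
      then have "raise_factor (s - 1) l = 0" using assms by (simp add: raise_factor_def ab)
      then show ?thesis using 0 ab by simp
    next
      case (Suc b')
      have e: "nat (int l + (s - 1)) = b'" "nat (int l - (s - 1)) = Suc a" using Suc assms ab by auto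
      have "int l - (s - 1) = int (Suc a)" "int l + (s - 1) + 1 = int (Suc b')" using Suc assms ab by auto
      then have r: "raise_factor (s - 1) l = sqrt (real (Suc b') * real (Suc a))"
        unfolding raise_factor_def by (simp only: of_int_mult of_int_of_nat_eq mult.commute)
      show ?thesis unfolding G(2) e r ab[symmetric] T_def Suc
        using prefactor_shift[OF G(1), of a b'] by (simp del: fact_Suc of_nat_Suc add: mult.commute)
    qed
  qed
qed

lemma polar_part_has_derivative:
  assumes "\<bar>s\<bar> \<le> int l"
  shows "(polar_part s l m has_real_derivative
     (raise_factor (s - 1) l * polar_part (s - 1) l m \<theta> - raise_factor s l * polar_part (s + 1) l m \<theta>) / 2) (at \<theta>)"
proof -
  obtain T where T: "\<And>\<theta>. polar_part s l m \<theta> = T * coeff (wigner_poly (nat (int l - s)) (nat (int l + s)) \<theta>) (nat (int l - m))"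
    "\<And>\<theta>. T * (real (nat (int l - s)) * coeff (wigner_poly (nat (int l - s) - 1) (nat (int l + s) + 1) \<theta>) (nat (int l - m)))
      = raise_factor s l * polar_part (s + 1) l m \<theta>"
    "\<And>\<theta>. T * (real (nat (int l + s)) * coeff (wigner_poly (nat (int l - s) + 1) (nat (int l + s) - 1) \<theta>) (nat (int l - m)))
      = raise_factor (s - 1) l * polar_part (s - 1) l m \<theta>"
    using polar_part_shift[OF assms] by metis
  show ?thesis unfolding T(2,3)[symmetric] T(1)[abs_def]
    by (rule DERIV_cong[OF DERIV_cmult[OF coeffwise_derivative_wigner_poly[unfolded coeffwise_derivative_def, rule_format]]])
      (simp add: algebra_simps diff_divide_distrib)
qed

text \<open>This is the sum of the raising and the lowering relation, the \<theta>-derivative being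
  their difference. Free of division by \<open>sin \<theta>\<close>, it holds at the poles as well,
  where the integration by parts for orthogonality uses it.\<close>

lemma polar_part_azimuthal:
  assumes "\<bar>s\<bar> \<le> int l" "\<bar>m\<bar> \<le> int l"
  shows "(of_int m + of_int s * cos \<theta>) * polar_part s l m \<theta> = sin \<theta> / 2 *
     (raise_factor s l * polar_part (s + 1) l m \<theta> + raise_factor (s - 1) l * polar_part (s - 1) l m \<theta>)"
proof -
  obtain T where T: "\<And>\<theta>. polar_part s l m \<theta> = T * coeff (wigner_poly (nat (int l - s)) (nat (int l + s)) \<theta>) (nat (int l - m))"
    "\<And>\<theta>. T * (real (nat (int l - s)) * coeff (wigner_poly (nat (int l - s) - 1) (nat (int l + s) + 1) \<theta>) (nat (int l - m)))
      = raise_factor s l * polar_part (s + 1) l m \<theta>"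
    "\<And>\<theta>. T * (real (nat (int l + s)) * coeff (wigner_poly (nat (int l - s) + 1) (nat (int l + s) - 1) \<theta>) (nat (int l - m)))
      = raise_factor (s - 1) l * polar_part (s - 1) l m \<theta>"
    using polar_part_shift[OF assms(1)] by metis
  have m: "real_of_int m = (real (nat (int l - s)) + real (nat (int l + s)) - 2 * real (nat (int l - m))) / 2"
    and s: "real_of_int s = (real (nat (int l + s)) - real (nat (int l - s))) / 2" using assms by auto
  have "(of_int m + of_int s * cos \<theta>) * polar_part s l m \<theta> = T / 2 *
      ((real (nat (int l - s)) + real (nat (int l + s)) - 2 * real (nat (int l - m)) + (real (nat (int l + s)) - real (nat (int l - s))) * cos \<theta>)
        * coeff (wigner_poly (nat (int l - s)) (nat (int l + s)) \<theta>) (nat (int l - m)))"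
    by (subst m, subst s) (simp add: T(1) field_simps)
  also have "\<dots> = sin \<theta> / 2 *
     (raise_factor s l * polar_part (s + 1) l m \<theta> + raise_factor (s - 1) l * polar_part (s - 1) l m \<theta>)"
    unfolding wigner_poly_azimuthal T(2,3)[symmetric] by (simp add: algebra_simps)
  finally show ?thesis .
qed

lemma swsh_theta_vector_derivative:
  assumes "\<bar>s\<bar> \<le> int l" "\<bar>m\<bar> \<le> int l"
  shows "((\<lambda>t. swsh s l m t \<psi>) has_vector_derivative
     of_real ((raise_factor (s - 1) l * polar_part (s - 1) l m \<theta> - raise_factor s l * polar_part (s + 1) l m \<theta>) / 2)
       * cis (of_int m * \<psi>)) (at \<theta>)"
  unfolding swsh_eq_polar_part[OF assms]
  by (intro has_vector_derivative_mult_left has_vector_derivative_of_real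
       polar_part_has_derivative[OF assms(1)])

lemma swsh_psi_vector_derivative:
  assumes "\<bar>s\<bar> \<le> int l" "\<bar>m\<bar> \<le> int l"
  shows "((\<lambda>t. swsh s l m \<theta> t) has_vector_derivative \<i> * of_int m * swsh s l m \<theta> \<psi>) (at \<psi>)"
proof -
  have "((\<lambda>t. cis (of_int m * t)) has_vector_derivative \<i> * of_int m * cis (of_int m * \<psi>)) (at \<psi>)"
    unfolding has_vector_derivative_def
    by (auto intro!: derivative_eq_intros simp: scaleR_conv_of_real fun_eq_iff mult_ac)
  then show ?thesis
    unfolding swsh_eq_polar_part[OF assms]
    by (auto intro!: derivative_eq_intros)
qed

lemma eth_swsh:
  assumes "\<bar>s\<bar> \<le> int l" "\<bar>m\<bar> \<le> int l" "sin \<theta> \<noteq> 0"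
  shows "eth s (swsh s l m) \<theta> \<psi> = of_real (raise_factor s l * polar_part (s + 1) l m \<theta>) * cis (of_int m * \<psi>)"
    and "eth_bar s (swsh s l m) \<theta> \<psi> = - of_real (raise_factor (s - 1) l * polar_part (s - 1) l m \<theta>) * cis (of_int m * \<psi>)"
proof -
  define X where "X = raise_factor s l * polar_part (s + 1) l m \<theta>"
  define Y where "Y = raise_factor (s - 1) l * polar_part (s - 1) l m \<theta>"
  define P where "P = polar_part s l m \<theta>"
  have "(of_int m + of_int s * cos \<theta>) * P / sin \<theta> = (X + Y) / 2"
    unfolding P_def X_def Y_def polar_part_azimuthal[OF assms(1,2)] using assms(3) by simp
  then have mP: "of_int m * P / sin \<theta> = (X + Y) / 2 - of_int s * cot \<theta> * P"
    using assms(3) by (simp add: field_simps cot_def)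
  have i: "\<i> / of_real (sin \<theta>) * (\<i> * of_int m * (of_real P * E)) = - of_real (of_int m * P / sin \<theta>) * E" for E
    by (simp add: mult.assoc)
  note d = vector_derivative_at[OF swsh_theta_vector_derivative[OF assms(1,2)]]
    vector_derivative_at[OF swsh_psi_vector_derivative[OF assms(1,2)]]
  show "eth s (swsh s l m) \<theta> \<psi> = of_real (raise_factor s l * polar_part (s + 1) l m \<theta>) * cis (of_int m * \<psi>)"
    unfolding eth_def d unfolding swsh_eq_polar_part[OF assms(1,2)] X_def[symmetric] Y_def[symmetric] P_def[symmetric] i mP
    by (simp add: field_simps)
  show "eth_bar s (swsh s l m) \<theta> \<psi> = - of_real (raise_factor (s - 1) l * polar_part (s - 1) l m \<theta>) * cis (of_int m * \<psi>)"
    unfolding eth_bar_def d unfolding swsh_eq_polar_part[OF assms(1,2)] X_def[symmetric] Y_def[symmetric] P_def[symmetric] i mP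
    by (simp add: field_simps)
qed

section \<open>Orthonormality\<close>

text \<open>Continuity on the whole plane of angles, without periodicity or any condition at the
  poles: enough for integrability over the bounded coordinate rectangle.\<close>

definition sphere_continuous :: "(real \<Rightarrow> real \<Rightarrow> complex) \<Rightarrow> bool" where
  "sphere_continuous f \<longleftrightarrow> continuous_on UNIV (\<lambda>x. f (fst x) (snd x))"

definition sphere_proj :: "int \<Rightarrow> nat \<Rightarrow> int \<Rightarrow> (real \<Rightarrow> real \<Rightarrow> complex) \<Rightarrow> complex" where
  "sphere_proj s l m f = sphere_integral (\<lambda>\<theta> \<psi>. cnj (swsh s l m \<theta> \<psi>) * f \<theta> \<psi>)"

lemma sphere_continuous_swsh: "sphere_continuous (swsh s l m)"
  unfolding sphere_continuous_def swsh_def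
  by (rule continuous_on_const continuous_on_mult continuous_on_of_real continuous_on_sum continuous_on_power
      continuous_on_cos continuous_on_sin continuous_on_cis continuous_on_divide continuous_on_fst continuous_on_snd
      continuous_on_id | simp)+

lemma sphere_continuous_cmult: "sphere_continuous f \<Longrightarrow> sphere_continuous (\<lambda>\<theta> \<psi>. c * f \<theta> \<psi>)"
  unfolding sphere_continuous_def by (intro continuous_intros)

lemma sphere_continuous_mult:
  "sphere_continuous f \<Longrightarrow> sphere_continuous g \<Longrightarrow> sphere_continuous (\<lambda>\<theta> \<psi>. f \<theta> \<psi> * g \<theta> \<psi>)"
  unfolding sphere_continuous_def by (intro continuous_intros)

lemma sphere_continuous_cnj: "sphere_continuous f \<Longrightarrow> sphere_continuous (\<lambda>\<theta> \<psi>. cnj (f \<theta> \<psi>))"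
  unfolding sphere_continuous_def by (intro continuous_intros)

lemma sphere_continuous_sum:
  "(\<And>i. i \<in> I \<Longrightarrow> sphere_continuous (f i)) \<Longrightarrow> sphere_continuous (\<lambda>\<theta> \<psi>. \<Sum>i\<in>I. f i \<theta> \<psi>)"
  unfolding sphere_continuous_def by (intro continuous_intros)

lemma sphere_set_integrable:
  assumes "sphere_continuous f"
  shows "set_integrable lborel ({0<..<pi} \<times> {0..2 * pi}) (\<lambda>x. sin (fst x) *\<^sub>R f (fst x) (snd x))"
proof (rule set_integrable_subset)
  have "continuous_on UNIV (\<lambda>x. sin (fst x) *\<^sub>R f (fst x) (snd x))"
    using assms unfolding sphere_continuous_def by (intro continuous_intros)
  then show "set_integrable lborel ({0..pi} \<times> {0..2 * pi}) (\<lambda>x. sin (fst x) *\<^sub>R f (fst x) (snd x))"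
    unfolding set_integrable_def
    by (intro borel_integrable_compact compact_Times) (auto intro: continuous_on_subset)
qed (auto intro!: borel_closed borel_open pair_measureI simp: borel_prod[symmetric])

lemma sphere_integral_sum:
  assumes "finite I" "\<And>i. i \<in> I \<Longrightarrow> sphere_continuous (f i)"
  shows "sphere_integral (\<lambda>\<theta> \<psi>. \<Sum>i\<in>I. f i \<theta> \<psi>) = (\<Sum>i\<in>I. sphere_integral (f i))"
  unfolding sphere_integral_def set_lebesgue_integral_def scaleR_sum_right
  by (rule Bochner_Integration.integral_sum)
    (rule sphere_set_integrable[OF assms(2), unfolded set_integrable_def])

lemma sphere_proj_sum:
  assumes "finite I" "\<And>i. i \<in> I \<Longrightarrow> sphere_continuous (f i)"
  shows "sphere_proj s l m (\<lambda>\<theta> \<psi>. \<Sum>i\<in>I. f i \<theta> \<psi>) = (\<Sum>i\<in>I. sphere_proj s l m (f i))"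
  unfolding sphere_proj_def sum_distrib_left
  by (rule sphere_integral_sum[OF assms(1)])
    (intro sphere_continuous_mult sphere_continuous_cnj sphere_continuous_swsh assms(2))

lemma sphere_proj_cmult: "sphere_proj s l m (\<lambda>\<theta> \<psi>. c * f \<theta> \<psi>) = c * sphere_proj s l m f"
proof -
  have "(\<lambda>x. sin (fst x) *\<^sub>R (cnj (swsh s l m (fst x) (snd x)) * (c * f (fst x) (snd x))))
    = (\<lambda>x. c * (sin (fst x) *\<^sub>R (cnj (swsh s l m (fst x) (snd x)) * f (fst x) (snd x))))"
    by (simp add: fun_eq_iff)
  then show ?thesis unfolding sphere_proj_def sphere_integral_def by (simp only: set_integral_mult_right)
qed

lemma sphere_proj_cong:
  assumes "\<And>\<theta> \<psi>. 0 < \<theta> \<Longrightarrow> \<theta> < pi \<Longrightarrow> f \<theta> \<psi> = g \<theta> \<psi>"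
  shows "sphere_proj s l m f = sphere_proj s l m g"
  unfolding sphere_proj_def sphere_integral_def set_lebesgue_integral_def
  by (rule Bochner_Integration.integral_cong) (auto simp: indicator_def assms)

text \<open>Dominated convergence. The limit need not extend to the poles and is measurable only as
  a pointwise limit; the dominating constant comes from one bounded member \<open>f N0\<close>,
  since all later members stay within distance 2 of it.\<close>

lemma sphere_proj_uniform_limit:
  assumes f: "\<And>N. sphere_continuous (f N)"
    and lim: "uniform_limit ({0<..<pi} \<times> UNIV) (\<lambda>N (\<theta>, \<psi>). f N \<theta> \<psi>) (\<lambda>(\<theta>, \<psi>). F \<theta> \<psi>) sequentially"
  shows "(\<lambda>N. sphere_proj s l m (f N)) \<longlonglongrightarrow> sphere_proj s l m F"
proof -
  define S where "S = {0<..<pi} \<times> {0..2 * pi}"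
  define g where "g N x = indicator S x *\<^sub>R (sin (fst x) *\<^sub>R (cnj (swsh s l m (fst x) (snd x)) * f N (fst x) (snd x)))" for N and x :: "real \<times> real"
  define G where "G x = indicator S x *\<^sub>R (sin (fst x) *\<^sub>R (cnj (swsh s l m (fst x) (snd x)) * F (fst x) (snd x)))" for x :: "real \<times> real"
  have int: "integrable lborel (g N)" for N
    using sphere_set_integrable[OF sphere_continuous_mult[OF sphere_continuous_cnj[OF sphere_continuous_swsh] f]]
    unfolding set_integrable_def g_def S_def .
  have ptw: "(\<lambda>N. g N x) \<longlonglongrightarrow> G x" for x
  proof (cases "x \<in> S")
    case True
    then have "x \<in> {0<..<pi} \<times> UNIV" by (auto simp: S_def)
    from tendsto_uniform_limitI[OF lim this]
    have "(\<lambda>N. f N (fst x) (snd x)) \<longlonglongrightarrow> F (fst x) (snd x)" by (simp add: case_prod_beta)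
    then show ?thesis unfolding g_def G_def by (intro tendsto_intros)
  qed (simp add: g_def G_def)
  from uniform_limitD[OF lim, of 1] obtain N0 where
    "\<forall>n\<ge>N0. \<forall>x\<in>{0<..<pi} \<times> UNIV. dist (f n (fst x) (snd x)) (F (fst x) (snd x)) < 1"
    unfolding eventually_sequentially case_prod_beta by auto
  then have N0: "\<And>n x. n \<ge> N0 \<Longrightarrow> x \<in> {0<..<pi} \<times> UNIV \<Longrightarrow> dist (f n (fst x) (snd x)) (F (fst x) (snd x)) < 1"
    by blast
  have bdd: "\<exists>B>0. \<forall>x\<in>S. norm (h (fst x) (snd x)) \<le> B" if "sphere_continuous h" for h
  proof -
    have "compact ((\<lambda>x. h (fst x) (snd x)) ` ({0..pi} \<times> {0..2 * pi}))"
      using that unfolding sphere_continuous_def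
      by (intro compact_continuous_image compact_Times) (auto intro: continuous_on_subset)
    from compact_imp_bounded[OF this]
    obtain B where B: "B > 0" "\<forall>x\<in>{0..pi} \<times> {0..2 * pi}. norm (h (fst x) (snd x)) \<le> B"
      unfolding bounded_pos ball_simps by blast
    have "norm (h (fst x) (snd x)) \<le> B" if "x \<in> S" for x
      using that by (intro bspec[OF B(2)]) (auto simp: S_def)
    with B(1) show ?thesis by blast
  qed
  obtain B where B: "B > 0" "\<And>x. x \<in> S \<Longrightarrow> norm (f N0 (fst x) (snd x)) \<le> B"
    using bdd[OF f[of N0]] by auto
  obtain C where C: "C > 0" "\<And>x. x \<in> S \<Longrightarrow> norm (swsh s l m (fst x) (snd x)) \<le> C"
    using bdd[OF sphere_continuous_swsh[of s l m]] by auto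
  have Sm: "S \<in> sets lborel" unfolding S_def
    by (auto intro!: borel_closed borel_open pair_measureI simp: borel_prod[symmetric])
  have "S \<subseteq> cbox (0, 0) (pi, 2 * pi)" unfolding S_def cbox_Pair_eq by auto
  then have "emeasure lborel S \<le> emeasure lborel (cbox (0, 0) (pi, 2 * pi) :: (real \<times> real) set)"
    by (intro emeasure_mono) auto
  also have "\<dots> < \<infinity>" by (simp add: emeasure_lborel_cbox_eq)
  finally have Sfin: "emeasure lborel S < \<infinity>" .
  have bound: "norm (g (N + N0) x) \<le> indicator S x * (C * (B + 2))" for N x
  proof (cases "x \<in> S")
    case True
    have x: "x \<in> {0<..<pi} \<times> UNIV" using True by (auto simp: S_def)
    have 1: "dist (f N0 (fst x) (snd x)) (F (fst x) (snd x)) < 1" using N0[OF _ x] by simp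
    have 2: "dist (f (N + N0) (fst x) (snd x)) (F (fst x) (snd x)) < 1" using N0[OF _ x] by simp
    have "dist (f (N + N0) (fst x) (snd x)) (f N0 (fst x) (snd x)) < 2"
      using 1 2 dist_triangle2[of "f (N + N0) (fst x) (snd x)" "f N0 (fst x) (snd x)" "F (fst x) (snd x)"] by linarith
    then have "norm (f (N + N0) (fst x) (snd x)) \<le> B + 2"
      using B(2)[OF True] norm_triangle_ineq2[of "f (N + N0) (fst x) (snd x)" "f N0 (fst x) (snd x)"]
      by (simp add: dist_norm)
    then have "\<bar>sin (fst x)\<bar> * (norm (swsh s l m (fst x) (snd x)) * norm (f (N + N0) (fst x) (snd x))) \<le> 1 * (C * (B + 2))"
      using C B by (intro mult_mono) (auto simp: True)
    then show ?thesis using True by (simp add: g_def norm_mult)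
  qed (simp add: g_def)
  have "(\<lambda>N. integral\<^sup>L lborel (g (N + N0))) \<longlonglongrightarrow> integral\<^sup>L lborel G"
  proof (rule integral_dominated_convergence)
    show "G \<in> borel_measurable lborel"
      using borel_measurable_LIMSEQ_metric[of g lborel G] int ptw by (auto intro: borel_measurable_integrable)
    show "g (N + N0) \<in> borel_measurable lborel" for N using int by (rule borel_measurable_integrable)
    show "integrable lborel (\<lambda>x. indicator S x * (C * (B + 2)))"
      using Sm Sfin by simp
    show "AE x in lborel. (\<lambda>N. g (N + N0) x) \<longlonglongrightarrow> G x"
      using LIMSEQ_ignore_initial_segment[OF ptw] by simp
    show "AE x in lborel. norm (g (N + N0) x) \<le> indicator S x * (C * (B + 2))" for N
      using bound by simp
  qed
  then have "(\<lambda>N. integral\<^sup>L lborel (g N)) \<longlonglongrightarrow> integral\<^sup>L lborel G"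
    by (rule LIMSEQ_offset)
  then show ?thesis
    unfolding sphere_proj_def sphere_integral_def set_lebesgue_integral_def g_def G_def S_def .
qed

lemma integral_cis_period:
  "(LINT y : {0..2 * pi} | lborel. cis (of_int k * y)) = (if k = 0 then of_real (2 * pi) else 0)"
proof -
  have c: "continuous_on {0..2 * pi} (\<lambda>y. cis (of_int k * y))" by (intro continuous_intros)
  have "set_integrable lborel {0..2 * pi} (\<lambda>y. cis (of_int k * y))"
    using c by (rule borel_integrable_atLeastAtMost')
  then have eq: "(LINT y : {0..2 * pi} | lborel. cis (of_int k * y)) = integral {0..2 * pi} (\<lambda>y. cis (of_int k * y))"
    by (rule set_borel_integral_eq_integral(2))
  show ?thesis
  proof (cases "k = 0")
    case True
    then show ?thesis unfolding eq by (simp add: scaleR_conv_of_real)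
  next
    case False
    define H where "H y = cis (of_int k * y) / (\<i> * of_int k)" for y
    have "(H has_vector_derivative cis (of_int k * y)) (at y within {0..2 * pi})" for y
      unfolding H_def has_vector_derivative_def using False
      by (auto intro!: derivative_eq_intros simp: scaleR_conv_of_real fun_eq_iff field_simps)
    then have "((\<lambda>y. cis (of_int k * y)) has_integral (H (2 * pi) - H 0)) {0..2 * pi}"
      by (intro fundamental_theorem_of_calculus) auto
    moreover have "H (2 * pi) = H 0"
      using cis_multiple_2pi[of "of_int k"] by (simp add: H_def mult.commute)
    ultimately show ?thesis unfolding eq using False by (simp add: integral_unique)
  qed
qed

lemma sphere_integral_separated:
  fixes A :: "real \<Rightarrow> real"
  assumes A: "continuous_on UNIV A"
  shows "sphere_integral (\<lambda>\<theta> \<psi>. of_real (A \<theta>) * cis (of_int k * \<psi>)) =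
    (if k = 0 then of_real (2 * pi * integral {0..pi} (\<lambda>\<theta>. sin \<theta> * A \<theta>)) else 0)"
proof -
  define f where "f x = indicator ({0<..<pi} \<times> {0..2 * pi}) x *\<^sub>R (sin (fst x) *\<^sub>R (of_real (A (fst x)) * cis (of_int k * snd x)))" for x :: "real \<times> real"
  have A': "continuous_on S (\<lambda>x. A (h x))" if "continuous_on S h" for S and h :: "'a::topological_space \<Rightarrow> real"
    using continuous_on_compose2[OF A that] by simp
  have "sphere_continuous (\<lambda>\<theta> \<psi>. of_real (A \<theta>) * cis (of_int k * \<psi>))"
    unfolding sphere_continuous_def by (intro continuous_intros A')
  from sphere_set_integrable[OF this] have int: "integrable (lborel \<Otimes>\<^sub>M lborel) f"
    unfolding set_integrable_def f_def[abs_def] lborel_prod .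
  have "sphere_integral (\<lambda>\<theta> \<psi>. of_real (A \<theta>) * cis (of_int k * \<psi>)) = integral\<^sup>L (lborel \<Otimes>\<^sub>M lborel) f"
    unfolding sphere_integral_def set_lebesgue_integral_def f_def[abs_def] lborel_prod ..
  also have "\<dots> = (LINT x|lborel. LINT y|lborel. f (x, y))"
    by (rule lborel_pair.integral_fst'[OF int, symmetric])
  also have "\<dots> = (LINT x|lborel. (indicator {0<..<pi} x *\<^sub>R (sin x * A x)) *\<^sub>R (LINT y : {0..2 * pi} | lborel. cis (of_int k * y)))"
  proof (rule Bochner_Integration.integral_cong[OF refl])
    fix x :: real
    have "f (x, y) = (indicator {0<..<pi} x *\<^sub>R (sin x * A x)) *\<^sub>R (indicator {0..2 * pi} y *\<^sub>R cis (of_int k * y))" for y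
      by (simp add: f_def indicator_def scaleR_conv_of_real)
    then show "(LINT y|lborel. f (x, y)) = (indicator {0<..<pi} x *\<^sub>R (sin x * A x)) *\<^sub>R (LINT y : {0..2 * pi} | lborel. cis (of_int k * y))"
      unfolding set_lebesgue_integral_def by (simp only: integral_scaleR_right)
  qed
  also have "\<dots> = (LINT x : {0<..<pi} | lborel. sin x * A x) *\<^sub>R (LINT y : {0..2 * pi} | lborel. cis (of_int k * y))"
  proof -
    have i: "set_integrable lborel {0<..<pi} (\<lambda>x. sin x * A x)"
      by (rule set_integrable_subset[OF borel_integrable_atLeastAtMost'[of 0 pi]]) (auto intro!: continuous_intros A')
    show ?thesis using i unfolding set_lebesgue_integral_def set_integrable_def by simp
  qed
  also have "(LINT x : {0<..<pi} | lborel. sin x * A x) = integral {0..pi} (\<lambda>x. sin x * A x)"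
  proof -
    have i: "set_integrable lborel {0<..<pi} (\<lambda>x. sin x * A x)"
      by (rule set_integrable_subset[OF borel_integrable_atLeastAtMost'[of 0 pi]]) (auto intro!: continuous_intros A')
    show ?thesis unfolding set_borel_integral_eq_integral(2)[OF i] by (simp add: integral_open_interval_real)
  qed
  finally show ?thesis unfolding integral_cis_period by (simp add: scaleR_conv_of_real)
qed

lemma continuous_on_polar_part: "continuous_on S (polar_part s l m)"
proof -
  have "continuous_on S (\<lambda>\<theta>. coeff (wigner_poly a b \<theta>) k)" for a b k
    using coeffwise_derivative_wigner_poly[of a b]
    by (intro continuous_at_imp_continuous_on ballI)
       (auto simp: coeffwise_derivative_def intro: DERIV_isCont)
  then show ?thesis unfolding polar_part_def[abs_def] by (intro continuous_intros)
qed

section \<open>Orthogonality in the polar angle\<close>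

definition polar_inner :: "int \<Rightarrow> nat \<Rightarrow> nat \<Rightarrow> int \<Rightarrow> real" where
  "polar_inner s l l' m = integral {0..pi} (\<lambda>\<theta>. sin \<theta> * (polar_part s l m \<theta> * polar_part s l' m \<theta>))"

text \<open>Raising and lowering are adjoint up to sign: integrate the derivative of
  \<open>sin \<theta> * P \<theta> * Q \<theta>\<close>, whose boundary values vanish. The terms
  with m cancel because both factors have the same m, and those with \<open>cos \<theta>\<close>
  cancel because the spin weights differ by one, which offsets the derivative of
  \<open>sin \<theta>\<close>.\<close>

lemma polar_inner_shift:
  assumes "\<bar>s\<bar> \<le> int l" "\<bar>s + 1\<bar> \<le> int l'" "\<bar>m\<bar> \<le> int l" "\<bar>m\<bar> \<le> int l'"
  shows "raise_factor s l * polar_inner (s + 1) l l' m = raise_factor s l' * polar_inner s l l' m"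
proof -
  define P where "P = polar_part s l m"
  define Q where "Q = polar_part (s + 1) l' m"
  define f where "f \<theta> = raise_factor s l' * (sin \<theta> * (P \<theta> * polar_part s l' m \<theta>))
       - raise_factor s l * (sin \<theta> * (polar_part (s + 1) l m \<theta> * Q \<theta>))" for \<theta>
  have "((\<lambda>\<theta>. sin \<theta> * P \<theta> * Q \<theta>) has_real_derivative f \<theta>) (at \<theta>)" for \<theta>
  proof -
    define P' where "P' = (raise_factor (s - 1) l * polar_part (s - 1) l m \<theta> - raise_factor s l * polar_part (s + 1) l m \<theta>) / 2"
    define Q' where "Q' = (raise_factor (s + 1 - 1) l' * polar_part (s + 1 - 1) l' m \<theta> - raise_factor (s + 1) l' * polar_part (s + 1 + 1) l' m \<theta>) / 2"
    have dP: "(P has_real_derivative P') (at \<theta>)" and dQ: "(Q has_real_derivative Q') (at \<theta>)"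
      unfolding P_def Q_def P'_def Q'_def
      by (rule polar_part_has_derivative[OF assms(1)], rule polar_part_has_derivative[OF assms(2)])
    have P1: "sin \<theta> * P' = (of_int m + of_int s * cos \<theta>) * P \<theta> - raise_factor s l * (sin \<theta> * polar_part (s + 1) l m \<theta>)"
      unfolding P_def P'_def polar_part_azimuthal[OF assms(1,3)] by (simp add: field_simps)
    have Q1: "sin \<theta> * Q' = raise_factor s l' * (sin \<theta> * polar_part s l' m \<theta>) - (of_int m + of_int (s + 1) * cos \<theta>) * Q \<theta>"
      unfolding Q_def Q'_def polar_part_azimuthal[OF assms(2,4)] by (simp add: field_simps)
    have "((\<lambda>\<theta>. sin \<theta> * P \<theta> * Q \<theta>) has_real_derivative cos \<theta> * P \<theta> * Q \<theta> + (sin \<theta> * P') * Q \<theta> + (sin \<theta> * Q') * P \<theta>) (at \<theta>)"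
      by (auto intro!: derivative_eq_intros dP dQ simp: algebra_simps)
    moreover have "cos \<theta> * P \<theta> * Q \<theta> + (sin \<theta> * P') * Q \<theta> + (sin \<theta> * Q') * P \<theta> = f \<theta>"
      unfolding P1 Q1 f_def by (simp add: algebra_simps)
    ultimately show ?thesis by simp
  qed
  then have "(f has_integral (sin pi * P pi * Q pi - sin 0 * P 0 * Q 0)) {0..pi}"
    by (intro fundamental_theorem_of_calculus)
      (auto simp: has_real_derivative_iff_has_vector_derivative[symmetric] intro: has_field_derivative_at_within)
  then have "integral {0..pi} f = 0" by (simp add: integral_unique)
  moreover have "integral {0..pi} f = raise_factor s l' * polar_inner s l l' m - raise_factor s l * polar_inner (s + 1) l l' m"
    unfolding f_def[abs_def] polar_inner_def P_def Q_def
    by (subst Henstock_Kurzweil_Integration.integral_diff)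
       (auto intro!: integrable_continuous_interval continuous_intros continuous_on_polar_part)
  ultimately show ?thesis by simp
qed

text \<open>Twice a Beta integral in the variable \<open>sin (\<theta> / 2) ^ 2\<close>. The
  induction lowers the power of the cosine at the cost of raising that of the sine, hence the
  arbitrary \<open>j\<close>.\<close>

lemma integral_half_angle_powers:
  "integral {0..pi} (\<lambda>\<theta>. sin \<theta> * (cos (\<theta> / 2) ^ (2 * k) * sin (\<theta> / 2) ^ (2 * j))) = 2 * fact k * fact j / fact (k + j + 1)"
proof (induction k arbitrary: j)
  case 0
  have "((\<lambda>\<theta>. sin \<theta> * (cos (\<theta> / 2) ^ (2 * 0) * sin (\<theta> / 2) ^ (2 * j))) has_integral
     (2 / (real j + 1) * sin (pi / 2) ^ (2 * j + 2) - 2 / (real j + 1) * sin (0 / 2) ^ (2 * j + 2))) {0..pi}"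
  proof (rule fundamental_theorem_of_calculus)
    fix \<theta> :: real
    have s: "sin \<theta> = 2 * sin (\<theta> / 2) * cos (\<theta> / 2)" using sin_double[of "\<theta> / 2"] by simp
    have "((\<lambda>\<theta>. sin (\<theta> / 2)) has_real_derivative cos (\<theta> / 2) * (1 / 2)) (at \<theta> within {0..pi})"
      by (auto intro!: derivative_eq_intros)
    from DERIV_cmult[OF DERIV_power[OF this, of "2 * j + 2"], of "2 / (real j + 1)"]
    have "((\<lambda>\<theta>. 2 / (real j + 1) * sin (\<theta> / 2) ^ (2 * j + 2)) has_real_derivative
        2 / (real j + 1) * (real (2 * j + 2) * (cos (\<theta> / 2) * (1 / 2)) * sin (\<theta> / 2) ^ (2 * j + 1))) (at \<theta> within {0..pi})"
      by (simp add: mult.assoc del: power_Suc)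
    moreover have "2 / (real j + 1) * (real (2 * j + 2) * (cos (\<theta> / 2) * (1 / 2)) * sin (\<theta> / 2) ^ (2 * j + 1))
        = sin \<theta> * (cos (\<theta> / 2) ^ (2 * 0) * sin (\<theta> / 2) ^ (2 * j))"
      unfolding s by (simp add: field_simps)
    ultimately show "((\<lambda>\<theta>. 2 / (real j + 1) * sin (\<theta> / 2) ^ (2 * j + 2)) has_vector_derivative
        sin \<theta> * (cos (\<theta> / 2) ^ (2 * 0) * sin (\<theta> / 2) ^ (2 * j))) (at \<theta> within {0..pi})"
      by (simp add: has_real_derivative_iff_has_vector_derivative)
  qed simp
  then show ?case by (simp add: integral_unique divide_simps)
next
  case (Suc k)
  let ?c = "\<lambda>\<theta>::real. cos (\<theta> / 2)" and ?s = "\<lambda>\<theta>::real. sin (\<theta> / 2)"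
  \<comment> \<open>The integrand is the derivative of twice the product of the powers 2 k + 2 and 2
    j + 2, which vanishes at both ends.\<close>
  have "((\<lambda>\<theta>. (real j + 1) * (sin \<theta> * (?c \<theta> ^ (2 * Suc k) * ?s \<theta> ^ (2 * j))) - (real k + 1) * (sin \<theta> * (?c \<theta> ^ (2 * k) * ?s \<theta> ^ (2 * Suc j)))) has_integral
     (2 * (?c pi ^ (2 * k + 2) * ?s pi ^ (2 * j + 2)) - 2 * (?c 0 ^ (2 * k + 2) * ?s 0 ^ (2 * j + 2)))) {0..pi}"
  proof (rule fundamental_theorem_of_calculus)
    fix \<theta> :: real
    have s: "sin \<theta> = 2 * ?s \<theta> * ?c \<theta>" using sin_double[of "\<theta> / 2"] by simp
    have ds: "(?s has_real_derivative ?c \<theta> * (1 / 2)) (at \<theta> within {0..pi})"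
      and dc: "(?c has_real_derivative - ?s \<theta> * (1 / 2)) (at \<theta> within {0..pi})"
      by (auto intro!: derivative_eq_intros)
    from DERIV_cmult[OF DERIV_mult'[OF DERIV_power[OF dc, of "2 * k + 2"] DERIV_power[OF ds, of "2 * j + 2"]], of 2]
    have "((\<lambda>\<theta>. 2 * (?c \<theta> ^ (2 * k + 2) * ?s \<theta> ^ (2 * j + 2))) has_real_derivative
        2 * (?c \<theta> ^ (2 * k + 2) * (real (2 * j + 2) * (?c \<theta> * (1 / 2)) * ?s \<theta> ^ (2 * j + 1))
          + (real (2 * k + 2) * (- ?s \<theta> * (1 / 2)) * ?c \<theta> ^ (2 * k + 1)) * ?s \<theta> ^ (2 * j + 2))) (at \<theta> within {0..pi})"
      by (simp add: mult.assoc del: power_Suc)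
    moreover have "2 * (?c \<theta> ^ (2 * k + 2) * (real (2 * j + 2) * (?c \<theta> * (1 / 2)) * ?s \<theta> ^ (2 * j + 1))
          + (real (2 * k + 2) * (- ?s \<theta> * (1 / 2)) * ?c \<theta> ^ (2 * k + 1)) * ?s \<theta> ^ (2 * j + 2))
        = (real j + 1) * (sin \<theta> * (?c \<theta> ^ (2 * Suc k) * ?s \<theta> ^ (2 * j))) - (real k + 1) * (sin \<theta> * (?c \<theta> ^ (2 * k) * ?s \<theta> ^ (2 * Suc j)))"
      unfolding s by (simp add: field_simps)
    ultimately show "((\<lambda>\<theta>. 2 * (?c \<theta> ^ (2 * k + 2) * ?s \<theta> ^ (2 * j + 2))) has_vector_derivative
        (real j + 1) * (sin \<theta> * (?c \<theta> ^ (2 * Suc k) * ?s \<theta> ^ (2 * j))) - (real k + 1) * (sin \<theta> * (?c \<theta> ^ (2 * k) * ?s \<theta> ^ (2 * Suc j)))) (at \<theta> within {0..pi})"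
      by (simp add: has_real_derivative_iff_has_vector_derivative)
  qed simp
  then have "integral {0..pi} (\<lambda>\<theta>. (real j + 1) * (sin \<theta> * (?c \<theta> ^ (2 * Suc k) * ?s \<theta> ^ (2 * j))) - (real k + 1) * (sin \<theta> * (?c \<theta> ^ (2 * k) * ?s \<theta> ^ (2 * Suc j)))) = 0"
    by (simp add: integral_unique)
  moreover have "integral {0..pi} (\<lambda>\<theta>. (real j + 1) * (sin \<theta> * (?c \<theta> ^ (2 * Suc k) * ?s \<theta> ^ (2 * j))) - (real k + 1) * (sin \<theta> * (?c \<theta> ^ (2 * k) * ?s \<theta> ^ (2 * Suc j))))
     = (real j + 1) * integral {0..pi} (\<lambda>\<theta>. sin \<theta> * (?c \<theta> ^ (2 * Suc k) * ?s \<theta> ^ (2 * j)))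
      - (real k + 1) * integral {0..pi} (\<lambda>\<theta>. sin \<theta> * (?c \<theta> ^ (2 * k) * ?s \<theta> ^ (2 * Suc j)))"
    by (subst Henstock_Kurzweil_Integration.integral_diff) (auto intro!: integrable_continuous_interval continuous_intros simp del: power_Suc)
  ultimately have "(real j + 1) * integral {0..pi} (\<lambda>\<theta>. sin \<theta> * (?c \<theta> ^ (2 * Suc k) * ?s \<theta> ^ (2 * j)))
      = (real k + 1) * (2 * fact k * fact (Suc j) / fact (k + Suc j + 1))"
    unfolding Suc.IH by simp
  also have "\<dots> = (real j + 1) * (2 * fact (Suc k) * fact j / fact (Suc k + j + 1))"
    by (simp add: field_simps)
  finally show ?case by (subst (asm) mult_left_cancel) (auto simp del: power_Suc fact_Suc)
qed

lemma raise_factor_pos: "raise_factor s l > 0" if "- int l \<le> s" "s < int l"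
  using that unfolding raise_factor_def by simp

text \<open>Descending induction from the top weight s = l of the smaller degree; adjointness
  carries the value down because the ladder factors stay positive. At the top, for l < l', the
  factor of degree l vanishes while that of degree l' does not, which forces orthogonality.\<close>

lemma polar_inner_orthonormal:
  assumes "\<bar>s\<bar> \<le> int l" "l \<le> l'" "\<bar>m\<bar> \<le> int l"
  shows "2 * pi * polar_inner s l l' m = (if l = l' then 1 else 0)"
proof -
  have "- int l \<le> s \<longrightarrow> 2 * pi * polar_inner s l l' m = (if l = l' then 1 else 0)"
    using abs_le_D1[OF assms(1)]
  proof (induction rule: int_le_induct)
    case base
    show ?case
    proof (cases "l = l'")
      case False
      have "raise_factor (int l) l * polar_inner (int l + 1) l l' m = raise_factor (int l) l' * polar_inner (int l) l l' m"
        using assms False by (intro polar_inner_shift) auto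
      moreover have "raise_factor (int l) l = 0" by (simp add: raise_factor_def)
      moreover have "raise_factor (int l) l' > 0" using assms False by (intro raise_factor_pos) auto
      ultimately show ?thesis using False by simp
    next
      \<comment> \<open>At s = l only powers of the second linear polynomial remain, so the polar
        factor is a single monomial in the half-angle functions and its norm is a Beta
        integral.\<close>
      case True
      define k j where kj: "k = nat (int l - m)" "j = nat (int l + m)"
      have l: "nat (int l + int l) = k + j" "2 * l = k + j" using assms kj by auto
      have rl: "2 * real l = real k + real j" using l by linarith
      define G where "G = fact j * fact k * (real k + real j + 1) / (4 * pi * fact (k + j))"
      have P: "polar_part (int l) l m \<theta> = (-1) powi m * sqrt G * (real ((k + j) choose k) * cos (\<theta> / 2) ^ k * sin (\<theta> / 2) ^ j)" for \<theta>
        unfolding polar_part_def kj[symmetric] l wigner_poly_def G_def rl by (simp add: coeff_linear_power_choose)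
      have G0: "G \<ge> 0" by (simp add: G_def)
      have m1: "((-1) powi m) * ((-1) powi m) = (1::real)"
        by (simp only: power_int_mult_distrib[symmetric]) simp
      have "sin \<theta> * (polar_part (int l) l m \<theta> * polar_part (int l) l m \<theta>)
          = (((-1) powi m) * ((-1) powi m)) * (sqrt G * sqrt G) * (real ((k + j) choose k))\<^sup>2 * (sin \<theta> * (cos (\<theta> / 2) ^ (2 * k) * sin (\<theta> / 2) ^ (2 * j)))" for \<theta>
        unfolding P mult_2 power_add power2_eq_square by (simp only: mult_ac)
      then have "sin \<theta> * (polar_part (int l) l m \<theta> * polar_part (int l) l m \<theta>)
          = G * (real ((k + j) choose k))\<^sup>2 * (sin \<theta> * (cos (\<theta> / 2) ^ (2 * k) * sin (\<theta> / 2) ^ (2 * j)))" for \<theta>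
        using G0 by (simp only: m1 real_sqrt_mult_self abs_of_nonneg mult_1)
      then have "polar_inner (int l) l l m = integral {0..pi} (\<lambda>\<theta>. (G * (real ((k + j) choose k))\<^sup>2) * (sin \<theta> * (cos (\<theta> / 2) ^ (2 * k) * sin (\<theta> / 2) ^ (2 * j))))"
        unfolding polar_inner_def by (simp only:)
      also have "\<dots> = G * (real ((k + j) choose k))\<^sup>2 * (2 * fact k * fact j / fact (k + j + 1))"
        unfolding integral_mult_right integral_half_angle_powers ..
      also have "2 * pi * \<dots> = 1"
        unfolding G_def binomial_fact[OF le_add1[of k j]]
        by (simp add: divide_simps power2_eq_square add_eq_0_iff)
      finally show ?thesis using True by simp
    qed
  next
    case (step s)
    show ?case
    proof
      assume s: "- int l \<le> s - 1"
      have "raise_factor (s - 1) l * polar_inner (s - 1 + 1) l l' m = raise_factor (s - 1) l' * polar_inner (s - 1) l l' m"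
        using assms s step by (intro polar_inner_shift) auto
      moreover have "2 * pi * polar_inner s l l' m = (if l = l' then 1 else 0)" using step s by simp
      moreover have "raise_factor (s - 1) l' > 0" using assms s step by (intro raise_factor_pos) auto
      ultimately show "2 * pi * polar_inner (s - 1) l l' m = (if l = l' then 1 else 0)"
        by (auto split: if_splits)
    qed
  qed
  then show ?thesis using assms by auto
qed

lemma polar_inner_commute: "polar_inner s l l' m = polar_inner s l' l m"
  by (simp add: polar_inner_def mult.commute)

lemma sphere_proj_swsh:
  assumes "\<bar>s\<bar> \<le> int l" "\<bar>m\<bar> \<le> int l" "\<bar>s\<bar> \<le> int l'" "\<bar>m'\<bar> \<le> int l'"
  shows "sphere_proj s l m (swsh s l' m') = (if l = l' \<and> m = m' then 1 else 0)"
proof -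
  have c: "cis (of_int (m' - m) * \<psi>) = cnj (cis (of_int m * \<psi>)) * cis (of_int m' * \<psi>)" for \<psi>
    by (simp add: cis_cnj cis_mult left_diff_distrib)
  have "sphere_proj s l m (swsh s l' m') =
    sphere_integral (\<lambda>\<theta> \<psi>. of_real (polar_part s l m \<theta> * polar_part s l' m' \<theta>) * cis (of_int (m' - m) * \<psi>))"
    unfolding sphere_proj_def swsh_eq_polar_part[OF assms(1,2)] swsh_eq_polar_part[OF assms(3,4)] c
    by (simp add: mult_ac)
  also have "\<dots> = (if m = m' then of_real (2 * pi * polar_inner s l l' m) else 0)"
    unfolding polar_inner_def
    by (subst sphere_integral_separated) (auto intro!: continuous_intros continuous_on_polar_part)
  also have "\<dots> = (if l = l' \<and> m = m' then 1 else 0)"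
  proof (cases "m = m'")
    case True
    then have "2 * pi * polar_inner s l l' m = (if l = l' then 1 else 0)"
      using polar_inner_orthonormal[of s l l' m] polar_inner_orthonormal[of s l' l m] assms
      by (cases "l \<le> l'") (auto simp: polar_inner_commute[of s l l'])
    then show ?thesis using True by simp
  qed simp
  finally show ?thesis .
qed

section \<open>Mode equations\<close>

text \<open>A class on which \<open>sphere_proj\<close> is additive, as it need not be for arbitrary
  functions. All terms of the field equations at fixed \<tau> and \<rho> < \<rho>0 belong to
  it.\<close>

definition sphere_limit :: "(real \<Rightarrow> real \<Rightarrow> complex) \<Rightarrow> bool" where
  "sphere_limit F \<longleftrightarrow> (\<exists>f. (\<forall>N. sphere_continuous (f N)) \<and>
     uniform_limit ({0<..<pi} \<times> UNIV) (\<lambda>N (\<theta>, \<psi>). f N \<theta> \<psi>) (\<lambda>(\<theta>, \<psi>). F \<theta> \<psi>) sequentially)"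

lemma sphere_limit_cmult:
  assumes "sphere_limit F"
  shows "sphere_limit (\<lambda>\<theta> \<psi>. c * F \<theta> \<psi>)"
proof -
  obtain f where f: "\<And>N. sphere_continuous (f N)"
    "uniform_limit ({0<..<pi} \<times> UNIV) (\<lambda>N (\<theta>, \<psi>). f N \<theta> \<psi>) (\<lambda>(\<theta>, \<psi>). F \<theta> \<psi>) sequentially"
    using assms unfolding sphere_limit_def by blast
  have "uniform_limit ({0<..<pi} \<times> UNIV) (\<lambda>N x. c * (case x of (\<theta>, \<psi>) \<Rightarrow> f N \<theta> \<psi>)) (\<lambda>x. c * (case x of (\<theta>, \<psi>) \<Rightarrow> F \<theta> \<psi>)) sequentially"
    by (rule bounded_linear.uniform_limit[OF bounded_linear_mult_right f(2)])
  then show ?thesis unfolding sphere_limit_def case_prod_beta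
    by (intro exI[of _ "\<lambda>N \<theta> \<psi>. c * f N \<theta> \<psi>"]) (auto intro: sphere_continuous_cmult f(1))
qed

lemma sphere_continuous_add:
  "sphere_continuous f \<Longrightarrow> sphere_continuous g \<Longrightarrow> sphere_continuous (\<lambda>\<theta> \<psi>. f \<theta> \<psi> + g \<theta> \<psi>)"
  unfolding sphere_continuous_def by (intro continuous_intros)

lemma sphere_proj_limit_add:
  assumes "sphere_limit F" "sphere_limit G"
  shows "sphere_limit (\<lambda>\<theta> \<psi>. F \<theta> \<psi> + G \<theta> \<psi>)"
    and "sphere_proj s l m (\<lambda>\<theta> \<psi>. F \<theta> \<psi> + G \<theta> \<psi>) = sphere_proj s l m F + sphere_proj s l m G"
proof -
  obtain f where f: "\<And>N. sphere_continuous (f N)"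
    "uniform_limit ({0<..<pi} \<times> UNIV) (\<lambda>N (\<theta>, \<psi>). f N \<theta> \<psi>) (\<lambda>(\<theta>, \<psi>). F \<theta> \<psi>) sequentially"
    using assms(1) unfolding sphere_limit_def by blast
  obtain g where g: "\<And>N. sphere_continuous (g N)"
    "uniform_limit ({0<..<pi} \<times> UNIV) (\<lambda>N (\<theta>, \<psi>). g N \<theta> \<psi>) (\<lambda>(\<theta>, \<psi>). G \<theta> \<psi>) sequentially"
    using assms(2) unfolding sphere_limit_def by blast
  have lim: "uniform_limit ({0<..<pi} \<times> UNIV) (\<lambda>N (\<theta>, \<psi>). f N \<theta> \<psi> + g N \<theta> \<psi>) (\<lambda>(\<theta>, \<psi>). F \<theta> \<psi> + G \<theta> \<psi>) sequentially"
    using uniform_limit_add[OF f(2) g(2)] unfolding case_prod_beta .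
  have c: "sphere_continuous (\<lambda>\<theta> \<psi>. f N \<theta> \<psi> + g N \<theta> \<psi>)" for N
    by (rule sphere_continuous_add[OF f(1) g(1)])
  show "sphere_limit (\<lambda>\<theta> \<psi>. F \<theta> \<psi> + G \<theta> \<psi>)"
    unfolding sphere_limit_def using lim c by (intro exI[of _ "\<lambda>N \<theta> \<psi>. f N \<theta> \<psi> + g N \<theta> \<psi>"]) auto
  have "sphere_proj s l m (\<lambda>\<theta> \<psi>. \<Sum>i\<in>{False, True}. (if i then f N else g N) \<theta> \<psi>)
      = (\<Sum>i\<in>{False, True}. sphere_proj s l m (if i then f N else g N))" for N
    using f(1) g(1) by (intro sphere_proj_sum) auto
  then have "sphere_proj s l m (\<lambda>\<theta> \<psi>. f N \<theta> \<psi> + g N \<theta> \<psi>) = sphere_proj s l m (f N) + sphere_proj s l m (g N)" for N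
    by (simp add: add.commute)
  then have "(\<lambda>N. sphere_proj s l m (\<lambda>\<theta> \<psi>. f N \<theta> \<psi> + g N \<theta> \<psi>)) \<longlonglongrightarrow> sphere_proj s l m F + sphere_proj s l m G"
    using tendsto_add[OF sphere_proj_uniform_limit[OF f] sphere_proj_uniform_limit[OF g]] by simp
  moreover have "(\<lambda>N. sphere_proj s l m (\<lambda>\<theta> \<psi>. f N \<theta> \<psi> + g N \<theta> \<psi>)) \<longlonglongrightarrow> sphere_proj s l m (\<lambda>\<theta> \<psi>. F \<theta> \<psi> + G \<theta> \<psi>)"
    by (rule sphere_proj_uniform_limit[OF c lim])
  ultimately show "sphere_proj s l m (\<lambda>\<theta> \<psi>. F \<theta> \<psi> + G \<theta> \<psi>) = sphere_proj s l m F + sphere_proj s l m G"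
    by (rule LIMSEQ_unique[rotated])
qed

lemma eth_swsh_shift:
  assumes "\<bar>s\<bar> \<le> int l" "\<bar>m\<bar> \<le> int l" "sin \<theta> \<noteq> 0"
  shows "eth s (swsh s l m) \<theta> \<psi> = of_real (raise_factor s l) * swsh (s + 1) l m \<theta> \<psi>"
    and "eth_bar s (swsh s l m) \<theta> \<psi> = - of_real (raise_factor (s - 1) l) * swsh (s - 1) l m \<theta> \<psi>"
proof -
  show "eth s (swsh s l m) \<theta> \<psi> = of_real (raise_factor s l) * swsh (s + 1) l m \<theta> \<psi>"
  proof (cases "s = int l")
    case True
    then have "raise_factor s l = 0" by (simp add: raise_factor_def)
    then show ?thesis unfolding eth_swsh[OF assms] by simp
  next
    case False
    then have "\<bar>s + 1\<bar> \<le> int l" using assms by auto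
    from swsh_eq_polar_part[OF this assms(2)] show ?thesis unfolding eth_swsh[OF assms] by simp
  qed
  show "eth_bar s (swsh s l m) \<theta> \<psi> = - of_real (raise_factor (s - 1) l) * swsh (s - 1) l m \<theta> \<psi>"
  proof (cases "s = - int l")
    case True
    then have "raise_factor (s - 1) l = 0" by (simp add: raise_factor_def)
    then show ?thesis unfolding eth_swsh[OF assms] by simp
  next
    case False
    then have "\<bar>s - 1\<bar> \<le> int l" using assms by auto
    from swsh_eq_polar_part[OF this assms(2)] show ?thesis unfolding eth_swsh[OF assms] by simp
  qed
qed

lemma eth_cmult_swsh:
  assumes "\<bar>s\<bar> \<le> int l" "\<bar>m\<bar> \<le> int l"
  shows "eth s (\<lambda>\<theta> \<psi>. c * swsh s l m \<theta> \<psi>) \<theta> \<psi> = c * eth s (swsh s l m) \<theta> \<psi>"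
    and "eth_bar s (\<lambda>\<theta> \<psi>. c * swsh s l m \<theta> \<psi>) \<theta> \<psi> = c * eth_bar s (swsh s l m) \<theta> \<psi>"
proof -
  have "vector_derivative (\<lambda>t. c * swsh s l m t \<psi>) (at \<theta>) = c * vector_derivative (\<lambda>t. swsh s l m t \<psi>) (at \<theta>)"
    "vector_derivative (\<lambda>t. c * swsh s l m \<theta> t) (at \<psi>) = c * vector_derivative (\<lambda>t. swsh s l m \<theta> t) (at \<psi>)"
    using swsh_theta_vector_derivative[OF assms] swsh_psi_vector_derivative[OF assms]
    by (metis has_vector_derivative_mult_right vector_derivative_at)+
  then show "eth s (\<lambda>\<theta> \<psi>. c * swsh s l m \<theta> \<psi>) \<theta> \<psi> = c * eth s (swsh s l m) \<theta> \<psi>"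
    "eth_bar s (\<lambda>\<theta> \<psi>. c * swsh s l m \<theta> \<psi>) \<theta> \<psi> = c * eth_bar s (swsh s l m) \<theta> \<psi>"
    unfolding eth_def eth_bar_def by (simp_all add: algebra_simps)
qed

lemma at_within_Ici_nontrivial: "(x::real) \<ge> 0 \<Longrightarrow> at x within {0..} \<noteq> bot"
proof -
  assume "x \<ge> 0"
  then have "at_right x \<le> at x within {0..}" by (intro at_le) auto
  then show ?thesis using trivial_limit_at_right_real[of x] by (auto simp: bot_unique)
qed

lemma expansion_uniform_limit:
  assumes "has_expansion \<phi> a \<rho>0" "n \<le> 4" "\<tau> \<in> {-1..1}" "\<rho> \<in> {0..<\<rho>0}"
  shows "uniform_limit ({0<..<pi} \<times> UNIV)
     (\<lambda>N (\<theta>, \<psi>). \<Sum>p = nat \<bar>2 - int n\<bar>..N. \<Sum>l = nat \<bar>2 - int n\<bar>..p. \<Sum>m = - int l..int l.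
               field_deriv w (2 - int n) (mode a n p l m) \<tau> \<rho> \<theta> \<psi>)
     (\<lambda>(\<theta>, \<psi>). field_deriv w (2 - int n) (\<phi> n) \<tau> \<rho> \<theta> \<psi>) sequentially"
proof (rule uniform_limitI)
  fix e :: real assume "e > 0"
  have "uniform_limit ({-1..1} \<times> {0..\<rho>} \<times> {0<..<pi} \<times> UNIV)
          (\<lambda>N (\<tau>, \<rho>, \<theta>, \<psi>).
             \<Sum>p = nat \<bar>2 - int n\<bar>..N. \<Sum>l = nat \<bar>2 - int n\<bar>..p. \<Sum>m = - int l..int l.
               field_deriv w (2 - int n) (mode a n p l m) \<tau> \<rho> \<theta> \<psi>)
          (\<lambda>(\<tau>, \<rho>, \<theta>, \<psi>). field_deriv w (2 - int n) (\<phi> n) \<tau> \<rho> \<theta> \<psi>)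
          sequentially"
    using assms unfolding has_expansion_def by blast
  from uniform_limitD[OF this \<open>e > 0\<close>]
  show "\<forall>\<^sub>F N in sequentially. \<forall>x\<in>{0<..<pi} \<times> UNIV.
      dist (case x of (\<theta>, \<psi>) \<Rightarrow> \<Sum>p = nat \<bar>2 - int n\<bar>..N. \<Sum>l = nat \<bar>2 - int n\<bar>..p. \<Sum>m = - int l..int l.
               field_deriv w (2 - int n) (mode a n p l m) \<tau> \<rho> \<theta> \<psi>)
        (case x of (\<theta>, \<psi>) \<Rightarrow> field_deriv w (2 - int n) (\<phi> n) \<tau> \<rho> \<theta> \<psi>) < e"
  proof eventually_elim
    case (elim N)
    show ?case
    proof
      fix x :: "real \<times> real" assume x: "x \<in> {0<..<pi} \<times> UNIV"
      have "(\<tau>, \<rho>, x) \<in> {-1..1} \<times> {0..\<rho>} \<times> {0<..<pi} \<times> UNIV" using x assms by auto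
      from bspec[OF elim this] show "dist (case x of (\<theta>, \<psi>) \<Rightarrow> \<Sum>p = nat \<bar>2 - int n\<bar>..N. \<Sum>l = nat \<bar>2 - int n\<bar>..p. \<Sum>m = - int l..int l.
               field_deriv w (2 - int n) (mode a n p l m) \<tau> \<rho> \<theta> \<psi>)
        (case x of (\<theta>, \<psi>) \<Rightarrow> field_deriv w (2 - int n) (\<phi> n) \<tau> \<rho> \<theta> \<psi>) < e"
        by (simp add: case_prod_beta)
    qed
  qed
qed

section \<open>Projection of single terms of the field equations\<close>

fun shifted_spin :: "deriv_op list \<Rightarrow> int \<Rightarrow> int" where
  "shifted_spin [Eth] s = s + 1"
| "shifted_spin [EthBar] s = s - 1"
| "shifted_spin _ s = s"

text \<open>The field equations contain \<rho> times the \<rho>-derivative; the factor \<rho>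
  restores the power lost by differentiation, so that every term contributes to the same power of
  \<rho>.\<close>

definition rho_weight :: "deriv_op list \<Rightarrow> real \<Rightarrow> complex" where
  "rho_weight w \<rho> = (if w = [Rho] then of_real \<rho> else 1)"

fun mode_coeff :: "coeffs \<Rightarrow> deriv_op list \<Rightarrow> nat \<Rightarrow> nat \<Rightarrow> nat \<Rightarrow> int \<Rightarrow> real \<Rightarrow> complex" where
  "mode_coeff a [Tau] n p l m \<tau> = vector_derivative (a n p l m) (at \<tau> within {-1..1})"
| "mode_coeff a [Rho] n p l m \<tau> = of_nat p * a n p l m \<tau>"
| "mode_coeff a [Eth] n p l m \<tau> = of_real (raise_factor (2 - int n) l) * a n p l m \<tau>"
| "mode_coeff a [EthBar] n p l m \<tau> = - of_real (raise_factor (1 - int n) l) * a n p l m \<tau>"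
| "mode_coeff a _ n p l m \<tau> = a n p l m \<tau>"

definition simple_words :: "deriv_op list set" where
  "simple_words = {[], [Tau], [Rho], [Eth], [EthBar]}"

lemma field_deriv_mode:
  assumes w: "w \<in> simple_words" and l: "nat \<bar>2 - int n\<bar> \<le> l" and m: "\<bar>m\<bar> \<le> int l"
    and d: "a n p l m differentiable (at \<tau> within {-1..1})"
    and \<tau>: "\<tau> \<in> {-1..1}" and \<rho>: "\<rho> \<ge> 0" and \<theta>: "0 < \<theta>" "\<theta> < pi"
  shows "rho_weight w \<rho> * field_deriv w (2 - int n) (mode a n p l m) \<tau> \<rho> \<theta> \<psi>
    = mode_coeff a w n p l m \<tau> / fact p * of_real \<rho> ^ p * swsh (shifted_spin w (2 - int n)) l m \<theta> \<psi>"
proof -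
  have s: "sin \<theta> \<noteq> 0" using sin_gt_zero[OF \<theta>] by simp
  have sl: "\<bar>2 - int n\<bar> \<le> int l" using l by linarith
  define Y where "Y = swsh (2 - int n) l m \<theta> \<psi>"
  define K where "K = 1 / fact p * a n p l m \<tau> * of_real \<rho> ^ p"
  have md: "mode a n p l m \<tau> \<rho> = (\<lambda>\<theta> \<psi>. K * swsh (2 - int n) l m \<theta> \<psi>)"
    by (simp add: fun_eq_iff mode_def mult_ac K_def)
  consider "w = []" | "w = [Tau]" | "w = [Rho]" | "w = [Eth]" | "w = [EthBar]"
    using w unfolding simple_words_def by blast
  then show ?thesis
  proof cases
    case 1
    then show ?thesis by (simp add: rho_weight_def mode_def mult_ac)
  next
    case 2
    define a' where "a' = vector_derivative (a n p l m) (at \<tau> within {-1..1})"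
    have "(a n p l m has_vector_derivative a') (at \<tau> within {-1..1})"
      unfolding a'_def using d by (rule vector_derivative_works[THEN iffD1])
    then have "((\<lambda>t. (1 / fact p * of_real \<rho> ^ p * Y) * a n p l m t) has_vector_derivative (1 / fact p * of_real \<rho> ^ p * Y) * a') (at \<tau> within {-1..1})"
      by (rule has_vector_derivative_mult_right)
    then have "vector_derivative (\<lambda>t. (1 / fact p * of_real \<rho> ^ p * Y) * a n p l m t) (at \<tau> within {-1..1}) = (1 / fact p * of_real \<rho> ^ p * Y) * a'"
      using \<tau> by (intro vector_derivative_within_closed_interval) auto
    then show ?thesis unfolding 2 by (simp add: rho_weight_def d_tau_def mode_def a'_def Y_def mult_ac)
  next
    case 3
    have "((\<lambda>r. (1 / fact p * a n p l m \<tau> * Y) * of_real r ^ p) has_vector_derivative (1 / fact p * a n p l m \<tau> * Y) * (of_nat p * of_real \<rho> ^ (p - 1))) (at \<rho> within {0..})"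
    proof -
      have "((\<lambda>r. r ^ p) has_real_derivative real p * \<rho> ^ (p - 1)) (at \<rho> within {0..})"
        by (auto intro!: derivative_eq_intros)
      then have "((\<lambda>r. complex_of_real (r ^ p)) has_vector_derivative of_real (real p * \<rho> ^ (p - 1))) (at \<rho> within {0..})"
        by (rule has_vector_derivative_of_real)
      then show ?thesis by (intro has_vector_derivative_mult_right) simp
    qed
    then have "vector_derivative (\<lambda>r. (1 / fact p * a n p l m \<tau> * Y) * of_real r ^ p) (at \<rho> within {0..}) = (1 / fact p * a n p l m \<tau> * Y) * (of_nat p * of_real \<rho> ^ (p - 1))"
      by (rule vector_derivative_within[OF at_within_Ici_nontrivial[OF \<rho>]])
    then have "d_rho (mode a n p l m) \<tau> \<rho> \<theta> \<psi> = (1 / fact p * a n p l m \<tau> * Y) * (of_nat p * of_real \<rho> ^ (p - 1))"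
      unfolding d_rho_def mode_def Y_def by (simp add: mult_ac)
    then show ?thesis unfolding 3 by (cases p) (simp_all add: rho_weight_def Y_def mult_ac)
  next
    case 4
    show ?thesis unfolding 4
      by (simp add: rho_weight_def eth_field_def md eth_cmult_swsh(1)[OF sl m] eth_swsh_shift(1)[OF sl m s])
        (simp add: K_def mult_ac)
  next
    case 5
    show ?thesis unfolding 5
      by (simp add: rho_weight_def eth_bar_field_def md eth_cmult_swsh(2)[OF sl m] eth_swsh_shift(2)[OF sl m s])
        (simp add: K_def mult_ac)
  qed
qed

text \<open>The sums start at the lowest degree for the undifferentiated component, and an angular
  operator can push the spin weight beyond it, where \<open>swsh\<close> is meaningless. The ladder
  factor removes these terms.\<close>

lemma mode_coeff_eq_0:
  assumes "w \<in> simple_words" "nat \<bar>2 - int n\<bar> \<le> l" "int l < \<bar>shifted_spin w (2 - int n)\<bar>"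
  shows "mode_coeff a w n p l m \<tau> = 0"
proof -
  have "\<bar>2 - int n\<bar> \<le> int l" using assms(2) by linarith
  then show ?thesis
    using assms(1,3) unfolding simple_words_def
    by (auto simp: raise_factor_def)
qed

lemma sphere_proj_mode_sum:
  fixes \<kappa> :: "nat \<Rightarrow> nat \<Rightarrow> int \<Rightarrow> complex"
  assumes "\<bar>s\<bar> \<le> int l" "\<bar>m\<bar> \<le> int l" "q \<le> l"
    and z: "\<And>p l' m'. q \<le> l' \<Longrightarrow> int l' < \<bar>s\<bar> \<Longrightarrow> \<kappa> p l' m' = 0"
  shows "sphere_proj s l m (\<lambda>\<theta> \<psi>. \<Sum>p = q..N. \<Sum>l' = q..p. \<Sum>m' = - int l'..int l'. \<kappa> p l' m' * swsh s l' m' \<theta> \<psi>)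
    = (\<Sum>p = l..N. \<kappa> p l m)"
proof -
  have "sphere_proj s l m (\<lambda>\<theta> \<psi>. \<Sum>p = q..N. \<Sum>l' = q..p. \<Sum>m' = - int l'..int l'. \<kappa> p l' m' * swsh s l' m' \<theta> \<psi>)
    = (\<Sum>p = q..N. \<Sum>l' = q..p. \<Sum>m' = - int l'..int l'. \<kappa> p l' m' * sphere_proj s l m (swsh s l' m'))"
    by (simp add: sphere_proj_sum sphere_continuous_sum sphere_continuous_cmult sphere_continuous_swsh sphere_proj_cmult)
  also have "\<dots> = (\<Sum>p = q..N. \<Sum>l' = q..p. \<Sum>m' = - int l'..int l'. if l' = l then (if m' = m then \<kappa> p l m else 0) else 0)"
  proof (intro sum.cong refl)
    fix p l' m' assume A: "p \<in> {q..N}" "l' \<in> {q..p}" "m' \<in> {- int l'..int l'}"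
    show "\<kappa> p l' m' * sphere_proj s l m (swsh s l' m') = (if l' = l then (if m' = m then \<kappa> p l m else 0) else 0)"
    proof (cases "int l' < \<bar>s\<bar>")
      case True
      then show ?thesis using z[of l' p m'] A assms(1) by auto
    next
      case False
      then have "\<bar>s\<bar> \<le> int l'" by simp
      moreover have "\<bar>m'\<bar> \<le> int l'" using A by auto
      ultimately show ?thesis using sphere_proj_swsh[OF assms(1,2), of l' m'] by auto
    qed
  qed
  also have "\<dots> = (\<Sum>p = q..N. \<Sum>l' = q..p. if l' = l then \<kappa> p l m else 0)"
    using assms(2) by (intro sum.cong refl) auto
  also have "\<dots> = (\<Sum>p = q..N. if l \<le> p then \<kappa> p l m else 0)"
    using assms(3) by (intro sum.cong refl) auto
  also have "\<dots> = (\<Sum>p \<in> {q..N} \<inter> {p. l \<le> p}. \<kappa> p l m)"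
    by (simp add: sum.inter_restrict)
  also have "{q..N} \<inter> {p. l \<le> p} = {l..N}" using assms(3) by auto
  finally show ?thesis .
qed

lemma has_expansion_differentiable:
  assumes "has_expansion \<phi> a \<rho>0" "n \<le> 4" "nat \<bar>2 - int n\<bar> \<le> l" "l \<le> p" "\<bar>m\<bar> \<le> int l" "\<tau> \<in> {-1..1}"
  shows "((\<lambda>f t. vector_derivative f (at t within {-1..1})) ^^ j) (a n p l m) differentiable (at \<tau> within {-1..1})"
proof -
  have "p \<ge> nat \<bar>2 - int n\<bar>" "l \<in> {nat \<bar>2 - int n\<bar>..p}" "m \<in> {- int l..int l}" using assms by auto
  then show ?thesis using assms(1,2,6) unfolding has_expansion_def by blast
qed

lemma sphere_proj_field_deriv:
  assumes "has_expansion \<phi> a \<rho>0" "n \<le> 4" "\<tau> \<in> {-1..1}" "\<rho> \<in> {0..<\<rho>0}" "w \<in> simple_words"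
    and "2 \<le> l" "\<bar>m\<bar> \<le> int l" "shifted_spin w (2 - int n) = s" "\<bar>s\<bar> \<le> 2"
  shows "sphere_limit (\<lambda>\<theta> \<psi>. rho_weight w \<rho> * field_deriv w (2 - int n) (\<phi> n) \<tau> \<rho> \<theta> \<psi>)"
    and "(\<lambda>N. \<Sum>p = l..N. mode_coeff a w n p l m \<tau> / fact p * of_real \<rho> ^ p)
       \<longlonglongrightarrow> sphere_proj s l m (\<lambda>\<theta> \<psi>. rho_weight w \<rho> * field_deriv w (2 - int n) (\<phi> n) \<tau> \<rho> \<theta> \<psi>)"
proof -
  let ?q = "nat \<bar>2 - int n\<bar>"
  define F where "F = (\<lambda>\<theta> \<psi>. rho_weight w \<rho> * field_deriv w (2 - int n) (\<phi> n) \<tau> \<rho> \<theta> \<psi>)"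
  define f where "f N \<theta> \<psi> = (\<Sum>p = ?q..N. \<Sum>l = ?q..p. \<Sum>m = - int l..int l.
      mode_coeff a w n p l m \<tau> / fact p * of_real \<rho> ^ p * swsh s l m \<theta> \<psi>)" for N \<theta> \<psi>
  have eq: "rho_weight w \<rho> * (case x of (\<theta>, \<psi>) \<Rightarrow> (\<Sum>p = ?q..N. \<Sum>l = ?q..p. \<Sum>m = - int l..int l.
               field_deriv w (2 - int n) (mode a n p l m) \<tau> \<rho> \<theta> \<psi>)) = (case x of (\<theta>, \<psi>) \<Rightarrow> f N \<theta> \<psi>)"
    if "x \<in> {0<..<pi} \<times> UNIV" for x N
  proof -
    define \<theta> \<psi> where "\<theta> = fst x" "\<psi> = snd x"
    then have x: "x = (\<theta>, \<psi>)" "0 < \<theta>" "\<theta> < pi" using that by auto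
    have "rho_weight w \<rho> * field_deriv w (2 - int n) (mode a n p l m) \<tau> \<rho> \<theta> \<psi>
       = mode_coeff a w n p l m \<tau> / fact p * of_real \<rho> ^ p * swsh s l m \<theta> \<psi>"
      if "p \<in> {?q..N}" "l \<in> {?q..p}" "m \<in> {- int l..int l}" for p l m
      unfolding assms(8)[symmetric]
      using that assms x has_expansion_differentiable[OF assms(1,2), of l p m \<tau> 0]
      by (intro field_deriv_mode) auto
    then show ?thesis unfolding x f_def sum_distrib_left prod.case by (intro sum.cong refl) auto
  qed
  have "uniform_limit ({0<..<pi} \<times> UNIV)
     (\<lambda>N x. rho_weight w \<rho> * (case x of (\<theta>, \<psi>) \<Rightarrow> \<Sum>p = ?q..N. \<Sum>l = ?q..p. \<Sum>m = - int l..int l.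
               field_deriv w (2 - int n) (mode a n p l m) \<tau> \<rho> \<theta> \<psi>))
     (\<lambda>x. rho_weight w \<rho> * (case x of (\<theta>, \<psi>) \<Rightarrow> field_deriv w (2 - int n) (\<phi> n) \<tau> \<rho> \<theta> \<psi>)) sequentially"
    by (rule bounded_linear.uniform_limit[OF bounded_linear_mult_right expansion_uniform_limit[OF assms(1-4)]])
  then have lim: "uniform_limit ({0<..<pi} \<times> UNIV) (\<lambda>N (\<theta>, \<psi>). f N \<theta> \<psi>) (\<lambda>(\<theta>, \<psi>). F \<theta> \<psi>) sequentially"
    by (rule uniform_limit_cong'[THEN iffD1, rotated 2]) (use eq in \<open>auto simp: F_def\<close>)
  have c: "sphere_continuous (f N)" for N
    unfolding f_def by (intro sphere_continuous_sum sphere_continuous_cmult sphere_continuous_swsh)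
  show "sphere_limit (\<lambda>\<theta> \<psi>. rho_weight w \<rho> * field_deriv w (2 - int n) (\<phi> n) \<tau> \<rho> \<theta> \<psi>)"
    unfolding F_def[symmetric] sphere_limit_def using c lim by blast
  have ql: "?q \<le> l" using assms(2,6) by auto
  have "sphere_proj s l m (f N) = (\<Sum>p = l..N. mode_coeff a w n p l m \<tau> / fact p * of_real \<rho> ^ p)" for N
    unfolding f_def
    by (rule sphere_proj_mode_sum) (use assms ql mode_coeff_eq_0[OF assms(5)] in auto)
  then show "(\<lambda>N. \<Sum>p = l..N. mode_coeff a w n p l m \<tau> / fact p * of_real \<rho> ^ p)
       \<longlonglongrightarrow> sphere_proj s l m (\<lambda>\<theta> \<psi>. rho_weight w \<rho> * field_deriv w (2 - int n) (\<phi> n) \<tau> \<rho> \<theta> \<psi>)"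
    using sphere_proj_uniform_limit[OF c lim, of s l m] unfolding F_def by simp
qed

text \<open>Convergence to 0 is known only for real \<rho> in a right neighbourhood of 0. Once the
  earlier coefficients vanish, division by \<rho> ^ q and the limit \<rho> \<rightarrow> 0 from the
  right give the next one; convergence at R / 2 makes the series a continuous complex power series
  near 0.\<close>

lemma power_series_zero_unique:
  fixes e :: "nat \<Rightarrow> complex"
  assumes R: "R > 0" and z: "\<And>\<rho>. 0 \<le> \<rho> \<Longrightarrow> \<rho> < R \<Longrightarrow> (\<lambda>N. \<Sum>p = l..N. e p * of_real \<rho> ^ p) \<longlonglongrightarrow> 0"
    and "p \<ge> l"
  shows "e p = 0"
  using \<open>p \<ge> l\<close>
proof (induction p rule: less_induct)
  case (less q)
  define f where "f k = e (k + q)" for k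
  have sums: "(\<lambda>k. f k * of_real \<rho> ^ k) sums 0" if \<rho>: "0 < \<rho>" "\<rho> < R" for \<rho>
  proof -
    have "(\<Sum>p = l..<n + q. e p * of_real \<rho> ^ p) = of_real \<rho> ^ q * (\<Sum>k<n. f k * of_real \<rho> ^ k)" for n
    proof -
      have "(\<Sum>p = l..<n + q. e p * of_real \<rho> ^ p) = (\<Sum>p = q..<n + q. e p * of_real \<rho> ^ p)"
        using less by (intro sum.mono_neutral_right) auto
      also have "\<dots> = (\<Sum>k = 0..<n. e (k + q) * of_real \<rho> ^ (k + q))"
        using sum.shift_bounds_nat_ivl[of "\<lambda>p. e p * of_real \<rho> ^ p" 0 q n] by simp
      finally show ?thesis by (simp add: f_def power_add sum_distrib_left mult_ac atLeast0LessThan)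
    qed
    moreover have "(\<lambda>n. \<Sum>p = l..<n + q. e p * of_real \<rho> ^ p) \<longlonglongrightarrow> 0"
    proof -
      have "(\<lambda>n. \<Sum>p = l..<Suc n. e p * of_real \<rho> ^ p) \<longlonglongrightarrow> 0"
        using z[of \<rho>] \<rho> by (simp add: atLeastLessThanSuc_atLeastAtMost)
      then have "(\<lambda>n. \<Sum>p = l..<n. e p * of_real \<rho> ^ p) \<longlonglongrightarrow> 0" by (rule LIMSEQ_imp_Suc)
      then show ?thesis by (rule LIMSEQ_ignore_initial_segment)
    qed
    ultimately have "(\<lambda>n. of_real \<rho> ^ q * (\<Sum>k<n. f k * of_real \<rho> ^ k)) \<longlonglongrightarrow> 0" by simp
    from tendsto_mult_left[OF this, of "inverse (of_real \<rho> ^ q)"]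
    have "(\<lambda>n. \<Sum>k<n. f k * of_real \<rho> ^ k) \<longlonglongrightarrow> 0" using \<rho> by (simp add: field_simps)
    then show ?thesis unfolding sums_def .
  qed
  define g where "g z = (\<Sum>k. f k * z ^ k)" for z :: complex
  have "(g \<longlongrightarrow> f 0) (at 0)"
  proof (rule powser_limit_0_strong[of "R / 2"])
    show "0 < R / 2" using R by simp
    fix z :: complex assume z: "norm z < R / 2"
    have "summable (\<lambda>k. f k * of_real (R / 2) ^ k)" using sums[of "R / 2"] R by (auto simp: sums_iff)
    then have "summable (\<lambda>k. f k * z ^ k)" by (rule powser_inside) (use z R in simp)
    then show "(\<lambda>k. f k * z ^ k) sums g z" unfolding g_def by (rule summable_sums)
  qed
  moreover have "filterlim complex_of_real (at 0) (at_right 0)"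
    unfolding filterlim_at
    by (auto intro!: tendsto_eq_intros simp: eventually_at_filter)
  ultimately have lim: "((\<lambda>\<rho>. g (of_real \<rho>)) \<longlongrightarrow> f 0) (at_right 0)"
    by (rule filterlim_compose)
  have "\<forall>\<^sub>F \<rho> in at_right 0. g (of_real \<rho>) = 0"
    using eventually_at_right_real[OF R]
    by eventually_elim (use sums in \<open>auto simp: g_def sums_iff\<close>)
  from tendsto_cong[OF this] have "((\<lambda>\<rho>::real. 0) \<longlongrightarrow> f 0) (at_right (0::real))" using lim by simp
  then have "f 0 = 0" using tendsto_unique[OF trivial_limit_at_right_real _ tendsto_const] by metis
  then show ?case by (simp add: f_def)
qed

text \<open>A field equation is encoded as a list of triples (factor, component, derivative word),
  so that a single argument serves all of them: project to a harmonic and compare the coefficients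
  of the resulting power series in \<rho>. The factors may depend on the fixed \<tau>, whereas
  \<rho> enters only through \<open>rho_weight\<close>.\<close>

lemma mode_equation:
  fixes ts :: "(complex \<times> nat \<times> deriv_op list) list"
  assumes ex: "has_expansion \<phi> a \<rho>0" and \<rho>0: "0 < \<rho>0" and \<tau>: "\<tau> \<in> {-1..1}"
    and lm: "2 \<le> l" "\<bar>m\<bar> \<le> int l" "l \<le> p" and s: "\<bar>s\<bar> \<le> 2"
    and ts: "\<And>c n w. (c, n, w) \<in> set ts \<Longrightarrow> n \<le> 4 \<and> w \<in> simple_words \<and> shifted_spin w (2 - int n) = s"
    and eq: "\<And>\<rho> \<theta> \<psi>. 0 \<le> \<rho> \<Longrightarrow> 0 < \<theta> \<Longrightarrow> \<theta> < pi \<Longrightarrow>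
       (\<Sum>(c, n, w)\<leftarrow>ts. c * (rho_weight w \<rho> * field_deriv w (2 - int n) (\<phi> n) \<tau> \<rho> \<theta> \<psi>)) = 0"
  shows "(\<Sum>(c, n, w)\<leftarrow>ts. c * mode_coeff a w n p l m \<tau>) = 0"
proof -
  have "(\<lambda>N. \<Sum>p = l..N. (\<Sum>(c, n, w)\<leftarrow>ts. c * mode_coeff a w n p l m \<tau>) / fact p * of_real \<rho> ^ p) \<longlonglongrightarrow> 0"
    if \<rho>: "0 \<le> \<rho>" "\<rho> < \<rho>0" for \<rho>
  proof -
    have \<rho>': "\<rho> \<in> {0..<\<rho>0}" using \<rho> by simp
    have "sphere_limit (\<lambda>\<theta> \<psi>. \<Sum>(c, n, w)\<leftarrow>ts. c * (rho_weight w \<rho> * field_deriv w (2 - int n) (\<phi> n) \<tau> \<rho> \<theta> \<psi>)) \<and>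
      (\<lambda>N. \<Sum>p = l..N. (\<Sum>(c, n, w)\<leftarrow>ts. c * mode_coeff a w n p l m \<tau>) / fact p * of_real \<rho> ^ p)
       \<longlonglongrightarrow> sphere_proj s l m (\<lambda>\<theta> \<psi>. \<Sum>(c, n, w)\<leftarrow>ts. c * (rho_weight w \<rho> * field_deriv w (2 - int n) (\<phi> n) \<tau> \<rho> \<theta> \<psi>))"
      using ts
    proof (induction ts)
      case Nil
      have "sphere_continuous (\<lambda>\<theta> \<psi>. 0)" by (simp add: sphere_continuous_def)
      then have "sphere_limit (\<lambda>\<theta> \<psi>. 0)" unfolding sphere_limit_def
        by (intro exI[of _ "\<lambda>N \<theta> \<psi>. 0"]) (auto intro: uniform_limit_const simp: case_prod_beta)
      moreover have "sphere_proj s l m (\<lambda>\<theta> \<psi>. 0) = 0" by (simp add: sphere_proj_def sphere_integral_def)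
      ultimately show ?case by simp
    next
      case (Cons t ts)
      obtain c n w where t: "t = (c, n, w)" by (cases t)
      have nw: "n \<le> 4" "w \<in> simple_words" "shifted_spin w (2 - int n) = s" using Cons.prems[of c n w] t by auto
      define F where "F = (\<lambda>\<theta> \<psi>. rho_weight w \<rho> * field_deriv w (2 - int n) (\<phi> n) \<tau> \<rho> \<theta> \<psi>)"
      define G where "G = (\<lambda>\<theta> \<psi>. \<Sum>(c, n, w)\<leftarrow>ts. c * (rho_weight w \<rho> * field_deriv w (2 - int n) (\<phi> n) \<tau> \<rho> \<theta> \<psi>))"
      note T = sphere_proj_field_deriv[OF ex nw(1) \<tau> \<rho>' nw(2) lm(1,2) nw(3) s, folded F_def]
      have IH: "sphere_limit G" "(\<lambda>N. \<Sum>p = l..N. (\<Sum>(c, n, w)\<leftarrow>ts. c * mode_coeff a w n p l m \<tau>) / fact p * of_real \<rho> ^ p)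
        \<longlonglongrightarrow> sphere_proj s l m G"
        using Cons unfolding G_def by auto
      note cF = sphere_limit_cmult[OF T(1), of c]
      have "(\<lambda>N. c * (\<Sum>p = l..N. mode_coeff a w n p l m \<tau> / fact p * of_real \<rho> ^ p)
          + (\<Sum>p = l..N. (\<Sum>(c, n, w)\<leftarrow>ts. c * mode_coeff a w n p l m \<tau>) / fact p * of_real \<rho> ^ p))
        \<longlonglongrightarrow> sphere_proj s l m (\<lambda>\<theta> \<psi>. c * F \<theta> \<psi>) + sphere_proj s l m G"
        unfolding sphere_proj_cmult by (intro tendsto_intros T IH)
      then have "(\<lambda>N. \<Sum>p = l..N. (\<Sum>(c, n, w)\<leftarrow>t # ts. c * mode_coeff a w n p l m \<tau>) / fact p * of_real \<rho> ^ p)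
        \<longlonglongrightarrow> sphere_proj s l m (\<lambda>\<theta> \<psi>. c * F \<theta> \<psi> + G \<theta> \<psi>)"
        unfolding sphere_proj_limit_add(2)[OF cF IH(1)]
        by (simp add: t sum_distrib_left sum.distrib[symmetric] add_divide_distrib distrib_left distrib_right mult_ac)
      then show ?case using sphere_proj_limit_add(1)[OF cF IH(1)] by (simp add: t F_def G_def)
    qed
    moreover have "sphere_proj s l m (\<lambda>\<theta> \<psi>. \<Sum>(c, n, w)\<leftarrow>ts. c * (rho_weight w \<rho> * field_deriv w (2 - int n) (\<phi> n) \<tau> \<rho> \<theta> \<psi>))
        = sphere_proj s l m (\<lambda>\<theta> \<psi>. 0)"
      using eq[OF \<rho>(1)] by (rule sphere_proj_cong)
    moreover have "sphere_proj s l m (\<lambda>\<theta> \<psi>. 0) = 0" by (simp add: sphere_proj_def sphere_integral_def)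
    ultimately show ?thesis by simp
  qed
  from power_series_zero_unique[OF \<rho>0 this lm(3)] show ?thesis by simp
qed

lemma raise_factor_reflect: "raise_factor (- 1 - s) l = raise_factor s l"
  by (simp add: raise_factor_def algebra_simps)

text \<open>The second relation minus the third eliminates a_2, which leaves with the first a closed
  system for a_0 and a_1. The last three, taken at \<tau> = 0, become algebraic and relate a_1, a_2,
  a_3 to the data a_0 and a_4.\<close>

lemma spin2_mode_equations:
  fixes \<phi> :: "nat \<Rightarrow> field" and a :: coeffs
  assumes sp: "massless_spin2 \<phi>" and ex: "has_expansion \<phi> a \<rho>0" and \<rho>0: "0 < \<rho>0"
    and \<tau>: "\<tau> \<in> {-1..1}" and lm: "2 \<le> l" "\<bar>m\<bar> \<le> int l" "l \<le> p"
  defines "A \<equiv> \<lambda>n. a n p l m \<tau>" and "A' \<equiv> \<lambda>n. vector_derivative (a n p l m) (at \<tau> within {-1..1})"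
    and "L1 \<equiv> complex_of_real (raise_factor 1 l)" and "L0 \<equiv> complex_of_real (raise_factor 0 l)"
  shows "(1 + of_real \<tau>) * A' 0 - of_nat p * A 0 + L1 * A 1 + 2 * A 0 = 0"
    and "A' 1 - L1 / 2 * A 0 + L0 / 2 * A 2 + A 1 = 0"
    and "of_real \<tau> * A' 1 - of_nat p * A 1 + L0 / 2 * A 2 + L1 / 2 * A 0 = 0"
    and "of_real \<tau> * A' 2 - of_nat p * A 2 + L0 / 2 * A 3 + L0 / 2 * A 1 = 0"
    and "of_real \<tau> * A' 3 - of_nat p * A 3 + L1 / 2 * A 4 + L0 / 2 * A 2 = 0"
proof -
  \<comment> \<open>The reflection s \<mapsto> - 1 - s leaves only the two ladder factors
    \<open>L0\<close> and \<open>L1\<close>.\<close>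
  have r: "raise_factor (-1) l = raise_factor 0 l" "raise_factor (-2) l = raise_factor 1 l"
    using raise_factor_reflect[of 0 l] raise_factor_reflect[of 1 l] by simp_all
  note E = mode_equation[OF ex \<rho>0 \<tau> lm]
  have eqs: "(1 + of_real \<tau>) * d_tau (\<phi> 0) \<tau> \<rho> \<theta> \<psi> - of_real \<rho> * d_rho (\<phi> 0) \<tau> \<rho> \<theta> \<psi>
          + eth_field 1 (\<phi> 1) \<tau> \<rho> \<theta> \<psi> = - 2 * \<phi> 0 \<tau> \<rho> \<theta> \<psi>"
     "d_tau (\<phi> 1) \<tau> \<rho> \<theta> \<psi> + eth_bar_field 2 (\<phi> 0) \<tau> \<rho> \<theta> \<psi> / 2
          + eth_field 0 (\<phi> 2) \<tau> \<rho> \<theta> \<psi> / 2 = - \<phi> 1 \<tau> \<rho> \<theta> \<psi>"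
     "\<And>k. k \<in> {1, 2, 3} \<Longrightarrow> of_real \<tau> * d_tau (\<phi> k) \<tau> \<rho> \<theta> \<psi> - of_real \<rho> * d_rho (\<phi> k) \<tau> \<rho> \<theta> \<psi>
             + eth_field (1 - int k) (\<phi> (k + 1)) \<tau> \<rho> \<theta> \<psi> / 2
             - eth_bar_field (3 - int k) (\<phi> (k - 1)) \<tau> \<rho> \<theta> \<psi> / 2 = 0"
    if "0 \<le> \<rho>" "0 < \<theta>" "\<theta> < pi" for \<rho> \<theta> \<psi>
    using sp that \<tau> unfolding massless_spin2_def by auto
  have "(\<Sum>(c, n, w)\<leftarrow>[(1 + of_real \<tau>, 0, [Tau]), (-1, 0, [Rho]), (1, 1, [Eth]), (2, 0, [])]. c * mode_coeff a w n p l m \<tau>) = 0"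
    by (rule E[of 2]) (use eqs(1) in \<open>auto simp: simple_words_def rho_weight_def add_eq_0_iff2 algebra_simps\<close>)
  then show "(1 + of_real \<tau>) * A' 0 - of_nat p * A 0 + L1 * A 1 + 2 * A 0 = 0"
    unfolding A_def A'_def L1_def by (simp add: algebra_simps)
  have "(\<Sum>(c, n, w)\<leftarrow>[(1, 1, [Tau]), (1 / 2, 0, [EthBar]), (1 / 2, 2, [Eth]), (1, 1, [])]. c * mode_coeff a w n p l m \<tau>) = 0"
    by (rule E[of 1]) (use eqs(2) in \<open>auto simp: simple_words_def rho_weight_def add_eq_0_iff2 algebra_simps\<close>)
  then show "A' 1 - L1 / 2 * A 0 + L0 / 2 * A 2 + A 1 = 0"
    unfolding A_def A'_def L1_def L0_def by (simp add: algebra_simps)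
  have "(\<Sum>(c, n, w)\<leftarrow>[(of_real \<tau>, 1, [Tau]), (- 1, 1, [Rho]), (1 / 2, 2, [Eth]), (- 1 / 2, 0, [EthBar])]. c * mode_coeff a w n p l m \<tau>) = 0"
    by (rule E[of 1]) (use eqs(3)[of _ _ 1] in \<open>auto simp: simple_words_def rho_weight_def algebra_simps numeral_2_eq_2\<close>)
  then show "of_real \<tau> * A' 1 - of_nat p * A 1 + L0 / 2 * A 2 + L1 / 2 * A 0 = 0"
    unfolding A_def A'_def L1_def L0_def by (simp add: algebra_simps)
  have "(\<Sum>(c, n, w)\<leftarrow>[(of_real \<tau>, 2, [Tau]), (- 1, 2, [Rho]), (1 / 2, 3, [Eth]), (- 1 / 2, 1, [EthBar])]. c * mode_coeff a w n p l m \<tau>) = 0"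
    by (rule E[of 0]) (use eqs(3)[of _ _ 2] in \<open>auto simp: simple_words_def rho_weight_def algebra_simps numeral_3_eq_3\<close>)
  then show "of_real \<tau> * A' 2 - of_nat p * A 2 + L0 / 2 * A 3 + L0 / 2 * A 1 = 0"
    unfolding A_def A'_def L1_def L0_def by (simp add: algebra_simps r)
  have "(\<Sum>(c, n, w)\<leftarrow>[(of_real \<tau>, 3, [Tau]), (- 1, 3, [Rho]), (1 / 2, 4, [Eth]), (- 1 / 2, 2, [EthBar])]. c * mode_coeff a w n p l m \<tau>) = 0"
    by (rule E[of "-1"]) (use eqs(3)[of _ _ 3] in \<open>auto simp: simple_words_def rho_weight_def algebra_simps eval_nat_numeral\<close>)
  then show "of_real \<tau> * A' 3 - of_nat p * A 3 + L1 / 2 * A 4 + L0 / 2 * A 2 = 0"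
    unfolding A_def A'_def L1_def L0_def by (simp add: algebra_simps r)
qed

section \<open>The transport equations of a single mode\<close>

text \<open>A function together with all its derivatives, one-sided at the ends. The interval 0
  \<le> u \<le> 1 is -1 \<le> \<tau> \<le> 0: it joins past null infinity to the initial
  surface.\<close>

definition derivative_chain :: "(nat \<Rightarrow> real \<Rightarrow> complex) \<Rightarrow> bool" where
  "derivative_chain b \<longleftrightarrow> (\<forall>k. \<forall>u\<in>{0..1}. (b k has_vector_derivative b (Suc k) u) (at u within {0..1}))"

lemma vector_derivative_unique_Icc:
  fixes f g :: "real \<Rightarrow> complex"
  assumes "(f has_vector_derivative f') (at u within {a..b})" "(g has_vector_derivative g') (at u within {a..b})"
    and "\<And>v. v \<in> {a..b} \<Longrightarrow> f v = g v" "u \<in> {a..b}" "a < b"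
  shows "f' = g'"
proof -
  have "(f has_vector_derivative g') (at u within {a..b})"
    by (rule has_vector_derivative_transform[OF assms(4) _ assms(2)]) (simp add: assms(3))
  then show ?thesis
    using vector_derivative_unique_within_closed_interval[of a b u f f' g'] assms by simp
qed

lemma derivative_chain_unique:
  assumes "derivative_chain b" "derivative_chain c" "\<And>u. u \<in> {0..1} \<Longrightarrow> b 0 u = c 0 u" "u \<in> {0..1}"
  shows "b k u = c k u"
  using assms(4)
proof (induction k arbitrary: u)
  case 0
  then show ?case using assms(3) by simp
next
  case (Suc k)
  have "(b k has_vector_derivative b (Suc k) u) (at u within {0..1})" "(c k has_vector_derivative c (Suc k) u) (at u within {0..1})"
    using assms(1,2) Suc.prems unfolding derivative_chain_def by auto
  then show ?case by (rule vector_derivative_unique_Icc) (use Suc in auto)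
qed

lemma has_vector_derivative_reparam:
  fixes f :: "real \<Rightarrow> complex"
  assumes "(f has_vector_derivative f') (at (u - 1) within {-1..1})" "u \<in> {0..1}"
  shows "((\<lambda>u. f (u - 1)) has_vector_derivative f') (at u within {0..1})"
proof -
  have g: "((\<lambda>u. u - 1) has_vector_derivative 1) (at u within {0..1::real})"
    by (auto intro!: derivative_eq_intros)
  have "(f has_vector_derivative f') (at (u - 1) within ((\<lambda>u. u - 1) ` {0..1}))"
    by (rule has_vector_derivative_within_subset[OF assms(1)]) auto
  from vector_diff_chain_within[OF g this] show ?thesis by (simp add: o_def)
qed

lemma has_vector_derivative_two_minus_power:
  "((\<lambda>u. complex_of_real (2 - u) ^ Suc n) has_vector_derivative - of_nat (Suc n) * complex_of_real (2 - u) ^ n) (at u within S)"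
proof -
  have "((\<lambda>u. (2 - u) ^ Suc n) has_real_derivative - real (Suc n) * (2 - u) ^ n) (at u within S)"
    by (auto intro!: derivative_eq_intros simp del: power_Suc of_nat_Suc)
  from has_vector_derivative_of_real[OF this] show ?thesis
    by (simp del: power_Suc of_nat_Suc)
qed

lemma reduced_mode_equation:
  fixes L :: complex and a0 a0' a1 a1' :: "real \<Rightarrow> complex"
  assumes a0: "\<And>t. t \<in> {-1..1} \<Longrightarrow> (a0 has_vector_derivative a0' t) (at t within {-1..1})"
    and a1: "\<And>t. t \<in> {-1..1} \<Longrightarrow> (a1 has_vector_derivative a1' t) (at t within {-1..1})"
    and e0: "\<And>t. t \<in> {-1..1} \<Longrightarrow> (1 + of_real t) * a0' t = (of_nat p - 2) * a0 t - L * a1 t"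
    and e1: "\<And>t. t \<in> {-1..1} \<Longrightarrow> (1 - of_real t) * a1' t = L * a0 t - (of_nat p + 1) * a1 t"
    and b: "derivative_chain b" "\<And>u. u \<in> {0..1} \<Longrightarrow> a0 (u - 1) = of_real (2 - u) ^ (p + 2) * b 0 u"
    and u: "u \<in> {0..1}"
  shows "of_real u * (2 - of_real u) * b 2 u = (2 * (of_nat p - 3) + 6 * of_real u) * b 1 u - (L ^ 2 - 4) * b 0 u"
proof -
  define w where "w = (\<lambda>u. complex_of_real (2 - u))"
  have b0: "(b 0 has_vector_derivative b 1 v) (at v within {0..1})"
    and b1: "(b 1 has_vector_derivative b 2 v) (at v within {0..1})" if "v \<in> {0..1}" for v
    using b(1) that unfolding derivative_chain_def by (auto simp: numeral_2_eq_2)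
  have dw: "((\<lambda>u. w u ^ Suc n) has_vector_derivative - of_nat (Suc n) * w u ^ n) (at u within S)" for n u S
    unfolding w_def by (rule has_vector_derivative_two_minus_power)
  have a0'_eq: "a0' (v - 1) = w v ^ (p + 2) * b 1 v - of_nat (p + 2) * w v ^ (p + 1) * b 0 v" if v: "v \<in> {0..1}" for v
  proof -
    have "((\<lambda>u. a0 (u - 1)) has_vector_derivative a0' (v - 1)) (at v within {0..1})"
      using v by (intro has_vector_derivative_reparam a0) auto
    moreover have "((\<lambda>u. w u ^ Suc (p + 1) * b 0 u) has_vector_derivative
        w v ^ Suc (p + 1) * b 1 v + (- of_nat (Suc (p + 1)) * w v ^ (p + 1)) * b 0 v) (at v within {0..1})"
      by (intro has_vector_derivative_mult b0 v) (rule dw)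
    ultimately have "a0' (v - 1) = w v ^ Suc (p + 1) * b 1 v + (- of_nat (Suc (p + 1)) * w v ^ (p + 1)) * b 0 v"
      by (rule vector_derivative_unique_Icc) (use v b(2) in \<open>auto simp: w_def\<close>)
    then show ?thesis by (simp add: algebra_simps)
  qed
  \<comment> \<open>By the first equation \<open>L * a1\<close> is \<open>w ^ (p + 1) * c\<close>.
    Working with this product avoids division by \<open>L\<close>, and the second equation
    multiplied by \<open>L\<close> needs only \<open>L ^ 2\<close>.\<close>
  define c where "c v = (2 * (of_nat p - 2) + 4 * of_real v) * b 0 v - of_real v * (2 - of_real v) * b 1 v" for v
  have La1: "L * a1 (v - 1) = w v ^ (p + 1) * c v" if v: "v \<in> {0..1}" for v
  proof -
    have "L * a1 (v - 1) = (of_nat p - 2) * a0 (v - 1) - (1 + of_real (v - 1)) * a0' (v - 1)"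
      using e0[of "v - 1"] v by simp
    also have "\<dots> = w v ^ (p + 1) * c v"
      unfolding a0'_eq[OF v] b(2)[OF v] c_def w_def by (simp add: algebra_simps)
    finally show ?thesis .
  qed
  define c' where "c' = 4 * b 0 u + (2 * (of_nat p - 2) + 4 * of_real u) * b 1 u
     - ((2 - 2 * of_real u) * b 1 u + of_real u * (2 - of_real u) * b 2 u)"
  have dc: "(c has_vector_derivative c') (at u within {0..1})"
    unfolding c_def[abs_def] c'_def
    by (rule derivative_eq_intros refl b0[OF u] b1[OF u] | simp add: algebra_simps)+
  have "((\<lambda>v. w v ^ Suc p * c v) has_vector_derivative w u ^ Suc p * c' + (- of_nat (Suc p) * w u ^ p) * c u) (at u within {0..1})"
    by (intro has_vector_derivative_mult dc) (rule dw)
  moreover have "((\<lambda>v. L * a1 (v - 1)) has_vector_derivative L * a1' (u - 1)) (at u within {0..1})"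
    using u by (intro has_vector_derivative_mult_right has_vector_derivative_reparam a1) auto
  ultimately have L1: "w u ^ Suc p * c' + (- of_nat (Suc p) * w u ^ p) * c u = L * a1' (u - 1)"
    by (rule vector_derivative_unique_Icc) (use u La1 in auto)
  have "w u * (L * a1' (u - 1)) = L * ((1 - of_real (u - 1)) * a1' (u - 1))" by (simp add: w_def)
  also have "(1 - of_real (u - 1)) * a1' (u - 1) = L * a0 (u - 1) - (of_nat p + 1) * a1 (u - 1)"
    using u by (intro e1) auto
  also have "L * \<dots> = L ^ 2 * a0 (u - 1) - (of_nat p + 1) * (L * a1 (u - 1))"
    by (simp add: power2_eq_square algebra_simps)
  also have "\<dots> = L ^ 2 * (w u ^ (p + 2) * b 0 u) - (of_nat p + 1) * (w u ^ (p + 1) * c u)"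
    unfolding La1[OF u] b(2)[OF u] w_def ..
  finally have "w u ^ (p + 2) * c' = w u ^ (p + 2) * (L ^ 2 * b 0 u)"
    unfolding L1[symmetric] by (simp add: algebra_simps)
  moreover have "w u \<noteq> 0" unfolding w_def of_real_eq_0_iff using u by auto
  ultimately have "c' = L ^ 2 * b 0 u" by simp
  then show ?thesis unfolding c'_def by (simp add: algebra_simps)
qed

text \<open>The k-fold differentiated equation. For \<open>K = (l - 1) (l + 2) - 4\<close> the
  coefficient \<open>k (k + 5) - K\<close> factors as \<open>(k - (l - 2)) (k + l + 3)\<close>, so
  at \<open>u = 0\<close> it vanishes for \<open>k = l - 2\<close>.\<close>

lemma reduced_mode_recursion:
  assumes b: "derivative_chain b"
    and ode: "\<And>u. u \<in> {0..1} \<Longrightarrow>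
      of_real u * (2 - of_real u) * b 2 u = (2 * (of_nat p - 3) + 6 * of_real u) * b 1 u - K * b 0 u"
    and u: "u \<in> {0..1}"
  shows "of_real u * (2 - of_real u) * b (k + 2) u =
    (2 * (of_nat p - 3 - of_nat k) + (6 + 2 * of_nat k) * of_real u) * b (k + 1) u
    + (of_nat k * (of_nat k + 5) - K) * b k u"
  using u
proof (induction k arbitrary: u)
  case 0
  then show ?case using ode[of u] by (simp add: numeral_2_eq_2)
next
  case (Suc k)
  have d: "(b j has_vector_derivative b (j + 1) u) (at u within {0..1})" for j
    using b Suc.prems unfolding derivative_chain_def by auto
  have "((\<lambda>u. of_real u * (2 - of_real u) * b (k + 2) u) has_vector_derivative
      (2 - 2 * of_real u) * b (k + 2) u + of_real u * (2 - of_real u) * b (k + 2 + 1) u) (at u within {0..1})"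
    by (rule derivative_eq_intros refl d | simp add: algebra_simps)+
  moreover have "((\<lambda>u. (2 * (of_nat p - 3 - of_nat k) + (6 + 2 * of_nat k) * of_real u) * b (k + 1) u
    + (of_nat k * (of_nat k + 5) - K) * b k u) has_vector_derivative
      (6 + 2 * of_nat k) * b (k + 1) u + (2 * (of_nat p - 3 - of_nat k) + (6 + 2 * of_nat k) * of_real u) * b (k + 1 + 1) u
    + (of_nat k * (of_nat k + 5) - K) * b (k + 1) u) (at u within {0..1})"
    by (rule derivative_eq_intros refl d | simp add: algebra_simps)+
  ultimately have "(2 - 2 * of_real u) * b (k + 2) u + of_real u * (2 - of_real u) * b (k + 2 + 1) u
     = (6 + 2 * of_nat k) * b (k + 1) u + (2 * (of_nat p - 3 - of_nat k) + (6 + 2 * of_nat k) * of_real u) * b (k + 1 + 1) u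
    + (of_nat k * (of_nat k + 5) - K) * b (k + 1) u"
    by (rule vector_derivative_unique_Icc) (use Suc in auto)
  then show ?case by (simp add: algebra_simps)
qed

lemma reduced_mode_coefficient_eq_0:
  assumes b: "derivative_chain b"
    and ode: "\<And>u. u \<in> {0..1} \<Longrightarrow>
      of_real u * (2 - of_real u) * b 2 u = (2 * (of_nat p - 3) + 6 * of_real u) * b 1 u - (of_nat (l - 1) * of_nat (l + 2) - 4) * b 0 u"
    and l: "2 \<le> l" and p: "p \<noteq> l + 1"
  shows "b (l - 1) 0 = 0"
proof -
  obtain k where k: "l = k + 2" using l by (metis add.commute le_Suc_ex)
  from reduced_mode_recursion[OF b ode, of 0 k]
  have "(2 * (of_nat p - 3 - of_nat k)) * b (k + 1) 0 = - ((of_nat k * (of_nat k + 5) - (of_nat (l - 1) * of_nat (l + 2) - 4)) * b k 0)"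
    by (simp add: eq_neg_iff_add_eq_0)
  also have "of_nat k * (of_nat k + 5) - (of_nat (l - 1) * of_nat (l + 2) - 4) = (0::complex)"
    unfolding k by (simp add: algebra_simps)
  finally have "2 * (of_nat p - 3 - of_nat k) * b (k + 1) 0 = 0" by (simp only: mult_zero_left minus_zero)
  then have "of_nat p - 3 - of_nat k = (0::complex) \<or> b (k + 1) 0 = 0"
    by (metis mult_eq_0_iff zero_neq_numeral)
  moreover have "of_nat p - 3 - of_nat k \<noteq> (0::complex)"
  proof
    assume "of_nat p - 3 - of_nat k = (0::complex)"
    then have "of_nat p = (of_nat (k + 3) :: complex)" by (simp add: algebra_simps)
    then have "p = k + 3" by (simp only: of_nat_eq_iff)
    then show False using p k by simp
  qed
  ultimately show ?thesis using k by simp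
qed

section \<open>The fundamental solutions as binomial partial sums\<close>

definition binomial_partial_sum :: "nat \<Rightarrow> nat \<Rightarrow> real \<Rightarrow> real" where
  "binomial_partial_sum N k x = (\<Sum>j\<le>k. real (N choose j) * x ^ j * (1 - x) ^ (N - j))"

text \<open>The derivatives of consecutive terms telescope, by the absorption identity for binomial
  coefficients, and only the last contribution survives.\<close>

lemma binomial_partial_sum_has_derivative:
  assumes "k < N"
  shows "(binomial_partial_sum N k has_real_derivative - real (N - k) * real (N choose k) * x ^ k * (1 - x) ^ (N - k - 1)) (at x)"
  using assms
proof (induction k)
  case 0
  then show ?case unfolding binomial_partial_sum_def
    by (auto intro!: derivative_eq_intros)
next
  case (Suc k)
  define M where "M = N - k - 2"
  have M: "N - Suc k = Suc M" "N - k = Suc (Suc M)" "N - Suc k - 1 = M" "N - k - 1 = Suc M" using Suc.prems by (auto simp: M_def)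
  have IH: "(binomial_partial_sum N k has_real_derivative - real (N - k) * real (N choose k) * x ^ k * (1 - x) ^ (N - k - 1)) (at x)"
    using Suc by simp
  have "Suc k * (N choose Suc k) = (N - k) * (N choose k)"
    using binomial_absorb_comp[of N k] binomial_absorption[of k N] by simp
  then have ch: "real (Suc k) * real (N choose Suc k) = real (N - k) * real (N choose k)"
    by (metis of_nat_mult)
  have "((\<lambda>x. binomial_partial_sum N k x + real (N choose Suc k) * (x ^ Suc k * (1 - x) ^ Suc M)) has_real_derivative
     - real (N - k) * real (N choose k) * x ^ k * (1 - x) ^ (N - k - 1) +
       real (N choose Suc k) * (real (Suc k) * x ^ k * (1 - x) ^ Suc M - real (Suc M) * (1 - x) ^ M * x ^ Suc k)) (at x)"
    by (rule derivative_eq_intros IH refl | simp del: power_Suc of_nat_Suc)+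
  moreover have "(\<lambda>x. binomial_partial_sum N k x + real (N choose Suc k) * (x ^ Suc k * (1 - x) ^ Suc M)) = binomial_partial_sum N (Suc k)"
    unfolding binomial_partial_sum_def fun_eq_iff by (simp add: M mult_ac)
  moreover have "- real (N - k) * real (N choose k) * x ^ k * (1 - x) ^ (N - k - 1) +
       real (N choose Suc k) * (real (Suc k) * x ^ k * (1 - x) ^ Suc M - real (Suc M) * (1 - x) ^ M * x ^ Suc k)
     = (real (Suc k) * real (N choose Suc k) - real (N - k) * real (N choose k)) * (x ^ k * (1 - x) ^ Suc M)
       - real (N - Suc k) * real (N choose Suc k) * x ^ Suc k * (1 - x) ^ (N - Suc k - 1)"
    unfolding M by (simp add: algebra_simps del: of_nat_Suc power_Suc)
  ultimately show ?case unfolding ch by simp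
qed

lemma gbinomial_minus_one: "(-1 :: real) gchoose k = (-1) ^ k"
  using gbinomial_minus[of "1 :: real" k] by (simp add: binomial_gbinomial[symmetric])

text \<open>For p = l + 1 one upper index in the Jacobi polynomial is -1 and the other 2 l + 1. The
  binomials of -1 are signs, which cancel those of the powers of
  \<open>(\<tau> - 1) / 2\<close>.\<close>

lemma Q1_eq_binomial_partial_sum:
  assumes "2 \<le> l"
  shows "Q1 (l + 1) l \<tau> = binomial_partial_sum (2 * l + 1) (l - 2) ((1 + \<tau>) / 2)"
proof -
  define x where "x = (1 + \<tau>) / 2"
  have y: "(1 - \<tau>) / 2 = 1 - x" "(\<tau> - 1) / 2 = - (1 - x)" "(\<tau> + 1) / 2 = x" by (auto simp: x_def field_simps)
  have e: "real (l - 2) + (real (l + 1) + 2) = real (2 * l + 1)" "real (l - 2) + (- real (l + 1) + 2) = -1"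
    using assms by (auto simp: of_nat_diff)
  have "Q1 (l + 1) l \<tau> = (\<Sum>s\<le>l - 2. (1 - x) ^ (l + 3) * (real (2 * l + 1 choose (l - 2 - s)) * (-1) ^ s * (- (1 - x)) ^ s * x ^ (l - 2 - s)))"
    unfolding Q1_def jacobi_def e y gbinomial_minus_one binomial_gbinomial sum_distrib_left
    by (simp add: numeral_3_eq_3)
  also have "\<dots> = (\<Sum>j\<le>l - 2. real (2 * l + 1 choose j) * x ^ j * (1 - x) ^ (2 * l + 1 - j))"
  proof (rule sum.reindex_bij_witness[where i = "\<lambda>j. l - 2 - j" and j = "\<lambda>s. l - 2 - s"])
    fix s assume s: "s \<in> {..l - 2}"
    have e1: "2 * l + 1 - (l - 2 - s) = (l + 3) + s" using s assms by auto
    have sg: "(-1) ^ s * ((-1) ^ s * z) = z" for z :: real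
      by (simp flip: power_mult_distrib mult.assoc)
    show "real (2 * l + 1 choose (l - 2 - s)) * x ^ (l - 2 - s) * (1 - x) ^ (2 * l + 1 - (l - 2 - s))
      = (1 - x) ^ (l + 3) * (real (2 * l + 1 choose (l - 2 - s)) * (-1) ^ s * (- (1 - x)) ^ s * x ^ (l - 2 - s))"
      unfolding power_minus[of "1 - x"] e1 by (simp only: power_add mult_ac sg)
  qed auto
  finally show ?thesis unfolding binomial_partial_sum_def x_def[symmetric] .
qed

text \<open>Here too one upper index is -1 and the other 2 l + 1. The prefactor with exponent l - 1
  shifts the terms to the degrees from l - 1 to 2 l + 1, exactly those missing from the partial sum;
  the full sum is 1.\<close>

lemma Q3_eq_binomial_partial_sum:
  assumes "2 \<le> l"
  shows "(-1) ^ l * Q3 (l + 1) l \<tau> = 1 - binomial_partial_sum (2 * l + 1) (l - 2) ((1 + \<tau>) / 2)"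
proof -
  define x where "x = (1 + \<tau>) / 2"
  define T where "T j = real (2 * l + 1 choose j) * x ^ j * (1 - x) ^ (2 * l + 1 - j)" for j
  have y: "(\<tau> - 1) / 2 = - (1 - x)" "(\<tau> + 1) / 2 = x" by (auto simp: x_def field_simps)
  have e: "real (l + 2) + (- real (l + 1) - 2) = -1" "real (l + 2) + (real (l + 1) - 2) = real (2 * l + 1)"
    by auto
  have "(-1) ^ l * Q3 (l + 1) l \<tau> = (\<Sum>s\<le>l + 2. (-1) ^ l * (x ^ (l - 1) * ((-1) ^ (l + 2 - s) * real (2 * l + 1 choose s) * (- (1 - x)) ^ s * x ^ (l + 2 - s))))"
    unfolding Q3_def jacobi_def e y gbinomial_minus_one binomial_gbinomial sum_distrib_left x_def[symmetric]
    by (simp add: mult_ac)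
  also have "\<dots> = (\<Sum>j\<in>{l - 1..2 * l + 1}. T j)"
  proof (rule sum.reindex_bij_witness[where i = "\<lambda>j. 2 * l + 1 - j" and j = "\<lambda>s. 2 * l + 1 - s"])
    fix s assume s: "s \<in> {..l + 2}"
    have e1: "2 * l + 1 - s = (l - 1) + (l + 2 - s)" and e2: "2 * l + 1 - (2 * l + 1 - s) = s"
      and e3: "l + (l + 2 - s) + s = 2 * (l + 1)" using s assms by auto
    have "(-1::real) ^ l * (-1) ^ (l + 2 - s) * (-1) ^ s = (-1) ^ (2 * (l + 1))"
      unfolding e3[symmetric] by (simp only: power_add)
    then have sg: "(-1::real) ^ l * (-1) ^ (l + 2 - s) * (-1) ^ s = 1" by simp
    have ch: "2 * l + 1 choose (2 * l + 1 - s) = (2 * l + 1 choose s)"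
      using binomial_symmetric[of s "2 * l + 1"] s assms by simp
    have "(-1) ^ l * (x ^ (l - 1) * ((-1) ^ (l + 2 - s) * real (2 * l + 1 choose s) * (- (1 - x)) ^ s * x ^ (l + 2 - s)))
        = ((-1::real) ^ l * (-1) ^ (l + 2 - s) * (-1) ^ s) * (real (2 * l + 1 choose s) * (x ^ (l - 1) * x ^ (l + 2 - s)) * (1 - x) ^ s)"
      by (subst power_minus) (simp only: mult_ac)
    then have R: "(-1) ^ l * (x ^ (l - 1) * ((-1) ^ (l + 2 - s) * real (2 * l + 1 choose s) * (- (1 - x)) ^ s * x ^ (l + 2 - s)))
        = 1 * (real (2 * l + 1 choose s) * (x ^ (l - 1) * x ^ (l + 2 - s)) * (1 - x) ^ s)"
      unfolding sg .
    show "T (2 * l + 1 - s) = (-1) ^ l * (x ^ (l - 1) * ((-1) ^ (l + 2 - s) * real (2 * l + 1 choose s) * (- (1 - x)) ^ s * x ^ (l + 2 - s)))"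
      unfolding R unfolding T_def ch e2 unfolding e1 power_add by simp
  qed (use assms in auto)
  also have "\<dots> = (\<Sum>j\<le>2 * l + 1. T j) - (\<Sum>j\<le>l - 2. T j)"
  proof -
    have "{..2 * l + 1} = {..l - 2} \<union> {l - 1..2 * l + 1}" "{..l - 2} \<inter> {l - 1..2 * l + 1} = {}" using assms by auto
    then show ?thesis by (simp add: sum.union_disjoint)
  qed
  also have "(\<Sum>j\<le>2 * l + 1. T j) = 1"
    using binomial_ring[of x "1 - x" "2 * l + 1"] unfolding T_def by (simp add: mult_ac)
  finally show ?thesis unfolding binomial_partial_sum_def x_def[symmetric] T_def .
qed

text \<open>\<open>f\<close> is the value of the fundamental solution at \<tau> = 0 and
  \<open>- \<kappa>\<close> its slope there. By the symmetry of the binomial coefficients, 1 - 2 f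
  collects the four central ones, and absorption expresses these by the coefficient in \<kappa>.
  Positivity makes the matrix of initial values invertible.\<close>

lemma binomial_partial_sum_half:
  fixes l :: nat
  assumes "2 \<le> l"
  defines "f \<equiv> binomial_partial_sum (2 * l + 1) (l - 2) (1 / 2)"
    and "\<kappa> \<equiv> real (l + 3) * real (2 * l + 1 choose (l - 2)) / 2 ^ (2 * l + 1)"
  shows "(1 - 2 * f) * (real l - 1) * real l = 4 * (real l + 1) * \<kappa>" and "1 - 2 * f > 0"
proof -
  define N where "N = 2 * l + 1"
  define C where "C j = real (N choose j)" for j
  have f: "2 ^ N * f = (\<Sum>j\<le>l - 2. C j)"
  proof -
    have "2 ^ N * (real (N choose j) * (1 / 2) ^ j * (1 - 1 / 2) ^ (N - j)) = C j" if "j \<le> l - 2" for j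
    proof -
      have "j \<le> N" using that by (simp add: N_def)
      then have "(1 / 2 :: real) ^ j * (1 / 2) ^ (N - j) = (1 / 2) ^ N" by (simp flip: power_add)
      then show ?thesis by (simp add: C_def power_one_over mult_ac field_simps)
    qed
    then show ?thesis unfolding f_def binomial_partial_sum_def sum_distrib_left N_def[symmetric]
      by (intro sum.cong) auto
  qed
  have refl: "(\<Sum>j\<in>{l + 3..N}. C j) = (\<Sum>j\<le>l - 2. C j)"
    by (rule sum.reindex_bij_witness[where i = "\<lambda>j. N - j" and j = "\<lambda>j. N - j"])
      (use assms(1) in \<open>auto simp: N_def C_def binomial_symmetric[symmetric]\<close>)
  have four: "sum C {l - 1, l, l + 1, l + 2} = C (l - 1) + C l + C (l + 1) + C (l + 2)"
    using assms(1) by (cases l) auto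
  have sym: "C (l + 1) = C l" "C (l + 2) = C (l - 1)"
    using binomial_symmetric[of l N] binomial_symmetric[of "l - 1" N] assms(1) by (auto simp: C_def N_def)
  have "2 ^ N = (\<Sum>j\<le>N. C j)"
    using choose_row_sum[of N] unfolding C_def by (metis of_nat_sum of_nat_power of_nat_numeral)
  also have "{..N} = {..l - 2} \<union> ({l - 1, l, l + 1, l + 2} \<union> {l + 3..N})" using assms(1) by (auto simp: N_def)
  also have "(\<Sum>j\<in>\<dots>. C j) = (\<Sum>j\<le>l - 2. C j) + (sum C {l - 1, l, l + 1, l + 2} + (\<Sum>j\<in>{l + 3..N}. C j))"
    using assms(1) by (subst sum.union_disjoint, simp, simp, force, subst sum.union_disjoint) auto
  also have "\<dots> = 2 * (2 ^ N * f) + 2 * (C (l - 1) + C l)"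
    unfolding four refl f sym by simp
  finally have sum: "2 ^ N * (1 - 2 * f) = 2 * (C (l - 1) + C l)"
    by (simp add: right_diff_distrib)
  have "2 ^ N * (1 - 2 * f) > 0" unfolding sum using assms(1) by (simp add: C_def N_def add_pos_pos)
  then show "1 - 2 * f > 0" by (simp add: zero_less_mult_iff)
  have absorb: "real (Suc k) * C (Suc k) = real (N - k) * C k" for k
  proof -
    have "Suc k * (N choose Suc k) = (N - k) * (N choose k)"
      using binomial_absorb_comp[of N k] binomial_absorption[of k N] by simp
    then show ?thesis unfolding C_def by (metis of_nat_mult)
  qed
  have s: "Suc (l - 2) = l - 1" "Suc (l - 1) = l" "N - (l - 2) = l + 3" "N - (l - 1) = l + 2" using assms(1) by (auto simp: N_def)
  have rl: "real (l - 1) = real l - 1" using assms(1) by (simp add: of_nat_diff)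
  have a1: "(real l - 1) * C (l - 1) = real (l + 3) * C (l - 2)"
    using absorb[of "l - 2"] unfolding s rl .
  have a2: "real l * C l = real (l + 2) * C (l - 1)"
    using absorb[of "l - 1"] unfolding s .
  have "2 ^ N * (1 - 2 * f) * (real l - 1) * real l = 2 * (real l * ((real l - 1) * C (l - 1)) + (real l - 1) * (real l * C l))"
    unfolding sum by (simp add: algebra_simps)
  also have "\<dots> = 2 * (2 * (real l + 1)) * ((real l - 1) * C (l - 1))"
    unfolding a2 by (simp add: algebra_simps)
  also have "\<dots> = 2 ^ N * (4 * (real l + 1) * \<kappa>)"
    unfolding a1 unfolding \<kappa>_def N_def[symmetric] C_def by simp
  finally show "(1 - 2 * f) * (real l - 1) * real l = 4 * (real l + 1) * \<kappa>" by (simp add: mult.assoc)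
qed

section \<open>Initial data and the constant D\<close>

lemma matrix_inv_mult_vec:
  fixes A :: "complex ^ 2 ^ 2"
  assumes "invertible A"
  shows "matrix_inv A *v (A *v x) = x"
proof -
  have "matrix_inv A ** A = mat 1"
    using someI_ex[OF assms[unfolded invertible_def]] unfolding matrix_inv_def by blast
  then show ?thesis by (simp add: matrix_vector_mul_assoc)
qed

lemma D_const_eqI:
  assumes l: "2 \<le> l" and f: "f = binomial_partial_sum (2 * l + 1) (l - 2) (1 / 2)"
    and a0: "a 0 (l + 1) l m 0 = A + B * of_real f"
    and a4: "a 4 (l + 1) l m 0 = a 0 (l + 1) l m 0 + of_real (1 - 2 * f) * B"
  shows "D_const a (l + 1) l m = A"
proof -
  have X: "X_mat (l + 1) l 0 = vector [vector [of_real f, of_real (1 - f)], vector [of_real (1 - f), of_real f]]"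
    unfolding X_mat_def minus_zero Q3_eq_binomial_partial_sum[OF l] Q1_eq_binomial_partial_sum[OF l] f by simp
  have "det (X_mat (l + 1) l 0) = - of_real (1 - 2 * f)"
    unfolding X det_2 by (simp add: algebra_simps)
  then have inv: "invertible (X_mat (l + 1) l 0)"
    unfolding invertible_det_nz using binomial_partial_sum_half(2)[OF l, folded f] by (simp del: of_real_diff)
  \<comment> \<open>If a_0 is A + B times the fundamental solution, then (C, D) = (A + B, A),
    because the two entries of the first row of the matrix add up to 1. Invertibility makes this
    pair the one defined from the data.\<close>
  have "X_mat (l + 1) l 0 *v vector [A + B, A] = vector [a 0 (l + 1) l m 0, a 4 (l + 1) l m 0]"
    unfolding X a4 a0 by (simp add: vec_eq_iff forall_2 matrix_vector_mult_def sum_2 algebra_simps)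
  then have "CD_vec a (l + 1) l m = vector [A + B, A]"
    unfolding CD_vec_def using matrix_inv_mult_vec[OF inv] by metis
  then show ?thesis unfolding D_const_def by simp
qed


text \<open>This is the case p = l + 1, in which the constants solve the equation for a_0; the other
  solution is a primitive of an explicit product of powers, recognised as a binomial partial
  sum.\<close>

lemma subcritical_mode_form:
  fixes L :: complex and a0 a0' a0'' a1 a1' :: "real \<Rightarrow> complex"
  assumes l: "2 \<le> l" and L: "L ^ 2 = of_nat (l - 1) * of_nat (l + 2)"
    and a0: "\<And>t. t \<in> {-1..1} \<Longrightarrow> (a0 has_vector_derivative a0' t) (at t within {-1..1})"
    and a0': "\<And>t. t \<in> {-1..1} \<Longrightarrow> (a0' has_vector_derivative a0'' t) (at t within {-1..1})"
    and a1: "\<And>t. t \<in> {-1..1} \<Longrightarrow> (a1 has_vector_derivative a1' t) (at t within {-1..1})"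
    and e0: "\<And>t. t \<in> {-1..1} \<Longrightarrow> (1 + of_real t) * a0' t = (of_nat (l + 1) - 2) * a0 t - L * a1 t"
    and e1: "\<And>t. t \<in> {-1..1} \<Longrightarrow> (1 - of_real t) * a1' t = L * a0 t - (of_nat (l + 1) + 1) * a1 t"
    and t: "t \<in> {-1..0}"
  defines "F \<equiv> \<lambda>t. complex_of_real (binomial_partial_sum (2 * l + 1) (l - 2) ((1 + t) / 2))"
    and "\<kappa> \<equiv> real (l + 3) * real (2 * l + 1 choose (l - 2)) / 2 ^ (2 * l + 1)"
  shows "a0 t = a0 0 - a0' 0 / of_real \<kappa> * (F t - F 0)"
proof -
  obtain k where k: "l = k + 2" using l by (metis add.commute le_Suc_ex)
  have \<kappa>: "\<kappa> > 0" by (simp add: \<kappa>_def)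
  \<comment> \<open>Eliminating \<open>a1\<close> leaves the coefficient (p - 2) (p + 1) - L ^ 2 in
    front of \<open>a0\<close>. It vanishes for p = l + 1, so the equation is of first order in
    \<open>a0'\<close>.\<close>
  have ode: "(1 - of_real t) * (1 + of_real t) * a0'' t = (of_nat k * (1 - of_real t) - of_nat (k + 4) * (1 + of_real t)) * a0' t"
    if t: "t \<in> {-1..1}" for t
  proof -
    have "((\<lambda>t. (1 + of_real t) * a0' t) has_vector_derivative a0' t + (1 + of_real t) * a0'' t) (at t within {-1..1})"
      by (rule derivative_eq_intros refl a0'[OF t] | simp add: algebra_simps)+
    moreover have "((\<lambda>t. (of_nat (l + 1) - 2) * a0 t - L * a1 t) has_vector_derivative (of_nat (l + 1) - 2) * a0' t - L * a1' t) (at t within {-1..1})"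
      by (intro has_vector_derivative_diff has_vector_derivative_mult_right a0[OF t] a1[OF t])
    ultimately have "a0' t + (1 + of_real t) * a0'' t = (of_nat (l + 1) - 2) * a0' t - L * a1' t"
      by (rule vector_derivative_unique_Icc) (use t e0 in auto)
    then have "(1 - of_real t) * (1 + of_real t) * a0'' t = (1 - of_real t) * ((of_nat (l + 1) - 3) * a0' t) - L * ((1 - of_real t) * a1' t)"
      by algebra
    also have "L * ((1 - of_real t) * a1' t) = L ^ 2 * a0 t - (of_nat (l + 1) + 1) * (L * a1 t)"
      unfolding e1[OF t] by (simp add: algebra_simps power2_eq_square)
    also have "L * a1 t = (of_nat (l + 1) - 2) * a0 t - (1 + of_real t) * a0' t"
      using e0[OF t] by (simp add: algebra_simps)
    finally show ?thesis unfolding L unfolding k by (simp add: algebra_simps)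
  qed
  define q where "q t = complex_of_real (1 + t) ^ k * complex_of_real (1 - t) ^ (k + 4)" for t
  define q' where "q' t = complex_of_real (real k * (1 + t) ^ (k - 1) * (1 - t) ^ (k + 4) - (1 + t) ^ k * (real (k + 4) * (1 - t) ^ (k + 3)))" for t
  have dq: "(q has_vector_derivative q' t) (at t within S)" for t S
  proof -
    have "((\<lambda>t. (1 + t) ^ k * (1 - t) ^ (k + 4)) has_real_derivative
      (real k * (1 + t) ^ (k - 1) * (1 - t) ^ (k + 4) - (1 + t) ^ k * (real (k + 4) * (1 - t) ^ (k + 3)))) (at t within S)"
      by (rule derivative_eq_intros refl | simp add: algebra_simps)+
    from has_vector_derivative_of_real[OF this] show ?thesis unfolding q_def[abs_def] q'_def by simp
  qed
  have q': "(1 - of_real t) * (1 + of_real t) * q' t = (of_nat k * (1 - of_real t) - of_nat (k + 4) * (1 + of_real t)) * q t" for t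
    unfolding q_def q'_def by (cases k) (simp_all add: algebra_simps eval_nat_numeral)
  have q0: "q t \<noteq> 0" if "t \<in> {-1<..0}" for t
    using that unfolding q_def by (auto simp del: of_real_add of_real_diff)
  \<comment> \<open>\<open>q\<close> solves the same first-order equation as \<open>a0'\<close>, so
    the quotient is constant. The end t = -1 is excluded because \<open>q\<close> vanishes there
    when k > 0.\<close>
  obtain c where c: "\<And>t. t \<in> {-1<..0} \<Longrightarrow> a0' t / q t = c"
  proof (rule has_vector_derivative_zero_constant[of "{-1<..0}" "\<lambda>t. a0' t / q t"])
    fix t :: real assume t: "t \<in> {-1<..0}"
    have "(a0' has_vector_derivative a0'' t) (at t within {-1<..0})"
      by (rule has_vector_derivative_within_subset[OF a0']) (use t in auto)
    then have d: "((\<lambda>t. a0' t / q t) has_vector_derivative (a0'' t * q t - a0' t * q' t) / (q t * q t)) (at t within {-1<..0})"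
      unfolding has_vector_derivative_def
      by (rule has_derivative_eq_rhs[OF has_derivative_divide'[OF _ dq[unfolded has_vector_derivative_def] q0[OF t]]])
        (auto simp: fun_eq_iff scaleR_conv_of_real algebra_simps diff_divide_distrib)
    have "x * (y * v - z * w) = (x * y) * v - z * (x * w)" for x y z v w :: complex
      by (simp add: algebra_simps)
    from this[of "(1 - of_real t) * (1 + of_real t)" "a0'' t" "q t" "a0' t" "q' t"]
    have "(1 - of_real t) * (1 + of_real t) * (a0'' t * q t - a0' t * q' t) = 0"
      using ode[of t] t unfolding q' by simp
    moreover have "1 - complex_of_real t \<noteq> 0" "1 + complex_of_real t \<noteq> 0"
      using t of_real_eq_0_iff[of "1 - t", where 'a = complex] of_real_eq_0_iff[of "1 + t", where 'a = complex] by auto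
    ultimately have "a0'' t * q t - a0' t * q' t = 0" by simp
    then show "((\<lambda>t. a0' t / q t) has_vector_derivative 0) (at t within {-1<..0})" using d by simp
  qed auto
  have "q 0 = 1" by (simp add: q_def)
  then have a0'q: "a0' t = a0' 0 * q t" if "t \<in> {-1<..0}" for t
    using c[of 0] c[OF that] q0[OF that] by (simp add: field_simps)
  have dF: "(F has_vector_derivative - of_real \<kappa> * q t) (at t within S)" for t S
  proof -
    have n: "2 * l + 1 - (l - 2) = l + 3" "2 * l + 1 - (l - 2) - 1 = l + 2" using l by auto
    have "(binomial_partial_sum (2 * l + 1) (l - 2) has_real_derivative
       - real (l + 3) * real (2 * l + 1 choose (l - 2)) * ((1 + t) / 2) ^ (l - 2) * (1 - (1 + t) / 2) ^ (l + 2)) (at ((1 + t) / 2))"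
      using binomial_partial_sum_has_derivative[of "l - 2" "2 * l + 1" "(1 + t) / 2", unfolded n] by simp
    moreover have "((\<lambda>t. (1 + t) / 2) has_real_derivative 1 / 2) (at t within S)"
      by (auto intro!: derivative_eq_intros)
    ultimately have "((\<lambda>t. binomial_partial_sum (2 * l + 1) (l - 2) ((1 + t) / 2)) has_real_derivative
       - real (l + 3) * real (2 * l + 1 choose (l - 2)) * ((1 + t) / 2) ^ (l - 2) * (1 - (1 + t) / 2) ^ (l + 2) * (1 / 2)) (at t within S)"
      by (rule DERIV_chain2)
    moreover have "- real (l + 3) * real (2 * l + 1 choose (l - 2)) * ((1 + t) / 2) ^ (l - 2) * (1 - (1 + t) / 2) ^ (l + 2) * (1 / 2)
        = - \<kappa> * ((1 + t) ^ k * (1 - t) ^ (k + 4))"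
    proof -
      have e: "1 - (1 + t) / 2 = (1 - t) / 2" by (simp add: field_simps)
      have "2 * l + 1 = k + (k + 4) + 1" using k by simp
      then have p: "(2::real) ^ (2 * l + 1) = 2 ^ k * 2 ^ (k + 4) * 2" by (simp only: power_add power_one_right)
      have lk: "l - 2 = k" "l + 2 = k + 4" using k by auto
      show ?thesis unfolding \<kappa>_def p e power_divide lk by (simp del: of_nat_add)
    qed
    ultimately have "((\<lambda>t. binomial_partial_sum (2 * l + 1) (l - 2) ((1 + t) / 2)) has_real_derivative - \<kappa> * ((1 + t) ^ k * (1 - t) ^ (k + 4))) (at t within S)"
      by simp
    from has_vector_derivative_of_real[OF this] show ?thesis unfolding F_def q_def by simp
  qed
  define K where "K = a0' 0 / of_real \<kappa>"
  define g where "g t = a0 t + K * F t" for t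
  obtain d where d: "\<And>t. t \<in> {-1<..0} \<Longrightarrow> g t = d"
  proof (rule has_vector_derivative_zero_constant[of "{-1<..0}" g])
    fix t :: real assume t: "t \<in> {-1<..0}"
    have "(a0 has_vector_derivative a0' 0 * q t) (at t within {-1<..0})"
      unfolding a0'q[OF t, symmetric]
      by (rule has_vector_derivative_within_subset[OF a0]) (use t in auto)
    then have "(g has_vector_derivative (a0' 0 * q t + K * (- of_real \<kappa> * q t))) (at t within {-1<..0})"
      unfolding g_def[abs_def] by (intro has_vector_derivative_add has_vector_derivative_mult_right dF)
    then show "(g has_vector_derivative 0) (at t within {-1<..0})" using \<kappa> by (simp add: K_def)
  qed auto
  \<comment> \<open>Past null infinity itself, t = -1, is reached by continuity.\<close>
  have "continuous_on {-1..1} a0"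
    using a0 by (rule continuous_on_vector_derivative)
  then have "continuous_on {-1..0} a0" by (rule continuous_on_subset) auto
  moreover have "continuous_on {-1..0} F" by (rule continuous_on_vector_derivative[OF dF])
  ultimately have "continuous_on {-1..0} g"
    unfolding g_def[abs_def] by (intro continuous_intros)
  then have "g t = d"
    using continuous_constant_on_closure[of "{-1<..0}" g d t] d t by simp
  moreover have "g 0 = d" by (rule d) simp
  ultimately have "g t = g 0" by simp
  then show ?thesis unfolding g_def K_def[symmetric] by (simp add: algebra_simps)
qed

lemma higher_pderiv_eq_0: "degree P < k \<Longrightarrow> (pderiv ^^ k) P = 0" for P :: "real poly"
proof (induction k arbitrary: P)
  case (Suc k)
  show ?case
  proof (cases "degree P = 0")
    case True
    then have "pderiv P = 0" by (simp add: pderiv_eq_0_iff)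
    moreover have "(pderiv ^^ k) 0 = (0 :: real poly)" by (induction k) simp_all
    ultimately show ?thesis by (simp add: funpow_Suc_right del: funpow.simps)
  next
    case False
    then have "degree (pderiv P) < k" using Suc.prems by (simp add: degree_pderiv)
    then show ?thesis using Suc.IH by (simp add: funpow_Suc_right del: funpow.simps)
  qed
qed simp

lemma inverse_power_two_minus_has_derivative:
  fixes c :: real
  assumes "u \<noteq> 2"
  shows "((\<lambda>u. c / (2 - u) ^ n) has_real_derivative c * real n / (2 - u) ^ Suc n) (at u within S)"
proof -
  have w: "2 - u \<noteq> 0" using assms by auto
  have "((\<lambda>u. inverse ((2 - u) ^ n)) has_real_derivative
      - (inverse ((2 - u) ^ n) * (real n * (-1 * (2 - u) ^ (n - Suc 0))) * inverse ((2 - u) ^ n))) (at u within S)"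
    using w by (intro DERIV_inverse' DERIV_power) (auto intro!: derivative_eq_intros)
  from DERIV_cmult[OF this, of c]
  have d: "((\<lambda>u. c / (2 - u) ^ n) has_real_derivative
      c * - (inverse ((2 - u) ^ n) * (real n * (-1 * (2 - u) ^ (n - Suc 0))) * inverse ((2 - u) ^ n))) (at u within S)"
    unfolding divide_inverse .
  have "c * - (inverse (x ^ n) * (real n * (-1 * x ^ (n - Suc 0))) * inverse (x ^ n)) = c * real n / x ^ Suc n" if "x \<noteq> 0" for x
    using that by (cases n) (simp_all add: field_simps)
  with d w show ?thesis by metis
qed

text \<open>Division by the power of 2 - u leaves a polynomial of degree below the order of
  differentiation next to a multiple of (2 - u) ^ -(l + 3). Differentiating the latter l - 1 times
  produces the Pochhammer symbol, and u = 0 the power of 2.\<close>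

lemma subcritical_coefficient:
  assumes l: "2 \<le> l" and b: "derivative_chain b"
    and b0: "\<And>u. u \<in> {0..1} \<Longrightarrow> of_real (2 - u) ^ (l + 3) * b 0 u
       = A + B * complex_of_real (binomial_partial_sum (2 * l + 1) (l - 2) (u / 2))"
  shows "b (l - 1) 0 = A * of_real (pochhammer (real (l + 3)) (l - 1) / 2 ^ (2 * l + 2))"
proof -
  \<comment> \<open>Every term of the partial sum contains at least l + 3 factors 2 - u, since its
    index is at most l - 2 out of 2 l + 1; \<open>P\<close> is what remains after removing
    them.\<close>
  define P where "P = (\<Sum>j\<le>l - 2. smult (real (2 * l + 1 choose j) / 2 ^ (2 * l + 1)) ([:0, 1:] ^ j * [:2, -1:] ^ (l - 2 - j)))"
  have "degree ([:0, 1:] ^ j * [:2, -1:] ^ (l - 2 - j) :: real poly) \<le> l - 2" if "j \<le> l - 2" for j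
  proof -
    have "degree ([:0, 1:] ^ j * [:2, -1:] ^ (l - 2 - j) :: real poly) \<le> degree ([:0, 1:] ^ j :: real poly) + degree ([:2, -1:] ^ (l - 2 - j) :: real poly)"
      by (rule degree_mult_le)
    also have "\<dots> \<le> 1 * j + 1 * (l - 2 - j)"
      using degree_power_le[of "[:0, 1:] :: real poly" j] degree_power_le[of "[:2, -1:] :: real poly" "l - 2 - j"]
      by (intro add_mono) auto
    finally show ?thesis using that by simp
  qed
  then have "degree P \<le> l - 2"
    unfolding P_def by (intro degree_sum_le) (auto intro: order_trans[OF degree_smult_le])
  then have Pl: "(pderiv ^^ (l - 1)) P = 0" using l by (intro higher_pderiv_eq_0) auto
  have P: "binomial_partial_sum (2 * l + 1) (l - 2) (u / 2) = (2 - u) ^ (l + 3) * poly P u" for u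
    unfolding P_def poly_sum binomial_partial_sum_def sum_distrib_left
  proof (intro sum.cong refl)
    fix j assume j: "j \<in> {..l - 2}"
    have e: "1 - u / 2 = (2 - u) / 2" by (simp add: field_simps)
    define M where "M = l - 2 - j"
    have n: "2 * l + 1 - j = (l + 3) + M" "2 * l + 1 = j + ((l + 3) + M)" using j l by (auto simp: M_def)
    have p: "(2::real) ^ (2 * l + 1) = 2 ^ j * 2 ^ ((l + 3) + M)" unfolding n(2) by (simp only: power_add)
    show "real (2 * l + 1 choose j) * (u / 2) ^ j * (1 - u / 2) ^ (2 * l + 1 - j)
      = (2 - u) ^ (l + 3) * poly (smult (real (2 * l + 1 choose j) / 2 ^ (2 * l + 1)) ([:0, 1:] ^ j * [:2, -1:] ^ (l - 2 - j))) u"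
      unfolding e power_divide n(1) p M_def[symmetric] by (simp add: power_add)
  qed
  define c where "c k u = A * of_real (pochhammer (real (l + 3)) k / (2 - u) ^ (l + 3 + k)) + B * of_real (poly ((pderiv ^^ k) P) u)" for k u
  have cc: "derivative_chain c"
    unfolding derivative_chain_def
  proof (intro allI ballI)
    fix k and u :: real assume u: "u \<in> {0..1}"
    have d1: "((\<lambda>u. pochhammer (real (l + 3)) k / (2 - u) ^ (l + 3 + k)) has_real_derivative
       pochhammer (real (l + 3)) (Suc k) / (2 - u) ^ (l + 3 + Suc k)) (at u within {0..1})"
      using inverse_power_two_minus_has_derivative[of u "pochhammer (real (l + 3)) k" "l + 3 + k" "{0..1}"] u
      unfolding pochhammer_Suc of_nat_add[symmetric] add_Suc_right by simp
    have d2: "(poly ((pderiv ^^ k) P) has_real_derivative poly ((pderiv ^^ Suc k) P) u) (at u within {0..1})"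
      using poly_DERIV[of "(pderiv ^^ k) P" u] by (simp add: has_field_derivative_at_within)
    show "(c k has_vector_derivative c (Suc k) u) (at u within {0..1})"
      unfolding c_def[abs_def]
      by (intro has_vector_derivative_add has_vector_derivative_mult_right has_vector_derivative_of_real d1 d2)
  qed
  have bc: "b 0 u = c 0 u" if u: "u \<in> {0..1}" for u
  proof -
    have nz: "complex_of_real (2 - u) \<noteq> 0" unfolding of_real_eq_0_iff using u by auto
    have "of_real (2 - u) ^ (l + 3) * b 0 u = of_real (2 - u) ^ (l + 3) * c 0 u"
      unfolding b0[OF u] P c_def using nz by (simp add: distrib_left mult_ac)
    then show ?thesis using nz by simp
  qed
  have "b (l - 1) 0 = c (l - 1) 0" by (rule derivative_chain_unique[OF b cc bc]) auto
  also have "\<dots> = A * of_real (pochhammer (real (l + 3)) (l - 1) / 2 ^ (2 * l + 2))"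
  proof -
    have "l + 3 + (l - 1) = 2 * l + 2" using l by simp
    then show ?thesis unfolding c_def Pl by (simp del: of_real_divide)
  qed
  finally show ?thesis .
qed

text \<open>The constraints at \<tau> = 0 split by parity: a_1 + a_3 is governed by a_0 + a_4, after
  elimination of a_2, and a_1 - a_3 by a_0 - a_4. In the slope the multiples of a_0 and a_4
  recombine into one of a_0 - a_4.\<close>

lemma subcritical_initial_slope:
  fixes L0 L1 :: complex
  assumes L1: "L1 ^ 2 = of_nat (l - 1) * of_nat (l + 2)" and L0: "L0 ^ 2 = of_nat l * of_nat (l + 1)" and l: "2 \<le> l"
    and e0: "a0' = (of_nat (l + 1) - 2) * a0 - L1 * a1"
    and c1: "of_nat (l + 1) * a1 = L0 / 2 * a2 + L1 / 2 * a0"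
    and c2: "of_nat (l + 1) * a2 = L0 / 2 * a3 + L0 / 2 * a1"
    and c3: "of_nat (l + 1) * a3 = L1 / 2 * a4 + L0 / 2 * a2"
  shows "4 * (of_nat l + 1) * a0' = (of_nat l - 1) * of_nat l * (a0 - a4)"
proof -
  define x :: complex where "x = of_nat l"
  have x: "of_nat (l + 1) = x + 1" "of_nat l = x" "of_nat (l + 2) = x + 2" "of_nat (l - 1) = x - 1"
    using l by (auto simp: x_def of_nat_diff)
  have x1: "x + 1 \<noteq> 0" unfolding x(1)[symmetric] of_nat_eq_0_iff by simp
  have x2: "x + 2 \<noteq> 0" unfolding x(3)[symmetric] of_nat_eq_0_iff by simp
  note L = L1[unfolded x] L0[unfolded x]
  define S where "S = a1 + a3"
  have c1': "2 * (x + 1) * a1 = L0 * a2 + L1 * a0" and c3': "2 * (x + 1) * a3 = L1 * a4 + L0 * a2"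
    and c2': "2 * (x + 1) * a2 = L0 * S"
    using c1 c2 c3 unfolding x S_def by (auto simp: field_simps)
  have "2 * (x + 1) * S = 2 * (L0 * a2) + L1 * (a0 + a4)"
    using c1' c3' unfolding S_def by (simp add: algebra_simps)
  then have "2 * (x + 1) * (x + 1) * S = L0 * (2 * (x + 1) * a2) + (x + 1) * (L1 * (a0 + a4))"
    by algebra
  also have "\<dots> = (x + 1) * (x * S + L1 * (a0 + a4))"
    unfolding c2' using L(2) by algebra
  finally have "(x + 1) * (2 * (x + 1) * S) = (x + 1) * (x * S + L1 * (a0 + a4))" by (simp only: mult_ac)
  then have "2 * (x + 1) * S = x * S + L1 * (a0 + a4)" using x1 by simp
  then have "(x + 2) * (L1 * S) = L1 ^ 2 * (a0 + a4)" by algebra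
  then have "(x + 2) * (L1 * S) = (x + 2) * ((x - 1) * (a0 + a4))" unfolding L by (simp only: mult_ac)
  then have S: "L1 * S = (x - 1) * (a0 + a4)" using x2 by simp
  have D: "2 * (x + 1) * (L1 * (a1 - a3)) = (x - 1) * (x + 2) * (a0 - a4)"
    using c1' c3' L(1) by algebra
  have "4 * (x + 1) * a0' = 4 * (x + 1) * (x - 1) * a0 - 2 * (x + 1) * (L1 * S) - 2 * (x + 1) * (L1 * (a1 - a3))"
    unfolding e0 x S_def by algebra
  then show ?thesis unfolding S D x_def[symmetric] by algebra
qed

lemma raise_factor_squares:
  assumes "2 \<le> l"
  shows "complex_of_real (raise_factor 1 l) ^ 2 = of_nat (l - 1) * of_nat (l + 2)"
    and "complex_of_real (raise_factor 0 l) ^ 2 = of_nat l * of_nat (l + 1)"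
proof -
  have "(raise_factor 1 l)\<^sup>2 = real (l - 1) * real (l + 2)" "(raise_factor 0 l)\<^sup>2 = real l * real (l + 1)"
    using assms by (auto simp: raise_factor_def of_nat_diff)
  then show "complex_of_real (raise_factor 1 l) ^ 2 = of_nat (l - 1) * of_nat (l + 2)"
    "complex_of_real (raise_factor 0 l) ^ 2 = of_nat l * of_nat (l + 1)"
    by (metis of_real_power of_real_mult of_real_of_nat_eq)+
qed

text \<open>The chain \<open>b\<close> is left arbitrary, so that the derivatives of a mode along a
  line of constant advanced time can be inserted without computing derivatives of the coefficient
  functions again.\<close>

lemma mode_taylor_coefficient:
  fixes \<phi> :: "nat \<Rightarrow> field" and a :: coeffs
  assumes sp: "massless_spin2 \<phi>" and ex: "has_expansion \<phi> a \<rho>0" and \<rho>0: "0 < \<rho>0"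
    and lm: "2 \<le> l" "\<bar>m\<bar> \<le> int l" "l \<le> p"
    and b: "derivative_chain b" "\<And>u. u \<in> {0..1} \<Longrightarrow> a 0 p l m (u - 1) = of_real (2 - u) ^ (p + 2) * b 0 u"
  shows "b (l - 1) 0 = (if p = l + 1 then D_const a p l m * of_real (pochhammer (real (l + 3)) (l - 1) / 2 ^ (2 * l + 2)) else 0)"
proof -
  define d where "d = (\<lambda>(f :: real \<Rightarrow> complex) t. vector_derivative f (at t within {-1..1}))"
  define A where "A n = a n p l m" for n
  define L1 where "L1 = complex_of_real (raise_factor 1 l)"
  define L0 where "L0 = complex_of_real (raise_factor 0 l)"
  note L = raise_factor_squares[OF lm(1), folded L1_def L0_def]
  have diff: "((d ^^ j) (A n) has_vector_derivative (d ^^ Suc j) (A n) t) (at t within {-1..1})"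
    if "n \<le> 4" "t \<in> {-1..1}" for n j t
  proof -
    have "nat \<bar>2 - int n\<bar> \<le> l" using that lm by auto
    from has_expansion_differentiable[OF ex that(1) this lm(3,2) that(2)]
    show ?thesis unfolding d_def A_def by (simp add: vector_derivative_works)
  qed
  have A0: "(A 0 has_vector_derivative d (A 0) t) (at t within {-1..1})"
    and A0': "(d (A 0) has_vector_derivative d (d (A 0)) t) (at t within {-1..1})"
    and A1: "(A 1 has_vector_derivative d (A 1) t) (at t within {-1..1})" if "t \<in> {-1..1}" for t
    using diff[of 0 t 0] diff[of 0 t 1] diff[of 1 t 0] that by simp_all
  have dA: "vector_derivative (a n p l m) (at t within {-1..1}) = d (A n) t" for n t
    by (simp add: d_def A_def)
  have e0: "(1 + of_real t) * d (A 0) t = (of_nat p - 2) * A 0 t - L1 * A 1 t"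
    and e1: "(1 - of_real t) * d (A 1) t = L1 * A 0 t - (of_nat p + 1) * A 1 t" if "t \<in> {-1..1}" for t
  proof -
    note E = spin2_mode_equations[OF sp ex \<rho>0 that lm, folded L1_def L0_def, unfolded dA, folded A_def]
    show "(1 + of_real t) * d (A 0) t = (of_nat p - 2) * A 0 t - L1 * A 1 t"
      using E(1) by algebra
    show "(1 - of_real t) * d (A 1) t = L1 * A 0 t - (of_nat p + 1) * A 1 t"
    proof -
      \<comment> \<open>Evolution equation minus constraint: the terms with a_2 cancel.\<close>
      have "(1 - of_real t) * d (A 1) t = (d (A 1) t - L1 / 2 * A 0 t + L0 / 2 * A 2 t + A 1 t)
          - (of_real t * d (A 1) t - of_nat p * A 1 t + L0 / 2 * A 2 t + L1 / 2 * A 0 t)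
          + (L1 * A 0 t - (of_nat p + 1) * A 1 t)"
        by (simp add: algebra_simps)
      then show ?thesis unfolding E(2,3) by simp
    qed
  qed
  show ?thesis
  proof (cases "p = l + 1")
    case False
    have "of_real u * (2 - of_real u) * b 2 u = (2 * (of_nat p - 3) + 6 * of_real u) * b 1 u - (L1 ^ 2 - 4) * b 0 u"
      if "u \<in> {0..1}" for u
      by (rule reduced_mode_equation[OF A0 A1 e0 e1 b[folded A_def] that])
    from reduced_mode_coefficient_eq_0[OF b(1) this[unfolded L(1)] lm(1) False] False show ?thesis by simp
  next
    case True
    define F where "F = (\<lambda>t. binomial_partial_sum (2 * l + 1) (l - 2) ((1 + t) / 2))"
    define \<kappa> where "\<kappa> = real (l + 3) * real (2 * l + 1 choose (l - 2)) / 2 ^ (2 * l + 1)"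
    \<comment> \<open>The slope of \<open>F\<close> at 0 is \<open>- \<kappa>\<close>, so these are
      the coefficients of a_0 with respect to \<open>F\<close> and 1. The constant term
      \<open>C\<close> turns out to be the D of the matrix notation, and \<open>B\<close> the
      difference of its C and D.\<close>
    define B where "B = - (d (A 0) 0 / of_real \<kappa>)"
    define C where "C = A 0 0 - B * of_real (F 0)"
    have \<kappa>: "\<kappa> > 0" by (simp add: \<kappa>_def)
    have form: "A 0 t = C + B * of_real (F t)" if "t \<in> {-1..0}" for t
    proof -
      have "A 0 t = A 0 0 - d (A 0) 0 / of_real \<kappa> * (of_real (F t) - of_real (F 0))"
        using subcritical_mode_form[OF lm(1) L(1) A0 A0' A1 e0[unfolded True] e1[unfolded True] that]
        unfolding F_def \<kappa>_def .
      then have "A 0 t = A 0 0 + B * (of_real (F t) - of_real (F 0))" by (simp add: B_def)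
      then show ?thesis unfolding C_def by (simp add: algebra_simps)
    qed
    note half = binomial_partial_sum_half(1)[OF lm(1), folded \<kappa>_def]
    note E = spin2_mode_equations[OF sp ex \<rho>0 _ lm, of 0, folded L1_def L0_def, unfolded dA, folded A_def, simplified]
    have slope: "4 * (of_nat l + 1) * d (A 0) 0 = (of_nat l - 1) * of_nat l * (A 0 0 - A 4 0)"
      by (rule subcritical_initial_slope[OF L lm(1), of _ _ "A 1 0" "A 2 0" "A 3 0"])
        (use E in \<open>simp_all add: True algebra_simps add_eq_0_iff2\<close>)
    have "D_const a (l + 1) l m = C"
    proof (rule D_const_eqI[OF lm(1) refl])
      show "a 0 (l + 1) l m 0 = C + B * of_real (binomial_partial_sum (2 * l + 1) (l - 2) (1 / 2))"
        using form[of 0] by (simp add: A_def True F_def)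
      define f where "f = binomial_partial_sum (2 * l + 1) (l - 2) (1 / 2)"
      \<comment> \<open>\<open>half\<close> relates 1 - 2 f to \<kappa> by the same factors by which
        \<open>slope\<close> relates a_0 - a_4 to the derivative; hence \<kappa> drops out and the
        hypothesis on a_4 follows.\<close>
      have h: "of_real (1 - 2 * f) * (of_nat l - 1) * of_nat l = 4 * (of_nat l + 1) * complex_of_real \<kappa>"
        using arg_cong[OF half, of complex_of_real] unfolding f_def by simp
      have "4 * (of_nat l + 1) * of_real \<kappa> * (of_real (1 - 2 * f) * B) = - (of_real (1 - 2 * f) * (4 * (of_nat l + 1) * d (A 0) 0))"
        unfolding B_def using \<kappa> by (simp add: field_simps)
      also have "\<dots> = 4 * (of_nat l + 1) * of_real \<kappa> * (A 4 0 - A 0 0)"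
        unfolding slope h[symmetric] by (simp add: algebra_simps)
      finally have "of_real (1 - 2 * f) * B = A 4 0 - A 0 0"
      proof (rule mult_left_cancel[THEN iffD1, rotated])
        show "4 * (of_nat l + 1) * complex_of_real \<kappa> \<noteq> 0"
          using \<kappa> of_nat_eq_0_iff[of "l + 1", where 'a = complex] unfolding mult_eq_0_iff
          by (simp add: add.commute)
      qed
      then show "a 4 (l + 1) l m 0 = a 0 (l + 1) l m 0 + of_real (1 - 2 * binomial_partial_sum (2 * l + 1) (l - 2) (1 / 2)) * B"
        unfolding f_def by (simp add: A_def True)
    qed
    moreover have "b (l - 1) 0 = C * of_real (pochhammer (real (l + 3)) (l - 1) / 2 ^ (2 * l + 2))"
    proof (rule subcritical_coefficient[OF lm(1) b(1)])
      fix u :: real assume u: "u \<in> {0..1}"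
      have "of_real (2 - u) ^ (l + 3) * b 0 u = A 0 (u - 1)"
        using b(2)[OF u] by (simp add: A_def True eval_nat_numeral)
      also have "\<dots> = C + B * of_real (F (u - 1))" using u by (intro form) auto
      finally show "of_real (2 - u) ^ (l + 3) * b 0 u = C + B * complex_of_real (binomial_partial_sum (2 * l + 1) (l - 2) (u / 2))"
        by (simp add: F_def)
    qed
    ultimately show ?thesis using True by simp
  qed
qed

section \<open>Expansion at past null infinity\<close>

lemma derivative_chain_continuous:
  assumes "derivative_chain b" "S \<subseteq> {0..1}"
  shows "continuous_on S (b k)"
proof -
  have "(b k has_vector_derivative b (Suc k) u) (at u within {0..1})" if "u \<in> {0..1}" for u
    using assms(1) that unfolding derivative_chain_def by blast
  then have "continuous_on {0..1} (b k)" by (rule continuous_on_vector_derivative)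
  then show ?thesis using assms(2) by (rule continuous_on_subset)
qed

lemma derivative_chain_taylor:
  assumes b: "derivative_chain b"
  obtains M where "\<And>u. u \<in> {0..1} \<Longrightarrow> norm (b 0 u - (\<Sum>i\<le>N. of_real (u ^ i / fact i) * b i 0)) \<le> M * u ^ Suc N"
proof -
  have "bounded (b (Suc N) ` {0..1})"
    by (intro compact_imp_bounded compact_continuous_image derivative_chain_continuous[OF b]) auto
  then obtain M where "\<forall>y\<in>b (Suc N) ` {0..1}. norm y \<le> M" unfolding bounded_iff by blast
  then have M: "\<And>u. u \<in> {0..1} \<Longrightarrow> norm (b (Suc N) u) \<le> M" by blast
  show thesis
  proof (rule that)
    fix u :: real assume u: "u \<in> {0..1}"
    define r where "r x = ((u - x) ^ (Suc N - 1) / fact (Suc N - 1)) *\<^sub>R b (Suc N) x" for x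
    have d: "(b j has_vector_derivative b (Suc j) t) (at t within {0..u})" if "0 \<le> t" "t \<le> u" for j t
      by (rule has_vector_derivative_within_subset[of _ _ _ "{0..1}"])
        (use b that u in \<open>auto simp: derivative_chain_def\<close>)
    have "b 0 u = (\<Sum>i<Suc N. ((u - 0) ^ i / fact i) *\<^sub>R b i 0) + integral {0..u} r"
      unfolding r_def using u d by (intro Taylor_integral) auto
    then have "b 0 u - (\<Sum>i\<le>N. of_real (u ^ i / fact i) * b i 0) = integral {0..u} r"
      by (simp add: scaleR_conv_of_real lessThan_Suc_atMost)
    also have "norm \<dots> \<le> (u ^ N * M) * (u - 0)"
    proof (rule integral_bound)
      show "continuous_on {0..u} r"
        unfolding r_def using u by (intro continuous_intros derivative_chain_continuous[OF b]) auto
      fix t assume t: "t \<in> {0..u}"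
      have "(u - t) ^ N / fact N \<le> (u - t) ^ N / 1"
        by (rule divide_left_mono) (use t fact_ge_1[of N] in auto)
      also have "\<dots> \<le> u ^ N" using t by (auto intro: power_mono)
      finally have "(u - t) ^ N / fact N * norm (b (Suc N) t) \<le> u ^ N * M"
        using t u M[of t] by (intro mult_mono) auto
      then show "norm (r t) \<le> u ^ N * M" using t by (simp add: r_def)
    qed (use u in auto)
    finally show "norm (b 0 u - (\<Sum>i\<le>N. of_real (u ^ i / fact i) * b i 0)) \<le> M * u ^ Suc N"
      by (simp add: mult_ac)
  qed
qed

section \<open>Asymptotic expansions from Taylor polynomials\<close>

lemma is_asymptotic_expansion_iff:
  "is_asymptotic_expansion f c \<longleftrightarrow>
     (\<forall>N. ((\<lambda>r. (f r - (\<Sum>k\<le>N. c k / of_real r ^ (5 + k))) * of_real r ^ (5 + N)) \<longlongrightarrow> 0) at_top)"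
proof -
  have nz: "\<forall>\<^sub>F r in at_top. 1 / complex_of_real r ^ j \<noteq> 0" for j
    using eventually_gt_at_top[of 0] by eventually_elim auto
  show ?thesis
    unfolding is_asymptotic_expansion_def
    using smalloD_tendsto smalloI_tendsto[OF _ nz] by (fastforce simp: field_simps)
qed

lemma is_asymptotic_expansion_unique:
  assumes c: "is_asymptotic_expansion f c" and d: "is_asymptotic_expansion f d"
  shows "c = d"
proof
  fix N show "c N = d N"
  proof (induction N rule: less_induct)
    case (less N)
    have lim: "((\<lambda>r. (f r - (\<Sum>k\<le>N. c k / of_real r ^ (5 + k))) * of_real r ^ (5 + N)
        - (f r - (\<Sum>k\<le>N. d k / of_real r ^ (5 + k))) * of_real r ^ (5 + N)) \<longlongrightarrow> 0 - 0) at_top"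
      using c d unfolding is_asymptotic_expansion_iff by (intro tendsto_diff) auto
    have ev: "\<forall>\<^sub>F r in at_top. (f r - (\<Sum>k\<le>N. c k / of_real r ^ (5 + k))) * of_real r ^ (5 + N)
        - (f r - (\<Sum>k\<le>N. d k / of_real r ^ (5 + k))) * of_real r ^ (5 + N) = d N - c N"
      using eventually_gt_at_top[of 0]
    proof eventually_elim
      case (elim r)
      have "(\<Sum>k<N. c k / of_real r ^ (5 + k)) = (\<Sum>k<N. d k / of_real r ^ (5 + k))"
        using less by (intro sum.cong) auto
      then show ?case using elim by (simp add: lessThan_Suc_atMost[symmetric] field_simps)
    qed
    from lim have "((\<lambda>r::real. d N - c N) \<longlongrightarrow> 0) at_top"
      unfolding tendsto_cong[OF ev] by simp
    then show ?case by (simp add: tendsto_const_iff)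
  qed
qed

lemma derivative_chain_asymptotic_expansion:
  assumes b: "derivative_chain b" and v: "v > 0"
    and f: "\<And>r. r > v \<Longrightarrow> f r = b 0 (v / r) / of_real r ^ 5"
  shows "is_asymptotic_expansion f (\<lambda>k. of_real (v ^ k / fact k) * b k 0)"
  unfolding is_asymptotic_expansion_iff
proof
  fix N
  obtain M where M: "\<And>u. u \<in> {0..1} \<Longrightarrow> norm (b 0 u - (\<Sum>i\<le>N. of_real (u ^ i / fact i) * b i 0)) \<le> M * u ^ Suc N"
    using derivative_chain_taylor[OF b] by blast
  have "((\<lambda>r. M * v ^ Suc N / r) \<longlongrightarrow> 0) at_top"
    by (rule tendsto_divide_0[OF tendsto_const]) (simp add: filterlim_at_top_imp_at_infinity filterlim_ident)
  then show "((\<lambda>r. (f r - (\<Sum>k\<le>N. of_real (v ^ k / fact k) * b k 0 / of_real r ^ (5 + k))) * of_real r ^ (5 + N)) \<longlongrightarrow> 0) at_top"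
  proof (rule Lim_null_comparison[rotated])
    show "\<forall>\<^sub>F r in at_top. norm ((f r - (\<Sum>k\<le>N. of_real (v ^ k / fact k) * b k 0 / of_real r ^ (5 + k))) * of_real r ^ (5 + N)) \<le> M * v ^ Suc N / r"
      using eventually_gt_at_top[of v]
    proof eventually_elim
      case (elim r)
      have r: "r > 0" using elim v by simp
      have "(\<Sum>k\<le>N. of_real (v ^ k / fact k) * b k 0 / of_real r ^ (5 + k)) = (\<Sum>i\<le>N. of_real ((v / r) ^ i / fact i) * b i 0) / of_real r ^ 5"
        unfolding sum_divide_distrib by (intro sum.cong refl) (simp add: power_divide power_add field_simps)
      then have "(f r - (\<Sum>k\<le>N. of_real (v ^ k / fact k) * b k 0 / of_real r ^ (5 + k))) * of_real r ^ (5 + N)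
         = (b 0 (v / r) - (\<Sum>i\<le>N. of_real ((v / r) ^ i / fact i) * b i 0)) * of_real r ^ N"
        using r by (simp only: f[OF elim]) (simp add: power_add diff_divide_distrib[symmetric])
      also have "norm \<dots> \<le> (M * (v / r) ^ Suc N) * r ^ N"
        unfolding norm_mult norm_power norm_of_real using r v elim
        by (simp only: abs_of_pos) (intro mult_right_mono M, auto)
      also have "\<dots> = M * v ^ Suc N / r" using r by (simp add: power_divide field_simps)
      finally show ?case .
    qed
  qed
qed

text \<open>A function given with all its mixed \<tau>- and \<rho>-derivatives, indexed by words.
  Both the field at fixed angles and the single modes are instances, so differentiation along a line
  is carried out once for both.\<close>

definition smooth_family :: "(deriv_op list \<Rightarrow> real \<Rightarrow> real \<Rightarrow> complex) \<Rightarrow> bool" where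
  "smooth_family F \<longleftrightarrow> (\<forall>w. set w \<subseteq> {Tau, Rho} \<longrightarrow>
     continuous_on ({-1..1} \<times> {0..}) (\<lambda>(\<tau>, \<rho>). F w \<tau> \<rho>) \<and>
     (\<forall>\<tau>\<in>{-1..1}. \<forall>\<rho>\<in>{0..}.
        ((\<lambda>t. F w t \<rho>) has_vector_derivative F (w @ [Tau]) \<tau> \<rho>) (at \<tau> within {-1..1}) \<and>
        ((\<lambda>r. F w \<tau> r) has_vector_derivative F (w @ [Rho]) \<tau> \<rho>) (at \<rho> within {0..})))"

text \<open>Along a line of constant advanced time \<open>v\<close>, with \<open>u = 1 + \<tau>\<close>, one has \<open>\<rho> = 1 / (v (2 - u))\<close>.
  A triple \<open>(c, j, w)\<close> stands for the term \<open>c (2 - u) ^ (- j)\<close> times the derivative \<open>w\<close> of the field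
  along this line.\<close>

definition line_eval :: "real \<Rightarrow> (real \<times> nat \<times> deriv_op list) list \<Rightarrow>
    (deriv_op list \<Rightarrow> real \<Rightarrow> real \<Rightarrow> complex) \<Rightarrow> real \<Rightarrow> complex" where
  "line_eval v L F u = (\<Sum>(c, j, w)\<leftarrow>L. of_real (c / (2 - u) ^ j) * F w (u - 1) (1 / (v * (2 - u))))"

text \<open>Product and chain rule: the three terms come from the power of 2 - u, from d\<tau>/du =
  1, and from d\<rho>/du = 1 / (v (2 - u) ^ 2).\<close>

definition line_deriv :: "real \<Rightarrow> (real \<times> nat \<times> deriv_op list) list \<Rightarrow> (real \<times> nat \<times> deriv_op list) list" where
  "line_deriv v L = concat (map (\<lambda>(c, j, w). [(c * real j, j + 1, w), (c, j, w @ [Tau]), (c / v, j + 2, w @ [Rho])]) L)"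

lemma smooth_family_chain_rule:
  assumes F: "smooth_family F" and w: "set w \<subseteq> {Tau, Rho}" and v: "v > 0" and u: "u \<in> {0..1}"
  shows "((\<lambda>u. F w (u - 1) (1 / (v * (2 - u)))) has_vector_derivative
     F (w @ [Tau]) (u - 1) (1 / (v * (2 - u))) + of_real (1 / (v * (2 - u) ^ 2)) * F (w @ [Rho]) (u - 1) (1 / (v * (2 - u))))
     (at u within {0..1})"
proof -
  define X Y where XY: "X = {-1..1::real}" "Y = {0::real..}"
  define g where "g = (\<lambda>u::real. (u - 1, 1 / (v * (2 - u))))"
  have w': "set (w @ [Rho]) \<subseteq> {Tau, Rho}" using w by auto
  \<comment> \<open>Total differentiability up to the boundary of the strip; besides both partial
    derivatives, only continuity of the one in \<rho> has to be supplied.\<close>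
  have D: "((\<lambda>(x, y). F w x y) has_derivative (\<lambda>(tx, ty). tx *\<^sub>R F (w @ [Tau]) x y + blinfun_scaleR_left (F (w @ [Rho]) x y) ty))
     (at (x, y) within X \<times> Y)" if "x \<in> X" "y \<in> Y" for x y
  proof (rule has_derivative_partialsI)
    show "((\<lambda>x. F w x y) has_derivative (\<lambda>tx. tx *\<^sub>R F (w @ [Tau]) x y)) (at x within X)"
      using F w that unfolding smooth_family_def has_vector_derivative_def XY by blast
    show "((\<lambda>y. F w x y) has_derivative blinfun_apply (blinfun_scaleR_left (F (w @ [Rho]) x y))) (at y within Y)"
      if "x \<in> X" "y \<in> Y" for x y
      using F w that unfolding smooth_family_def has_vector_derivative_def XY by auto
    have "continuous_on (X \<times> Y) (\<lambda>(x, y). F (w @ [Rho]) x y)"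
      using F w' unfolding smooth_family_def XY by blast
    then have "continuous_on (X \<times> Y) (\<lambda>z. blinfun_scaleR_left (F (w @ [Rho]) (fst z) (snd z)))"
      unfolding case_prod_beta by (intro bounded_linear.continuous_on[OF bounded_linear_blinfun_scaleR_left])
    then show "continuous (at (x, y) within X \<times> Y) (\<lambda>(x, y). blinfun_scaleR_left (F (w @ [Rho]) x y))"
      using that unfolding case_prod_beta continuous_on_eq_continuous_within by auto
  qed (use that in \<open>auto simp: XY\<close>)
  have u2: "2 - u > 0" using u by auto
  have dr: "((\<lambda>u. 1 / (v * (2 - u))) has_real_derivative 1 / (v * (2 - u) ^ 2)) (at u within {0..1})"
    using inverse_power_two_minus_has_derivative[of u "1 / v" 1 "{0..1}"] u2 by (simp add: power2_eq_square)
  have dg: "(g has_derivative (\<lambda>h. (h, h * (1 / (v * (2 - u) ^ 2))))) (at u within {0..1})"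
    unfolding g_def
    by (intro has_derivative_Pair) (auto intro!: derivative_eq_intros dr[unfolded has_field_derivative_def, THEN has_derivative_eq_rhs] simp: fun_eq_iff)
  have img: "g ` {0..1} \<subseteq> X \<times> Y"
    using v by (auto simp: g_def XY)
  have chain: "((\<lambda>u. (\<lambda>(x, y). F w x y) (g u)) has_derivative
     (\<lambda>h. (\<lambda>(tx, ty). tx *\<^sub>R F (w @ [Tau]) (fst (g u)) (snd (g u)) + blinfun_scaleR_left (F (w @ [Rho]) (fst (g u)) (snd (g u))) ty)
       (h, h * (1 / (v * (2 - u) ^ 2))))) (at u within {0..1})"
    by (rule has_derivative_in_compose2[OF _ img u dg]) (use D in auto)
  show ?thesis
    unfolding has_vector_derivative_def
    by (rule has_derivative_eq_rhs[OF chain[unfolded g_def prod.case fst_conv snd_conv]])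
      (auto simp: fun_eq_iff scaleR_conv_of_real algebra_simps)
qed

lemma line_eval_has_derivative:
  assumes F: "smooth_family F" and v: "v > 0" and u: "u \<in> {0..1}"
    and L: "\<And>c j w. (c, j, w) \<in> set L \<Longrightarrow> set w \<subseteq> {Tau, Rho}"
  shows "(line_eval v L F has_vector_derivative line_eval v (line_deriv v L) F u) (at u within {0..1})"
  using L
proof (induction L)
  case Nil
  then show ?case by (simp add: line_eval_def line_deriv_def)
next
  case (Cons t L)
  obtain c j w where t: "t = (c, j, w)" by (cases t)
  have w: "set w \<subseteq> {Tau, Rho}" using Cons.prems[of c j w] t by auto
  have u2: "2 - u \<noteq> 0" using u by auto
  have "((\<lambda>u. c / (2 - u) ^ j) has_real_derivative c * real j / (2 - u) ^ (j + 1)) (at u within {0..1})"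
    using inverse_power_two_minus_has_derivative[of u c j] u2 by simp
  from has_vector_derivative_mult[OF has_vector_derivative_of_real[OF this] smooth_family_chain_rule[OF F w v u]]
  have "((\<lambda>u. of_real (c / (2 - u) ^ j) * F w (u - 1) (1 / (v * (2 - u)))) has_vector_derivative
     line_eval v (line_deriv v [t]) F u) (at u within {0..1})"
    by (rule has_vector_derivative_eq_rhs)
      (simp add: t line_deriv_def line_eval_def algebra_simps power2_eq_square)
  moreover have "(line_eval v L F has_vector_derivative line_eval v (line_deriv v L) F u) (at u within {0..1})"
    using Cons by auto
  ultimately have "((\<lambda>u. of_real (c / (2 - u) ^ j) * F w (u - 1) (1 / (v * (2 - u))) + line_eval v L F u) has_vector_derivative
     line_eval v (line_deriv v [t]) F u + line_eval v (line_deriv v L) F u) (at u within {0..1})"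
    by (rule has_vector_derivative_add)
  then show ?case by (simp add: t line_eval_def[abs_def] line_deriv_def add.assoc)
qed

text \<open>The initial triple is the prefactor 16 / (\<rho>^2 (1 - \<tau>)^4) along the line, where
  1 - \<tau> = 2 - u. The lists do not depend on the function differentiated, which allows a
  termwise passage to the limit.\<close>

definition line_terms :: "real \<Rightarrow> nat \<Rightarrow> (real \<times> nat \<times> deriv_op list) list" where
  "line_terms v n = (line_deriv v ^^ n) [(16 * v ^ 2, 2, [])]"

lemma line_terms_words: "(c, j, w) \<in> set (line_terms v n) \<Longrightarrow> set w \<subseteq> {Tau, Rho}"
proof (induction n arbitrary: c j w)
  case 0
  then show ?case by (simp add: line_terms_def)
next
  case (Suc n)
  have "line_terms v (Suc n) = line_deriv v (line_terms v n)" by (simp add: line_terms_def)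
  with Suc.prems have "\<exists>c' j' w'. (c', j', w') \<in> set (line_terms v n) \<and> (w = w' \<or> w = w' @ [Tau] \<or> w = w' @ [Rho])"
    unfolding line_deriv_def by fastforce
  then show ?case using Suc.IH by fastforce
qed

lemma line_eval_chain:
  assumes "smooth_family F" "v > 0"
  shows "derivative_chain (\<lambda>n. line_eval v (line_terms v n) F)"
  unfolding derivative_chain_def
proof (intro allI ballI)
  fix k and u :: real assume "u \<in> {0..1}"
  from line_eval_has_derivative[OF assms this, of "line_terms v k"]
  show "(line_eval v (line_terms v k) F has_vector_derivative line_eval v (line_terms v (Suc k)) F u) (at u within {0..1})"
    using line_terms_words[of _ _ _ v k] by (simp add: line_terms_def)
qed

lemma line_eval_0: "line_eval v (line_terms v 0) F u = of_real (16 * v ^ 2 / (2 - u) ^ 2) * F [] (u - 1) (1 / (v * (2 - u)))"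
  by (simp add: line_eval_def line_terms_def)

lemma field_deriv_snoc:
  assumes "set w \<subseteq> {Tau, Rho}"
  shows "field_deriv (w @ [Tau]) s f = d_tau (field_deriv w s f)" "field_deriv (w @ [Rho]) s f = d_rho (field_deriv w s f)"
  using assms by (induction w arbitrary: f) (auto split: deriv_op.splits)

lemma field_deriv_spin_cong:
  assumes "set w \<subseteq> {Tau, Rho}"
  shows "field_deriv w s f = field_deriv w s' f"
  using assms by (induction w arbitrary: f) (auto split: deriv_op.splits)

lemma smooth_family_field:
  assumes f: "smooth_tau_rho f" and \<theta>: "\<theta> \<in> {0<..<pi}"
  shows "smooth_family (\<lambda>w \<tau> \<rho>. field_deriv w s f \<tau> \<rho> \<theta> \<psi>)"
  unfolding smooth_family_def
proof (intro allI impI conjI ballI)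
  fix w assume w: "set w \<subseteq> {Tau, Rho}"
  note s = field_deriv_spin_cong[OF w, of s f 0]
  show "continuous_on ({-1..1} \<times> {0..}) (\<lambda>(\<tau>, \<rho>). field_deriv w s f \<tau> \<rho> \<theta> \<psi>)"
    using f w \<theta> unfolding smooth_tau_rho_def s by blast
  fix \<tau> \<rho> :: real assume p: "\<tau> \<in> {-1..1}" "\<rho> \<in> {0..}"
  have "(\<lambda>t. field_deriv w s f t \<rho> \<theta> \<psi>) differentiable (at \<tau> within {-1..1})"
    "(\<lambda>r. field_deriv w s f \<tau> r \<theta> \<psi>) differentiable (at \<rho> within {0..})"
    using f w \<theta> p unfolding smooth_tau_rho_def s by blast+
  then show "((\<lambda>t. field_deriv w s f t \<rho> \<theta> \<psi>) has_vector_derivative field_deriv (w @ [Tau]) s f \<tau> \<rho> \<theta> \<psi>) (at \<tau> within {-1..1})"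
    "((\<lambda>r. field_deriv w s f \<tau> r \<theta> \<psi>) has_vector_derivative field_deriv (w @ [Rho]) s f \<tau> \<rho> \<theta> \<psi>) (at \<rho> within {0..})"
    unfolding field_deriv_snoc[OF w] d_tau_def d_rho_def by (simp_all add: vector_derivative_works)
qed

text \<open>\<tau> and \<rho> occur in separate factors of a mode, so only the numbers of the two
  kinds of derivatives matter, not their order.\<close>

definition mode_family :: "(real \<Rightarrow> complex) \<Rightarrow> nat \<Rightarrow> deriv_op list \<Rightarrow> real \<Rightarrow> real \<Rightarrow> complex" where
  "mode_family f p w \<tau> \<rho> = ((\<lambda>f t. vector_derivative f (at t within {-1..1})) ^^ count_list w Tau) f \<tau>
     * of_real (poly ((pderiv ^^ count_list w Rho) (monom 1 p)) \<rho>) / fact p"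

lemma mode_family_smooth:
  assumes "\<And>j \<tau>. \<tau> \<in> {-1..1} \<Longrightarrow> ((\<lambda>f t. vector_derivative f (at t within {-1..1})) ^^ j) f differentiable (at \<tau> within {-1..1})"
  shows "smooth_family (mode_family f p)"
  unfolding smooth_family_def
proof (intro allI impI conjI ballI)
  fix w assume w: "set w \<subseteq> {Tau, Rho}"
  define D where "D = (\<lambda>(f :: real \<Rightarrow> complex) t. vector_derivative f (at t within {-1..1}))"
  define i j where "i = count_list w Tau" "j = count_list w Rho"
  have D: "((D ^^ k) f has_vector_derivative (D ^^ Suc k) f \<tau>) (at \<tau> within {-1..1})" if "\<tau> \<in> {-1..1}" for k \<tau>
    using assms[OF that, of k] unfolding D_def by (simp add: vector_derivative_works)
  have "continuous_on {-1..1} ((D ^^ i) f)" using D by (rule continuous_on_vector_derivative)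
  then have "continuous_on ({-1..1} \<times> {0..}) (\<lambda>x. (D ^^ i) f (fst x))"
    by (rule continuous_on_compose2) (auto intro: continuous_intros)
  then show "continuous_on ({-1..1} \<times> {0..}) (\<lambda>(\<tau>, \<rho>). mode_family f p w \<tau> \<rho>)"
    unfolding mode_family_def case_prod_beta D_def[symmetric] i_j_def[symmetric]
    by (intro continuous_intros) auto
  fix \<tau> \<rho> :: real assume p: "\<tau> \<in> {-1..1}" "\<rho> \<in> {0..}"
  show "((\<lambda>t. mode_family f p w t \<rho>) has_vector_derivative mode_family f p (w @ [Tau]) \<tau> \<rho>) (at \<tau> within {-1..1})"
    unfolding mode_family_def D_def[symmetric] i_j_def[symmetric]
    using has_vector_derivative_mult_left[OF D[OF p(1), of i], of "of_real (poly ((pderiv ^^ j) (monom 1 p)) \<rho>) / fact p"]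
    by (simp add: i_j_def)
  have "(poly ((pderiv ^^ j) (monom 1 p)) has_real_derivative poly ((pderiv ^^ Suc j) (monom 1 p)) \<rho>) (at \<rho> within {0..})"
    using poly_DERIV[of "(pderiv ^^ j) (monom 1 p)" \<rho>] by (simp add: has_field_derivative_at_within)
  from has_vector_derivative_mult_right[OF has_vector_derivative_of_real[OF this], of "(D ^^ i) f \<tau> / fact p"]
  show "((\<lambda>r. mode_family f p w \<tau> r) has_vector_derivative mode_family f p (w @ [Rho]) \<tau> \<rho>) (at \<rho> within {0..})"
    unfolding mode_family_def D_def[symmetric] i_j_def[symmetric]
    by (simp add: i_j_def)
qed

text \<open>Induction from the right end of the word, where the last derivative acts. The induction
  hypothesis holds only on the admissible ranges of \<tau> and \<rho>, which is enough for
  derivatives taken within these ranges.\<close>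

lemma field_deriv_mode_word:
  assumes d: "\<And>j \<tau>. \<tau> \<in> {-1..1} \<Longrightarrow>
      ((\<lambda>f t. vector_derivative f (at t within {-1..1})) ^^ j) (a n p l m) differentiable (at \<tau> within {-1..1})"
    and "set w \<subseteq> {Tau, Rho}" "\<tau> \<in> {-1..1}" "\<rho> \<in> {0..}"
  shows "field_deriv w s (mode a n p l m) \<tau> \<rho> \<theta> \<psi> = mode_family (a n p l m) p w \<tau> \<rho> * swsh (2 - int n) l m \<theta> \<psi>"
  using assms(2-)
proof (induction w arbitrary: \<tau> \<rho> rule: rev_induct)
  case Nil
  then show ?case by (simp add: mode_def mode_family_def poly_monom mult_ac)
next
  case (snoc x w)
  have w: "set w \<subseteq> {Tau, Rho}" and x: "x = Tau \<or> x = Rho" using snoc.prems by auto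
  define Y where "Y = swsh (2 - int n) l m \<theta> \<psi>"
  have D: "((\<lambda>t. mode_family (a n p l m) p w t \<rho>) has_vector_derivative mode_family (a n p l m) p (w @ [Tau]) \<tau> \<rho>) (at \<tau> within {-1..1})"
    "((\<lambda>r. mode_family (a n p l m) p w \<tau> r) has_vector_derivative mode_family (a n p l m) p (w @ [Rho]) \<tau> \<rho>) (at \<rho> within {0..})"
    using mode_family_smooth[OF d, of p] w snoc.prems unfolding smooth_family_def by blast+
  show ?case
  proof (cases "x = Tau")
    case True
    have "((\<lambda>t. field_deriv w s (mode a n p l m) t \<rho> \<theta> \<psi>) has_vector_derivative mode_family (a n p l m) p (w @ [Tau]) \<tau> \<rho> * Y) (at \<tau> within {-1..1})"
      by (rule has_vector_derivative_transform[OF snoc.prems(2) _ has_vector_derivative_mult_left[OF D(1), of Y]])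
        (use snoc.IH[OF w] snoc.prems in \<open>auto simp: Y_def\<close>)
    then have "vector_derivative (\<lambda>t. field_deriv w s (mode a n p l m) t \<rho> \<theta> \<psi>) (at \<tau> within {-1..1}) = mode_family (a n p l m) p (w @ [Tau]) \<tau> \<rho> * Y"
      using snoc.prems by (intro vector_derivative_within_closed_interval) auto
    then show ?thesis unfolding True field_deriv_snoc[OF w] d_tau_def Y_def .
  next
    case False
    then have x: "x = Rho" using x by simp
    have "((\<lambda>r. field_deriv w s (mode a n p l m) \<tau> r \<theta> \<psi>) has_vector_derivative mode_family (a n p l m) p (w @ [Rho]) \<tau> \<rho> * Y) (at \<rho> within {0..})"
      by (rule has_vector_derivative_transform[OF snoc.prems(3) _ has_vector_derivative_mult_left[OF D(2), of Y]])
        (use snoc.IH[OF w] snoc.prems in \<open>auto simp: Y_def\<close>)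
    then have "vector_derivative (\<lambda>r. field_deriv w s (mode a n p l m) \<tau> r \<theta> \<psi>) (at \<rho> within {0..}) = mode_family (a n p l m) p (w @ [Rho]) \<tau> \<rho> * Y"
      using snoc.prems by (intro vector_derivative_within at_within_Ici_nontrivial) auto
    then show ?thesis unfolding x field_deriv_snoc[OF w] d_rho_def Y_def .
  qed
qed

lemma phi4_coeff_eq_line_eval:
  assumes \<phi>: "smooth_tau_rho (\<phi> 0)" and v: "v > 0" and \<theta>: "\<theta> \<in> {0<..<pi}"
  shows "phi4_coeff \<phi> v \<theta> \<psi> n = of_real (v ^ n / fact n) * line_eval v (line_terms v n) (\<lambda>w \<tau> \<rho>. field_deriv w 2 (\<phi> 0) \<tau> \<rho> \<theta> \<psi>) 0"
proof -
  define F where "F = (\<lambda>w \<tau> \<rho>. field_deriv w 2 (\<phi> 0) \<tau> \<rho> \<theta> \<psi>)"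
  have "smooth_family F" unfolding F_def by (rule smooth_family_field[OF \<phi> \<theta>])
  note chain = line_eval_chain[OF this v]
  have "is_asymptotic_expansion (\<lambda>r. physical_phi4 \<phi> (v - r) r \<theta> \<psi>) (\<lambda>n. of_real (v ^ n / fact n) * line_eval v (line_terms v n) F 0)"
  proof (rule derivative_chain_asymptotic_expansion[OF chain v])
    fix r assume r: "r > v"
    have "r > 0" using r v by simp
    define u where "u = v / r"
    have u: "0 < u" "u < 1" "v = u * r" using \<open>r > 0\<close> r v by (auto simp: u_def)
    have \<tau>: "tau_of (v - r) r = u - 1" using \<open>r > 0\<close> by (simp add: tau_of_def u_def diff_divide_distrib)
    have "r\<^sup>2 - (v - r)\<^sup>2 = r * (v * (2 - u))" unfolding u(3) by (simp add: power2_eq_square algebra_simps)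
    then have \<rho>: "rho_of (v - r) r = 1 / (v * (2 - u))" using \<open>r > 0\<close> by (simp add: rho_of_def)
    have "16 / ((1 / (v * (2 - u)))\<^sup>2 * (1 - (u - 1)) ^ 4) = 16 * v ^ 2 / (2 - u) ^ 2"
    proof -
      have e: "1 - (u - 1) = 2 - u" by simp
      show ?thesis unfolding e using u v by (simp add: power_divide power_mult_distrib divide_simps flip: power_add)
    qed
    then show "physical_phi4 \<phi> (v - r) r \<theta> \<psi> = line_eval v (line_terms v 0) F (v / r) / of_real r ^ 5"
      unfolding line_eval_0 physical_phi4_def phi4'_def \<tau> \<rho> u_def[symmetric] by (simp add: F_def)
  qed
  then have "phi4_coeff \<phi> v \<theta> \<psi> = (\<lambda>n. of_real (v ^ n / fact n) * line_eval v (line_terms v n) F 0)"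
    unfolding phi4_coeff_def by (intro the_equality is_asymptotic_expansion_unique)
  then show ?thesis by (simp add: F_def)
qed

text \<open>In the surviving mode p = n + 2 the powers of v cancel: v ^ n from the Taylor term and v
  ^ 2 from the prefactor against v ^ -(n + 2) from \<rho> ^ p. Hence the independence of the cut.
  The factor 16 and the two factorials come from the prefactor, the Taylor formula and the expansion
  in \<rho>.\<close>

lemma mode_line_coefficient:
  fixes \<phi> :: "nat \<Rightarrow> field" and a :: coeffs
  assumes sp: "massless_spin2 \<phi>" and ex: "has_expansion \<phi> a \<rho>0" and \<rho>0: "0 < \<rho>0" and v: "v > 0"
    and n: "1 \<le> n" "\<bar>m\<bar> \<le> int (n + 1)" "n + 1 \<le> p"
  shows "of_real (v ^ n / fact n) * line_eval v (line_terms v n) (mode_family (a 0 p (n + 1) m) p) 0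
    = (if p = n + 2 then of_real (16 * pochhammer (real (n + 4)) n / (fact n * fact (n + 2) * 2 ^ (2 * n + 4))) * D_const a (n + 2) (n + 1) m else 0)"
proof -
  \<comment> \<open>Normalisation that removes 16 v ^ 2, p! and the power of v in \<rho> ^ p, so
    that the chain \<open>b\<close> has the form required by
    \<open>mode_taylor_coefficient\<close>.\<close>
  define k where "k = v ^ p * fact p / (16 * v ^ 2)"
  define K where "K = complex_of_real k"
  have K: "K \<noteq> 0" using v by (simp add: K_def k_def)
  define b where "b k u = K * line_eval v (line_terms v k) (mode_family (a 0 p (n + 1) m) p) u" for k u
  have sm: "smooth_family (mode_family (a 0 p (n + 1) m) p)"
    by (rule mode_family_smooth) (rule has_expansion_differentiable[OF ex], use n in auto)
  have chain: "derivative_chain b"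
    using line_eval_chain[OF sm v] unfolding derivative_chain_def b_def
    by (auto intro: has_vector_derivative_mult_right)
  have b0: "a 0 p (n + 1) m (u - 1) = of_real (2 - u) ^ (p + 2) * b 0 u" if u: "u \<in> {0..1}" for u
  proof -
    define x where "x = 2 - u"
    define y z where "y = 16 * v ^ 2 / x ^ 2" "z = 1 / (v * x)"
    have "x \<noteq> 0" using u by (auto simp: x_def)
    then have "x ^ (p + 2) * (k * y * (z ^ p / fact p)) = 1"
      using v unfolding k_def y_z_def power_divide power_mult_distrib power_add by simp
    from arg_cong[OF this, of complex_of_real]
    have e: "of_real x ^ (p + 2) * (K * of_real y * (of_real z ^ p / fact p)) = 1"
      unfolding K_def by simp
    have "of_real x ^ (p + 2) * b 0 u = (of_real x ^ (p + 2) * (K * of_real y * (of_real z ^ p / fact p))) * a 0 p (n + 1) m (u - 1)"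
      unfolding b_def line_eval_0 mode_family_def x_def[symmetric] unfolding y_z_def[symmetric] by (simp add: poly_monom mult_ac)
    then show ?thesis unfolding e unfolding x_def by simp
  qed
  have "2 \<le> n + 1" using n by simp
  have e: "n + 1 - 1 = n" "n + 1 + 1 = n + 2" "n + 1 + 3 = n + 4" "2 * (n + 1) + 2 = 2 * n + 4" by auto
  from mode_taylor_coefficient[OF sp ex \<rho>0 \<open>2 \<le> n + 1\<close> n(2,3) chain b0]
  have bn: "b n 0 = (if p = n + 2 then D_const a p (n + 1) m * of_real (pochhammer (real (n + 4)) n / 2 ^ (2 * n + 4)) else 0)"
    unfolding e .
  have "line_eval v (line_terms v n) (mode_family (a 0 p (n + 1) m) p) 0 = b n 0 / K"
    using K by (simp add: b_def)
  then show ?thesis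
  proof (cases "p = n + 2")
    case True
    have c: "v ^ n / fact n / (v ^ p * fact p / (16 * v ^ 2)) * (x / y) = 16 * x / (fact n * fact (n + 2) * y)" for x y :: real
      using v unfolding True by (simp add: power2_eq_square)
    have "of_real (v ^ n / fact n) * (b n 0 / K) = of_real (v ^ n / fact n / (v ^ p * fact p / (16 * v ^ 2)) * (pochhammer (real (n + 4)) n / 2 ^ (2 * n + 4))) * D_const a (n + 2) (n + 1) m"
      unfolding bn K_def k_def using True by (simp only: of_real_mult of_real_divide if_True refl) (simp add: mult_ac)
    then show ?thesis unfolding c \<open>line_eval v (line_terms v n) _ 0 = b n 0 / K\<close> using True by simp
  qed (simp add: bn)
qed

section \<open>Passage from single modes to the whole field\<close>

lemma uniform_limit_line_eval:
  fixes F :: "nat \<Rightarrow> 'a \<Rightarrow> deriv_op list \<Rightarrow> real \<Rightarrow> real \<Rightarrow> complex"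
  assumes "\<And>w. uniform_limit S (\<lambda>N x. F N x w (u - 1) (1 / (v * (2 - u)))) (\<lambda>x. G x w (u - 1) (1 / (v * (2 - u)))) sequentially"
  shows "uniform_limit S (\<lambda>N x. line_eval v L (F N x) u) (\<lambda>x. line_eval v L (G x) u) sequentially"
proof (induction L)
  case Nil
  then show ?case by (simp add: line_eval_def uniform_limit_const)
next
  case (Cons t L)
  obtain c j w where t: "t = (c, j, w)" by (cases t)
  have "uniform_limit S (\<lambda>N x. of_real (c / (2 - u) ^ j) * F N x w (u - 1) (1 / (v * (2 - u))) + line_eval v L (F N x) u)
      (\<lambda>x. of_real (c / (2 - u) ^ j) * G x w (u - 1) (1 / (v * (2 - u))) + line_eval v L (G x) u) sequentially"
    by (intro uniform_limit_add Cons bounded_linear.uniform_limit[OF bounded_linear_mult_right assms])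
  then show ?case by (simp add: t line_eval_def)
qed

lemma line_eval_sum:
  "line_eval v L (\<lambda>w \<tau> \<rho>. \<Sum>i\<in>I. F i w \<tau> \<rho>) u = (\<Sum>i\<in>I. line_eval v L (F i) u)"
  by (induction L) (auto simp: line_eval_def sum.distrib sum_distrib_left)

lemma line_eval_cmult:
  "line_eval v L (\<lambda>w \<tau> \<rho>. F w \<tau> \<rho> * y) u = line_eval v L F u * y"
  by (induction L) (auto simp: line_eval_def distrib_left distrib_right mult_ac)

lemma line_eval_cong:
  assumes "\<And>c j w. (c, j, w) \<in> set L \<Longrightarrow> F w (u - 1) (1 / (v * (2 - u))) = G w (u - 1) (1 / (v * (2 - u)))"
  shows "line_eval v L F u = line_eval v L G u"
  unfolding line_eval_def by (rule arg_cong[of _ _ sum_list], rule map_cong) (use assms in auto)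

theorem proposition10:
  shows "\<exists>Q :: nat \<Rightarrow> real. \<forall>n \<ge> 1. \<forall>(\<phi> :: nat \<Rightarrow> field) (a :: coeffs) (\<rho>\<^sub>0 :: real) E Es I Is.
           0 < \<rho>\<^sub>0 \<longrightarrow> massless_spin2 \<phi> \<longrightarrow> has_expansion \<phi> a \<rho>\<^sub>0 \<longrightarrow>
           top_mode_form a E Es I Is \<longrightarrow> regularity_condition Es Is \<longrightarrow>
           (\<forall>m. \<bar>m\<bar> \<le> int (n + 1) \<longrightarrow>
             (\<forall>\<rho>c. 0 < \<rho>c \<and> \<rho>c < \<rho>\<^sub>0 \<longrightarrow>
               NP_minus \<phi> \<rho>c (n - 1) m = of_real (Q n) * D_const a (n + 2) (n + 1) m))"
proof (intro exI[of _ "\<lambda>n. 16 * pochhammer (real (n + 4)) n / (fact n * fact (n + 2) * 2 ^ (2 * n + 4))"] allI impI)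
  fix n :: nat and \<phi> :: "nat \<Rightarrow> field" and a :: coeffs and \<rho>0 :: real and E Es I Is and m :: int and \<rho>c :: real
  assume n: "1 \<le> n" and \<rho>0: "0 < \<rho>0" and sp: "massless_spin2 \<phi>" and ex: "has_expansion \<phi> a \<rho>0"
    and m: "\<bar>m\<bar> \<le> int (n + 1)" and \<rho>c: "0 < \<rho>c \<and> \<rho>c < \<rho>0"
  define v where "v = 1 / (2 * \<rho>c)"
  \<comment> \<open>At u = 0 the line meets the cut, \<rho> = \<rho>c, which lies inside the region
    of convergence. The expansion is needed at this point only, not along the line.\<close>
  have v: "v > 0" and vc: "1 / (v * (2 - 0)) = \<rho>c" using \<rho>c by (auto simp: v_def)
  define q where "q = complex_of_real (v ^ n / fact n)"
  define L where "L = line_terms v n"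
  define \<kappa> where "\<kappa> p l k = q * line_eval v L (mode_family (a 0 p l k) p) 0" for p l k
  define f where "f N \<theta> \<psi> = (\<Sum>p = 2..N. \<Sum>l = 2..p. \<Sum>k = - int l..int l. \<kappa> p l k * swsh 2 l k \<theta> \<psi>)" for N \<theta> \<psi>
  define G where "G \<theta> \<psi> = q * line_eval v L (\<lambda>w \<tau> \<rho>. field_deriv w 2 (\<phi> 0) \<tau> \<rho> \<theta> \<psi>) 0" for \<theta> \<psi>
  \<comment> \<open>Partial sums indexed by the derivative word, so that convergence can be invoked
    for each word of \<open>L\<close> separately.\<close>
  define S where "S = (\<lambda>N x w \<tau> \<rho>. \<Sum>p = 2..N. \<Sum>l = 2..p. \<Sum>k = - int l..int l. field_deriv w 2 (mode a 0 p l k) \<tau> \<rho> (fst x) (snd x))"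
  have f_eq: "q * line_eval v L (S N x) 0 = f N (fst x) (snd x)" for N x
  proof -
    have "line_eval v L (\<lambda>w \<tau> \<rho>. field_deriv w 2 (mode a 0 p l k) \<tau> \<rho> (fst x) (snd x)) 0
       = line_eval v L (mode_family (a 0 p l k) p) 0 * swsh 2 l k (fst x) (snd x)"
      if "l \<in> {2..p}" "k \<in> {- int l..int l}" for p l k
    proof -
      have "field_deriv w 2 (mode a 0 p l k) (0 - 1) (1 / (v * (2 - 0))) (fst x) (snd x)
         = mode_family (a 0 p l k) p w (0 - 1) (1 / (v * (2 - 0))) * swsh (2 - int 0) l k (fst x) (snd x)"
        if "set w \<subseteq> {Tau, Rho}" for w
        by (rule field_deriv_mode_word[OF has_expansion_differentiable[OF ex]])
          (use that \<open>l \<in> {2..p}\<close> \<open>k \<in> {- int l..int l}\<close> v in auto)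
      then show ?thesis
        unfolding line_eval_cmult[symmetric] L_def
        by (intro line_eval_cong) (use line_terms_words in fastforce)
    qed
    then show ?thesis unfolding S_def line_eval_sum f_def \<kappa>_def sum_distrib_left
      by (intro sum.cong refl) (simp add: mult_ac)
  qed
  have "uniform_limit ({0<..<pi} \<times> UNIV) (\<lambda>N x. S N x w (0 - 1) (1 / (v * (2 - 0))))
      (\<lambda>x. field_deriv w 2 (\<phi> 0) (0 - 1) (1 / (v * (2 - 0))) (fst x) (snd x)) sequentially" for w
    using expansion_uniform_limit[OF ex, of 0 "-1" \<rho>c w] \<rho>c unfolding vc S_def case_prod_beta by simp
  from bounded_linear.uniform_limit[OF bounded_linear_mult_right uniform_limit_line_eval[where F = S
        and G = "\<lambda>x w \<tau> \<rho>. field_deriv w 2 (\<phi> 0) \<tau> \<rho> (fst x) (snd x)", OF this], of q L]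
  have lim: "uniform_limit ({0<..<pi} \<times> UNIV) (\<lambda>N (\<theta>, \<psi>). f N \<theta> \<psi>) (\<lambda>(\<theta>, \<psi>). G \<theta> \<psi>) sequentially"
    unfolding f_eq G_def case_prod_beta .
  have c: "sphere_continuous (f N)" for N
    unfolding f_def by (intro sphere_continuous_sum sphere_continuous_cmult sphere_continuous_swsh)
  define Z where "Z = of_real (16 * pochhammer (real (n + 4)) n / (fact n * fact (n + 2) * 2 ^ (2 * n + 4))) * D_const a (n + 2) (n + 1) m"
  \<comment> \<open>As soon as the partial sum includes p = n + 2 its projection is constant, every
    other p contributing 0.\<close>
  have "sphere_proj 2 (n + 1) m (f N) = Z" if N: "N \<ge> n + 2" for N
  proof -
    have "sphere_proj 2 (n + 1) m (f N) = (\<Sum>p = n + 1..N. \<kappa> p (n + 1) m)"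
      unfolding f_def using n m by (intro sphere_proj_mode_sum) auto
    also have "\<dots> = (\<Sum>p = n + 1..N. if p = n + 2 then Z else 0)"
      using mode_line_coefficient[OF sp ex \<rho>0 v n m]
      by (intro sum.cong refl) (auto simp: \<kappa>_def q_def L_def Z_def)
    also have "\<dots> = Z" using N by simp
    finally show ?thesis .
  qed
  then have "\<forall>\<^sub>F N in sequentially. sphere_proj 2 (n + 1) m (f N) = Z"
    by (rule eventually_sequentiallyI)
  then have "(\<lambda>N. sphere_proj 2 (n + 1) m (f N)) \<longlonglongrightarrow> Z" by (rule tendsto_eventually)
  with sphere_proj_uniform_limit[OF c lim, of 2 "n + 1" m] have GZ: "sphere_proj 2 (n + 1) m G = Z"
    by (rule LIMSEQ_unique)
  have sm: "smooth_tau_rho (\<phi> 0)" using sp unfolding massless_spin2_def by simp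
  have "NP_minus \<phi> \<rho>c (n - 1) m = sphere_proj 2 (n + 1) m (\<lambda>\<theta> \<psi>. phi4_coeff \<phi> v \<theta> \<psi> n)"
    using n unfolding NP_minus_def sphere_proj_def v_def by simp
  also have "\<dots> = sphere_proj 2 (n + 1) m G"
    by (rule sphere_proj_cong) (simp add: phi4_coeff_eq_line_eval[where \<phi> = \<phi>, OF sm v] G_def q_def L_def)
  finally show "NP_minus \<phi> \<rho>c (n - 1) m
     = of_real (16 * pochhammer (real (n + 4)) n / (fact n * fact (n + 2) * 2 ^ (2 * n + 4))) * D_const a (n + 2) (n + 1) m"
    unfolding GZ Z_def .
qed

end
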